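(* Let $(A,\alpha)$ be a unital C*-dynamical system of multiplicity $d$. Then the mapping $\tau\mapsto\psi_\tau$ with $$\psi_\tau(V_\mu a V_\nu^* )=\begin{cases}\tau(a) & \text{for } \mu=\emptyset=\nu,\\ 0 & \text{otherwise},\end{cases}\qquad a\in A,\ \mu,\nu\in\mathbb{F}_+^d,$$ is an affine weak*-homeomorphism from the state space $S(A)$ onto the space of the ground states on $\mathcal{T}(A,\alpha)$.
   Context: A unital C*-dynamical system $(A,\alpha)$ of multiplicity $d$ (with $1 \le d < \infty$) consists of a unital C*-algebra $A$ and $d$ unital $*$-endomorphisms $\alpha_1,\dots,\alpha_d$ of $A$. $\mathbb{F}_+^d$ is the free semigroup (monoid) of words on $d$ symbols, with empty word $\emptyset$; $|\mu|$ is the length of $\mu$. $\mathcal{T}(A,\alpha)$ (the Toeplitz-Pimsner algebra) is the universal C*-algebra generated by $A$ and elements $V_1,\dots,V_d$ such that $[V_1,\dots,V_d]$ is a row isometry ($V_i^*V_j = \delta_{i,j}1$) and $aV_i = V_i\alpha_i(a)$ for all $a\in A$, $i=1,\dots,d$. The algebra $A$ embeds in it isometrically and the unit of $A$ is its unit. For a word $\mu=\mu_n\cdots\mu_1$ write $V_\mu = V_{\mu_n}\cdots V_{\mu_1}$, with $V_\emptyset = 1$. The elements $V_\mu a V_\nu^*$ span a dense $*$-subalgebra. The gauge action $\{\gamma_z\}_{z\in\mathbb{T}}$ satisfies $\gamma_z(a)=a$, $\gamma_z(V_i)=zV_i$, and $\sigma:\mathbb{R}\to \mathrm{Aut}(\mathcal{T}(A,\alpha))$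 is $\sigma_t=\gamma_{e^{it}}$, so $\sigma_t(V_\mu aV_\nu^* )=e^{i(|\mu|-|\nu|)t}V_\mu aV_\nu^*$; this extends to the entire function $z\mapsto e^{i(|\mu|-|\nu|)z}V_\mu aV_\nu^*$. A state $\psi$ on a C*-algebra $B$ with an action $\sigma$ of $\mathbb{R}$ is a ground state if the function $z\mapsto\psi(x\sigma_z(y))$ is bounded on $\{z\in\mathbb{C}:\mathrm{Im}\,z>0\}$ for all $x,y$ in a dense analytic subset of $B$ (here: the span of the elements $V_\mu aV_\nu^*$). *)

theory Defs
  imports "HOL-Analysis.Analysis" "HOL-Algebra.Ring"
begin

text \<open>
  Two renderings of unital \<open>C\<^sup>*\<close>-algebras are needed: a type class, for the algebra \<open>A\<close> and the
  Toeplitz-Pimsner algebra, and a carrier-based structure, because the universal property of the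
  latter quantifies over all \<open>C\<^sup>*\<close>-algebras.  The map \<open>type_cstar\<close> below turns the first rendering
  into the second.  As \<open>norm 1 = 1\<close> is an axiom of \<open>real_normed_algebra_1\<close>, the types of the
  class are nonzero; the carrier-based structures may be zero.
\<close>

class cstar_algebra = real_normed_algebra_1 + banach +
  fixes scaleC :: "complex \<Rightarrow> 'a \<Rightarrow> 'a"  (infixr "*\<^sub>C" 75)
    and star :: "'a \<Rightarrow> 'a"
  assumes scaleC_add_right: "c *\<^sub>C (x + y) = c *\<^sub>C x + c *\<^sub>C y"
    and scaleC_add_left: "(b + c) *\<^sub>C x = b *\<^sub>C x + c *\<^sub>C x"
    and scaleC_scaleC: "b *\<^sub>C c *\<^sub>C x = (b * c) *\<^sub>C x"
    and scaleR_scaleC: "scaleR r x = complex_of_real r *\<^sub>C x"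
    and mult_scaleC_left: "(c *\<^sub>C x) * y = c *\<^sub>C (x * y)"
    and mult_scaleC_right: "x * (c *\<^sub>C y) = c *\<^sub>C (x * y)"
    and norm_scaleC: "norm (c *\<^sub>C x) = cmod c * norm x"
    and star_add: "star (x + y) = star x + star y"
    and star_scaleC: "star (c *\<^sub>C x) = cnj c *\<^sub>C star x"
    and star_mult: "star (x * y) = star y * star x"
    and star_star: "star (star x) = x"
    and cstar_identity: "norm (star x * x) = (norm x)\<^sup>2"

lemma scaleC_one: "1 *\<^sub>C x = (x :: 'a::cstar_algebra)"
  using scaleR_scaleC[of 1 x] by simp

interpretation cstar: vector_space "scaleC :: complex \<Rightarrow> 'a \<Rightarrow> 'a::cstar_algebra"
  by unfold_locales (simp_all add: scaleC_add_right scaleC_add_left scaleC_scaleC scaleC_one)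

record 'x cstar_struct = "'x ring" +
  scal :: "complex \<Rightarrow> 'x \<Rightarrow> 'x"
  adj :: "'x \<Rightarrow> 'x"
  nrm :: "'x \<Rightarrow> real"

locale cstar_structure = ring B for B (structure) +
  assumes scal_closed: "x \<in> carrier B \<Longrightarrow> scal B c x \<in> carrier B"
    and scal_add_right: "x \<in> carrier B \<Longrightarrow> y \<in> carrier B \<Longrightarrow>
          scal B c (x \<oplus> y) = scal B c x \<oplus> scal B c y"
    and scal_add_left: "x \<in> carrier B \<Longrightarrow> scal B (b + c) x = scal B b x \<oplus> scal B c x"
    and scal_scal: "x \<in> carrier B \<Longrightarrow> scal B b (scal B c x) = scal B (b * c) x"
    and scal_one: "x \<in> carrier B \<Longrightarrow> scal B 1 x = x"
    and scal_mult_left: "x \<in> carrier B \<Longrightarrow> y \<in> carrier B \<Longrightarrow>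
          scal B c x \<otimes> y = scal B c (x \<otimes> y)"
    and scal_mult_right: "x \<in> carrier B \<Longrightarrow> y \<in> carrier B \<Longrightarrow>
          x \<otimes> scal B c y = scal B c (x \<otimes> y)"
    and adj_closed: "x \<in> carrier B \<Longrightarrow> adj B x \<in> carrier B"
    and adj_add: "x \<in> carrier B \<Longrightarrow> y \<in> carrier B \<Longrightarrow> adj B (x \<oplus> y) = adj B x \<oplus> adj B y"
    and adj_scal: "x \<in> carrier B \<Longrightarrow> adj B (scal B c x) = scal B (cnj c) (adj B x)"
    and adj_mult: "x \<in> carrier B \<Longrightarrow> y \<in> carrier B \<Longrightarrow> adj B (x \<otimes> y) = adj B y \<otimes> adj B x"
    and adj_adj: "x \<in> carrier B \<Longrightarrow> adj B (adj B x) = x"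
    and nrm_nonneg: "x \<in> carrier B \<Longrightarrow> 0 \<le> nrm B x"
    and nrm_eq_zero: "x \<in> carrier B \<Longrightarrow> nrm B x = 0 \<longleftrightarrow> x = \<zero>"
    and nrm_triangle: "x \<in> carrier B \<Longrightarrow> y \<in> carrier B \<Longrightarrow> nrm B (x \<oplus> y) \<le> nrm B x + nrm B y"
    and nrm_scal: "x \<in> carrier B \<Longrightarrow> nrm B (scal B c x) = cmod c * nrm B x"
    and nrm_mult: "x \<in> carrier B \<Longrightarrow> y \<in> carrier B \<Longrightarrow> nrm B (x \<otimes> y) \<le> nrm B x * nrm B y"
    and nrm_cstar: "x \<in> carrier B \<Longrightarrow> nrm B (adj B x \<otimes> x) = (nrm B x)\<^sup>2"
    and nrm_complete: "\<lbrakk>\<And>n. s n \<in> carrier B;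
          \<And>e. 0 < e \<Longrightarrow> \<exists>N. \<forall>m\<ge>N. \<forall>n\<ge>N. nrm B (s m \<ominus> s n) < e\<rbrakk> \<Longrightarrow>
          \<exists>l\<in>carrier B. (\<lambda>n::nat. nrm B (s n \<ominus> l)) \<longlonglongrightarrow> 0"

definition type_cstar :: "'a::cstar_algebra cstar_struct" where
  "type_cstar = \<lparr>carrier = UNIV, mult = (*), one = 1, zero = 0, add = (+),
     scal = scaleC, adj = star, nrm = norm\<rparr>"

lemma cstar_structure_type_cstar:
  "cstar_structure (type_cstar :: 'a::cstar_algebra cstar_struct)" (is "cstar_structure ?A")
proof -
  have simps: "carrier ?A = UNIV" "mult ?A = (*)" "one ?A = 1" "zero ?A = 0" "add ?A = (+)"
    "scal ?A = scaleC" "adj ?A = star" "nrm ?A = norm"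
    by (simp_all add: type_cstar_def)
  have "abelian_group ?A"
  proof (rule abelian_groupI)
    fix x assume "x \<in> carrier ?A"
    show "\<exists>y\<in>carrier ?A. y \<oplus>\<^bsub>?A\<^esub> x = \<zero>\<^bsub>?A\<^esub>"
      by (rule bexI[of _ "- x"]) (simp_all add: simps)
  qed (simp_all add: simps add_ac)
  moreover have "Group.monoid ?A"
    by (rule monoidI) (simp_all add: simps mult.assoc)
  ultimately interpret ring ?A
    by (rule ringI) (simp_all add: simps algebra_simps)
  have uminus: "\<ominus>\<^bsub>?A\<^esub> x = - x" for x
    by (rule minus_equality) (simp_all add: simps)
  have minus: "x \<ominus>\<^bsub>?A\<^esub> y = x - y" for x y
    by (simp add: a_minus_def uminus simps)
  show ?thesis
  proof
    fix s :: "nat \<Rightarrow> 'a"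
    assume "\<And>e. 0 < e \<Longrightarrow> \<exists>N. \<forall>m\<ge>N. \<forall>n\<ge>N. nrm ?A (s m \<ominus>\<^bsub>?A\<^esub> s n) < e"
    then have "Cauchy s"
      by (auto simp: Cauchy_def simps minus dist_norm)
    then obtain l where "s \<longlonglongrightarrow> l"
      using Cauchy_convergent convergent_def by blast
    then show "\<exists>l\<in>carrier ?A. (\<lambda>n. nrm ?A (s n \<ominus>\<^bsub>?A\<^esub> l)) \<longlonglongrightarrow> 0"
      by (auto simp: simps minus LIM_zero_iff tendsto_norm_zero_iff)
  qed (simp_all add: simps scaleC_add_right scaleC_add_left scaleC_scaleC scaleC_one
        mult_scaleC_left mult_scaleC_right norm_scaleC star_add star_scaleC star_mult star_star
        cstar_identity norm_triangle_ineq norm_mult_ineq)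
qed

definition star_hom :: "'x cstar_struct \<Rightarrow> 'y cstar_struct \<Rightarrow> ('x \<Rightarrow> 'y) \<Rightarrow> bool" where
  "star_hom A B f \<longleftrightarrow> f \<in> ring_hom A B
     \<and> (\<forall>c. \<forall>x\<in>carrier A. f (scal A c x) = scal B c (f x))
     \<and> (\<forall>x\<in>carrier A. f (adj A x) = adj B (f x))"

text \<open>The multiplicity is \<open>d = CARD('d)\<close>, hence finite and at least one.\<close>

definition dynamical_system :: "('d::finite \<Rightarrow> 'a::cstar_algebra \<Rightarrow> 'a) \<Rightarrow> bool" where
  "dynamical_system \<alpha> \<longleftrightarrow> (\<forall>i. star_hom type_cstar type_cstar (\<alpha> i))"

definition covariant ::
  "('d::finite \<Rightarrow> 'a::cstar_algebra \<Rightarrow> 'a) \<Rightarrow> 'x cstar_struct \<Rightarrow> ('a \<Rightarrow> 'x) \<Rightarrow> ('d \<Rightarrow> 'x) \<Rightarrow> bool"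
where
  "covariant \<alpha> B \<pi> W \<longleftrightarrow> star_hom type_cstar B \<pi>
     \<and> (\<forall>i. W i \<in> carrier B)
     \<and> (\<forall>i j. adj B (W i) \<otimes>\<^bsub>B\<^esub> W j = (if i = j then \<one>\<^bsub>B\<^esub> else \<zero>\<^bsub>B\<^esub>))
     \<and> (\<forall>a i. \<pi> a \<otimes>\<^bsub>B\<^esub> W i = W i \<otimes>\<^bsub>B\<^esub> \<pi> (\<alpha> i a))"

definition generates :: "'b::cstar_algebra set \<Rightarrow> bool" where
  "generates G \<longleftrightarrow> (\<forall>S. G \<subseteq> S \<and> closed S \<and> cstar.subspace S
      \<and> (\<forall>x\<in>S. \<forall>y\<in>S. x * y \<in> S) \<and> (\<forall>x\<in>S. star x \<in> S) \<longrightarrow> S = UNIV)"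

text \<open>
  HOL cannot quantify over types inside a formula, so the universal property ranges over all
  \<open>C\<^sup>*\<close>-algebra structures on subsets of one type.  No generality is lost: it suffices to consider
  algebras \<open>B\<close> generated by the image of \<open>A\<close> and \<open>d\<close> further elements.  Evaluating the
  \<open>*\<close>-polynomials below in these generators yields a dense subset of \<open>B\<close> (scalars are contained
  in \<open>A\<close>), whence \<open>b \<mapsto> (\<lambda>p. \<parallel>b - eval p\<parallel>)\<close> is an injection of \<open>B\<close> into the chosen type.
\<close>

datatype ('a, 'd) star_poly =
  Coeff 'a | Gen 'd
  | Plus "('a, 'd) star_poly" "('a, 'd) star_poly"
  | Times "('a, 'd) star_poly" "('a, 'd) star_poly"
  | Adj "('a, 'd) star_poly"

type_synonym ('a, 'd) universe = "('a, 'd) star_poly \<Rightarrow> real"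

text \<open>\<open>\<iota>\<close> is the canonical map of \<open>A\<close> into the Toeplitz-Pimsner algebra, which is the type \<open>'b\<close>.\<close>

definition toeplitz_pimsner ::
  "('d::finite \<Rightarrow> 'a::cstar_algebra \<Rightarrow> 'a) \<Rightarrow> ('a \<Rightarrow> 'b::cstar_algebra) \<Rightarrow> ('d \<Rightarrow> 'b) \<Rightarrow> bool"
where
  "toeplitz_pimsner \<alpha> \<iota> V \<longleftrightarrow>
     covariant \<alpha> type_cstar \<iota> V \<and> generates (range \<iota> \<union> range V)
     \<and> (\<forall>(B :: ('a, 'd) universe cstar_struct) \<pi> W. cstar_structure B \<and> covariant \<alpha> B \<pi> W \<longrightarrow>
          (\<exists>\<Phi>. star_hom type_cstar B \<Phi> \<and> (\<forall>a. \<Phi> (\<iota> a) = \<pi> a) \<and> (\<forall>i. \<Phi> (V i) = W i)))"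

text \<open>The word \<open>\<mu>\<^sub>n\<cdots>\<mu>\<^sub>1\<close> is the list \<open>[\<mu>\<^sub>n, \<dots>, \<mu>\<^sub>1]\<close>.\<close>

definition V_word :: "('d \<Rightarrow> 'b::cstar_algebra) \<Rightarrow> 'd list \<Rightarrow> 'b" where
  "V_word V \<mu> = prod_list (map V \<mu>)"

definition monom_elt :: "('a \<Rightarrow> 'b::cstar_algebra) \<Rightarrow> ('d \<Rightarrow> 'b) \<Rightarrow> 'd list \<Rightarrow> 'a \<Rightarrow> 'd list \<Rightarrow> 'b"
where
  "monom_elt \<iota> V \<mu> a \<nu> = V_word V \<mu> * \<iota> a * star (V_word V \<nu>)"

definition monom_span :: "('a \<Rightarrow> 'b::cstar_algebra) \<Rightarrow> ('d \<Rightarrow> 'b) \<Rightarrow> 'b set" where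
  "monom_span \<iota> V = cstar.span {monom_elt \<iota> V \<mu> a \<nu> | \<mu> a \<nu>. True}"

definition gauge_action ::
  "('a \<Rightarrow> 'b::cstar_algebra) \<Rightarrow> ('d \<Rightarrow> 'b) \<Rightarrow> complex \<Rightarrow> 'b \<Rightarrow> 'b"
where
  "gauge_action \<iota> V z = (THE \<theta>. star_hom type_cstar type_cstar \<theta> \<and> bij \<theta>
     \<and> (\<forall>a. \<theta> (\<iota> a) = \<iota> a) \<and> (\<forall>i. \<theta> (V i) = z *\<^sub>C V i))"

definition time_evolution ::
  "('a \<Rightarrow> 'b::cstar_algebra) \<Rightarrow> ('d \<Rightarrow> 'b) \<Rightarrow> real \<Rightarrow> 'b \<Rightarrow> 'b"
where
  "time_evolution \<iota> V t = gauge_action \<iota> V (exp (\<i> * complex_of_real t))"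

definition linear_functional :: "('b::cstar_algebra \<Rightarrow> complex) \<Rightarrow> bool" where
  "linear_functional \<psi> \<longleftrightarrow> Vector_Spaces.linear scaleC (*) \<psi>"

definition states :: "('b::cstar_algebra \<Rightarrow> complex) set" where
  "states = {\<psi>. linear_functional \<psi>
     \<and> (\<forall>x. Im (\<psi> (star x * x)) = 0 \<and> 0 \<le> Re (\<psi> (star x * x))) \<and> \<psi> 1 = 1}"

text \<open>\<open>F\<close> is entire (and, necessarily, the only entire function) with \<open>F t = \<sigma>\<^sub>t(y)\<close> for real \<open>t\<close>;
  thus \<open>F z\<close> is \<open>\<sigma>\<^sub>z(y)\<close>.\<close>

definition entire_extension ::
  "(real \<Rightarrow> 'b \<Rightarrow> 'b) \<Rightarrow> 'b \<Rightarrow> (complex \<Rightarrow> 'b::cstar_algebra) \<Rightarrow> bool"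
where
  "entire_extension \<sigma> y F \<longleftrightarrow>
     (\<forall>z. \<exists>D. ((\<lambda>w. inverse (w - z) *\<^sub>C (F w - F z)) \<longlongrightarrow> D) (at z))
     \<and> (\<forall>t. F (complex_of_real t) = \<sigma> t y)"

definition ground_states ::
  "(real \<Rightarrow> 'b \<Rightarrow> 'b) \<Rightarrow> 'b::cstar_algebra set \<Rightarrow> ('b \<Rightarrow> complex) set"
where
  "ground_states \<sigma> D = {\<psi> \<in> states. \<forall>x\<in>D. \<forall>y\<in>D.
     \<exists>F. entire_extension \<sigma> y F \<and> bounded ((\<lambda>z. \<psi> (x * F z)) ` {z. 0 < Im z})}"

definition TP_ground_states ::
  "('a \<Rightarrow> 'b::cstar_algebra) \<Rightarrow> ('d \<Rightarrow> 'b) \<Rightarrow> ('b \<Rightarrow> complex) set"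
where
  "TP_ground_states \<iota> V = ground_states (time_evolution \<iota> V) (monom_span \<iota> V)"

text \<open>The topology of pointwise convergence on a set of functionals.\<close>

definition weak_star :: "('b \<Rightarrow> complex) set \<Rightarrow> ('b \<Rightarrow> complex) topology" where
  "weak_star S = subtopology (product_topology (\<lambda>_. euclidean) UNIV) S"

definition psi_formula ::
  "('a \<Rightarrow> 'b::cstar_algebra) \<Rightarrow> ('d \<Rightarrow> 'b) \<Rightarrow> ('a \<Rightarrow> complex) \<Rightarrow> ('b \<Rightarrow> complex) \<Rightarrow> bool"
where
  "psi_formula \<iota> V \<tau> \<psi> \<longleftrightarrow> linear_functional \<psi> \<and> continuous_on UNIV \<psi>
     \<and> (\<forall>\<mu> a \<nu>. \<psi> (monom_elt \<iota> V \<mu> a \<nu>) = (if \<mu> = [] \<and> \<nu> = [] then \<tau> a else 0))"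

definition psi ::
  "('a \<Rightarrow> 'b::cstar_algebra) \<Rightarrow> ('d \<Rightarrow> 'b) \<Rightarrow> ('a \<Rightarrow> complex) \<Rightarrow> 'b \<Rightarrow> complex"
where
  "psi \<iota> V \<tau> = (THE \<psi>. psi_formula \<iota> V \<tau> \<psi>)"

definition affine_map_on ::
  "('a \<Rightarrow> complex) set \<Rightarrow> (('a \<Rightarrow> complex) \<Rightarrow> ('b \<Rightarrow> complex)) \<Rightarrow> bool"
where
  "affine_map_on S \<Psi> \<longleftrightarrow> (\<forall>\<phi>\<in>S. \<forall>\<psi>\<in>S. \<forall>t::real. 0 \<le> t \<and> t \<le> 1 \<longrightarrow>
     \<Psi> (\<lambda>a. of_real t * \<phi> a + of_real (1 - t) * \<psi> a)
       = (\<lambda>x. of_real t * \<Psi> \<phi> x + of_real (1 - t) * \<Psi> \<psi> x))"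

end

theory Submission
  imports Defs "HOL-Complex_Analysis.Conformal_Mappings" "HOL-Library.Function_Algebras"
begin

text \<open>
  Given a state \<open>\<tau>\<close> of \<open>A\<close>, let the system act on the Fock space of finitely supported functions on
  words with values in \<open>A\<close>, with semi-inner product \<open>\<Sum>\<^sub>\<mu> \<tau>(f(\<mu>)\<^sup>* g(\<mu>))\<close>: the generators act as left
  creation operators and \<open>a\<close> multiplies at \<open>\<mu>\<close> by \<open>\<alpha>\<^sub>\<mu>(a)\<close>.  The completion of the algebra generated
  by these operators is a quotient of the Toeplitz-Pimsner algebra, and its vacuum state pulls back
  to \<open>\<psi>\<^sub>\<tau>\<close>.

  By Cauchy-Schwarz \<open>\<psi>\<^sub>\<tau>\<close> kills \<open>x V\<^sub>\<nu>\<^sup>*\<close> for \<open>\<nu> \<noteq> \<emptyset>\<close>, so only frequencies \<open>|\<mu>| \<ge> 0\<close> survive in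
  \<open>\<psi>\<^sub>\<tau>(x \<sigma>\<^sub>z(y))\<close>, which is therefore bounded on the upper half plane.  Conversely, for a ground state
  \<open>\<psi>\<close> the function \<open>\<psi>(x \<sigma>\<^sub>z(V\<^sub>\<nu>\<^sup>*)) = e\<^sup>-\<^sup>i\<^sup>|\<^sup>\<nu>\<^sup>|\<^sup>z \<psi>(x V\<^sub>\<nu>\<^sup>*)\<close> is bounded there only if \<open>\<psi>(x V\<^sub>\<nu>\<^sup>*) = 0\<close>,
  whence \<open>\<psi> = \<psi>\<^sub>\<tau>\<close> for the restriction \<open>\<tau>\<close> of \<open>\<psi>\<close> to \<open>A\<close>.  Continuity of \<open>\<tau> \<mapsto> \<psi>\<^sub>\<tau>(x)\<close> is clear for
  \<open>x\<close> in the dense span of the monomials and passes to uniform limits.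
\<close>

text \<open>The universal property in \<open>toeplitz_pimsner\<close> speaks of complete structures
  with a definite norm on subsets of one fixed type. The Fock operators in general meet none of
  these demands: the inner product degenerates when \<open>\<tau>\<close> is not faithful, and
  neither the Fock space nor the algebra of operators is complete. The space is left as it is and
  only the algebra is repaired: it is cut down to the star-polynomials in the generators, replaced
  by Cauchy sequences modulo null sequences, which restores definiteness and completeness at once,
  and moved into the prescribed type. The vacuum functional survives all this because it is
  dominated by the operator norm.

  The order facts all go back to one self-adjoint square root of 1 - x, found as a fixed point. It
  makes star-homomorphisms contractive, and it bounds psi at \<open>star (x * y) * (x * y)\<close>
  by (norm x)^2 times psi at \<open>star y * y\<close>. The latter yields both the norm bound for
  states and the boundedness of the multiplication operators on Fock space.\<close>

lemma bounded_bilinear_scaleC: "bounded_bilinear (scaleC :: complex \<Rightarrow> 'a \<Rightarrow> 'a::cstar_algebra)"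
proof
  fix r :: real and c :: complex and x :: 'a
  show "(r *\<^sub>R c) *\<^sub>C x = r *\<^sub>R c *\<^sub>C x"
    by (simp add: scaleR_scaleC scaleC_scaleC scaleR_conv_of_real)
  show "c *\<^sub>C r *\<^sub>R x = r *\<^sub>R c *\<^sub>C x"
    by (simp add: scaleR_scaleC scaleC_scaleC mult.commute)
  show "\<exists>K. \<forall>(a::complex) (b::'a). norm (a *\<^sub>C b) \<le> norm a * norm b * K"
    by (rule exI[of _ 1]) (simp add: norm_scaleC)
qed (simp_all add: scaleC_add_left scaleC_add_right)

interpretation scaleC: bounded_bilinear "scaleC :: complex \<Rightarrow> 'a \<Rightarrow> 'a::cstar_algebra"
  by (rule bounded_bilinear_scaleC)

section \<open>Involution, square roots, contractivity of star-homomorphisms\<close>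

lemma star_zero [simp]: "star (0 :: 'a::cstar_algebra) = 0"
  using star_add[of 0 "0 :: 'a"] by simp

lemma star_minus: "star (- x) = - star (x :: 'a::cstar_algebra)"
  using star_add[of x "- x"] by (simp add: minus_unique)

lemma star_diff: "star (x - y) = star x - star (y :: 'a::cstar_algebra)"
  using star_add[of x "- y"] by (simp add: star_minus)

lemma star_one [simp]: "star (1 :: 'a::cstar_algebra) = 1"
  by (metis mult.left_neutral mult.right_neutral star_mult star_star)

lemma star_scaleR: "star (r *\<^sub>R x) = r *\<^sub>R star (x :: 'a::cstar_algebra)"
  by (simp add: scaleR_scaleC star_scaleC)

lemma norm_star: "norm (star x) = norm (x :: 'a::cstar_algebra)"
proof -
  have le: "norm y \<le> norm (star y)" for y :: 'a
  proof (cases "y = 0")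
    case False
    have "norm y * norm y \<le> norm (star y) * norm y"
      using norm_mult_ineq[of "star y" y] by (simp add: cstar_identity power2_eq_square)
    then show ?thesis
      using False by simp
  qed simp
  from le[of x] le[of "star x"] show ?thesis
    by (simp add: star_star)
qed

lemma bounded_linear_star: "bounded_linear (star :: 'a \<Rightarrow> 'a::cstar_algebra)"
  by (rule bounded_linear_intro[where K = 1]) (simp_all add: star_add star_scaleR norm_star)

text \<open>The fixed point \<open>y\<close> of \<open>y \<mapsto> (x + y\<^sup>2)/2\<close> satisfies \<open>(1 - y)\<^sup>2 = 1 - x\<close>.\<close>

lemma selfadjoint_sqrt:
  fixes x :: "'a::cstar_algebra"
  assumes "star x = x" "norm x < 1"
  obtains k where "star k = k" "k * k = 1 - x" "\<And>w. w * x = x * w \<Longrightarrow> w * k = k * w"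
proof -
  \<comment> \<open>\<open>r\<close> is the smaller root of r^2 - 2 r + norm x = 0. Hence (norm x +
    r^2) / 2 = r, which makes \<open>f\<close> preserve the ball of radius \<open>r\<close>, and r <
    1 serves as contraction constant.\<close>
  define r where "r = 1 - sqrt (1 - norm x)"
  have r: "0 \<le> r" "r < 1"
    using assms(2) by (simp_all add: r_def)
  have "sqrt (1 - norm x) * sqrt (1 - norm x) = 1 - norm x"
    using assms(2) by simp
  then have rr: "norm x + r * r = 2 * r"
    by (simp add: r_def algebra_simps)
  \<comment> \<open>Self-adjointness and commutation with everything that commutes with
    \<open>x\<close> are closed conditions preserved by \<open>f\<close>; as part of the domain they
    pass to the fixed point.\<close>
  define S where "S = {y. norm y \<le> r \<and> star y = y \<and> (\<forall>w. w * x = x * w \<longrightarrow> w * y = y * w)}"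
  define f where "f y = (1/2) *\<^sub>R (x + y * y)" for y
  have "closed S"
    unfolding S_def Collect_conj_eq
    by (intro closed_Int closed_Collect_all closed_Collect_imp open_Collect_const
        closed_Collect_le closed_Collect_eq continuous_intros
        linear_continuous_on bounded_linear_star)
  moreover have "0 \<in> S"
    using r by (simp add: S_def)
  moreover have "f ` S \<subseteq> S"
  proof safe
    fix y assume "y \<in> S"
    then have y: "norm y \<le> r" "star y = y" "\<And>w. w * x = x * w \<Longrightarrow> w * y = y * w"
      by (simp_all add: S_def)
    have "norm (x + y * y) \<le> norm x + norm y * norm y"
      by (meson add_left_mono norm_mult_ineq norm_triangle_ineq order_trans)
    also have "\<dots> \<le> norm x + r * r"
      by (intro add_left_mono mult_mono y r) simp
    finally have "norm (f y) \<le> r"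
      by (simp add: f_def rr)
    moreover have "star (f y) = f y"
      by (simp add: f_def star_scaleR star_add star_mult y(2) assms(1))
    moreover have "w * f y = f y * w" if "w * x = x * w" for w
    proof -
      have "w * (y * y) = (y * y) * w"
        using y(3)[OF that] by (metis mult.assoc)
      then show ?thesis
        using that by (simp add: f_def distrib_left distrib_right)
    qed
    ultimately show "f y \<in> S"
      by (simp add: S_def)
  qed
  moreover have lip: "dist (f y) (f z) \<le> r * dist y z" if "y \<in> S" "z \<in> S" for y z
  proof -
    have yz: "norm (y + z) \<le> 2 * r"
      using that norm_triangle_ineq[of y z] by (simp add: S_def)
    \<comment> \<open>The symmetrised factorisation of the difference of squares holds without
      commutation of \<open>y\<close> and \<open>z\<close>.\<close>
    have "(y - z) * (y + z) + (y + z) * (y - z) = 2 *\<^sub>R (y * y - z * z)"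
      by (simp add: algebra_simps scaleR_2)
    moreover have "2 *\<^sub>R (f y - f z) = y * y - z * z"
      by (simp add: f_def scaleR_diff_right)
    ultimately have "2 *\<^sub>R (f y - f z) = (1/2) *\<^sub>R ((y - z) * (y + z) + (y + z) * (y - z))"
      by simp
    also have "norm \<dots> \<le> (1/2) * (norm (y - z) * norm (y + z) + norm (y + z) * norm (y - z))"
      using norm_triangle_ineq[of "(y - z) * (y + z)" "(y + z) * (y - z)"]
        norm_mult_ineq[of "y - z" "y + z"] norm_mult_ineq[of "y + z" "y - z"]
      by (simp add: mult.commute[of "norm (y + z)"])
    also have "\<dots> = norm (y - z) * norm (y + z)"
      by simp
    also have "\<dots> \<le> norm (y - z) * (2 * r)"
      by (intro mult_left_mono yz) simp
    finally show ?thesis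
      by (simp add: dist_norm mult.commute)
  qed
  ultimately have "\<exists>!y. y \<in> S \<and> f y = y"
    using r by (intro Banach_fix[of S r f]) (auto simp: complete_eq_closed)
  then obtain y where y: "y \<in> S" "f y = y"
    by blast
  have "x + y * y = 2 *\<^sub>R f y"
    by (simp add: f_def)
  then have fp: "x + y * y = y + y"
    by (simp only: y(2)) (simp add: scaleR_2)
  show thesis
  proof
    show "star (1 - y) = 1 - y"
      using y(1) by (simp add: S_def star_diff)
    show "(1 - y) * (1 - y) = 1 - x"
    proof -
      have "(1 - y) * (1 - y) = 1 - ((y + y) - y * y)"
        by (simp add: algebra_simps)
      then show ?thesis
        by (simp flip: fp)
    qed
    show "w * (1 - y) = (1 - y) * w" if "w * x = x * w" for w
      using y(1) that by (simp add: S_def algebra_simps)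
  qed
qed

text \<open>The type-class form of \<open>star_hom\<close>; \<open>star_hom_type_cstar\<close>
  identifies the two, so that the conditions on \<open>\<alpha>\<close>, \<open>\<iota>\<close> and
  the gauge maps can be used by rewriting.\<close>

definition star_homo :: "('a::cstar_algebra \<Rightarrow> 'b::cstar_algebra) \<Rightarrow> bool" where
  "star_homo f \<longleftrightarrow> (\<forall>x y. f (x + y) = f x + f y) \<and> (\<forall>x y. f (x * y) = f x * f y)
     \<and> (\<forall>c x. f (c *\<^sub>C x) = c *\<^sub>C f x) \<and> (\<forall>x. f (star x) = star (f x)) \<and> f 1 = 1"

lemma star_hom_type_cstar: "star_hom type_cstar type_cstar f \<longleftrightarrow> star_homo f"
  by (auto simp: star_hom_def star_homo_def ring_hom_def type_cstar_def)

lemma star_homoD: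
  assumes "star_homo f"
  shows "f (x + y) = f x + f y" "f (x * y) = f x * f y" "f (c *\<^sub>C x) = c *\<^sub>C f x"
    "f (star x) = star (f x)" "f 1 = 1" "f 0 = 0" "f (- x) = - f x" "f (x - y) = f x - f y"
proof -
  interpret Modules.additive f
    by standard (use assms in \<open>simp add: star_homo_def\<close>)
  show "f 0 = 0" "f (- x) = - f x" "f (x - y) = f x - f y"
    by (rule zero minus diff)+
qed (use assms in \<open>simp_all add: star_homo_def\<close>)

text \<open>With \<open>1 - h\<^sup>2 = k\<^sup>2\<close> and \<open>k\<close> commuting with \<open>h\<close>, the element \<open>f h + \<i> f k\<close> is unitary,
  and \<open>f h\<close> is its real part.\<close>

lemma star_homo_norm_selfadjoint:
  assumes f: "star_homo f" and h: "star h = h" "norm h < 1"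
  shows "norm (f h) \<le> 1"
proof -
  have "norm (h * h) < 1"
    using h cstar_identity[of h] by (simp add: power_less_one_iff)
  moreover have "star (h * h) = h * h"
    by (simp add: star_mult h)
  ultimately obtain k where k: "star k = k" "k * k = 1 - h * h"
      "\<And>w. w * (h * h) = (h * h) * w \<Longrightarrow> w * k = k * w"
    using selfadjoint_sqrt by blast
  \<comment> \<open>\<open>h\<close> commutes with \<open>h * h\<close>, so the commutation clause
    of \<open>selfadjoint_sqrt\<close> applies; it cancels the cross terms in
    \<open>star u * u\<close>.\<close>
  have hk: "h * k = k * h"
    by (rule k(3)) (simp add: mult.assoc)
  define u where "u = h + \<i> *\<^sub>C k"
  have su: "star u = h - \<i> *\<^sub>C k"
    by (simp add: u_def star_add star_scaleC h k(1))
  have "star u * u = (h - \<i> *\<^sub>C k) * (h + \<i> *\<^sub>C k)"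
    by (simp only: su) (simp only: u_def)
  also have "\<dots> = 1"
    by (simp add: algebra_simps mult_scaleC_left mult_scaleC_right scaleC_scaleC k(2) hk
        flip: scaleC_add_left)
  finally have "star u * u = 1" .
  then have "star (f u) * f u = 1"
    by (simp flip: star_homoD[OF f])
  then have "(norm (f u))\<^sup>2 = 1"
    by (simp flip: cstar_identity)
  then have nu: "norm (f u) = 1"
    using norm_ge_zero[of "f u"] by (simp only: power2_eq_1_iff) linarith
  have "u + star u = 2 *\<^sub>R h"
    by (simp only: su) (simp add: u_def scaleR_2)
  then have "h = (1/2) *\<^sub>R (u + star u)"
    by simp
  then have "f h = (1/2) *\<^sub>R (f u + star (f u))"
    by (simp add: scaleR_scaleC star_homoD[OF f])
  then have "norm (f h) \<le> (1/2) * (norm (f u) + norm (star (f u)))"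
    using norm_triangle_ineq[of "f u" "star (f u)"] by simp
  then show ?thesis
    by (simp add: norm_star nu)
qed

text \<open>The C*-identity turns the square of norm (f y) into the norm of \<open>f\<close> at the
  self-adjoint element \<open>star y * y\<close>. Dividing by norm x + e instead of norm x keeps the
  norm strictly below 1, as the square root requires, and covers x = 0.\<close>

lemma star_homo_norm_le:
  assumes f: "star_homo f"
  shows "norm (f x) \<le> norm x"
proof (rule field_le_epsilon)
  fix e :: real assume e: "e > 0"
  define r where "r = norm x + e"
  have r: "r > 0" "norm x < r"
    using e by (simp_all add: r_def add_nonneg_pos)
  define y where "y = (1 / r) *\<^sub>R x"
  have y: "norm y < 1"
    using r by (simp add: y_def)
  have "norm (f (star y * y)) \<le> 1"
  proof (rule star_homo_norm_selfadjoint[OF f])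
    show "norm (star y * y) < 1"
      using y by (simp add: cstar_identity power_less_one_iff)
  qed (simp add: star_mult star_star)
  then have "(norm (f y))\<^sup>2 \<le> 1"
    by (simp add: star_homoD[OF f] cstar_identity)
  then have "norm (f y) \<le> 1"
    by (simp add: abs_square_le_1)
  moreover have "f y = (1 / r) *\<^sub>R f x"
    by (simp add: y_def scaleR_scaleC star_homoD[OF f])
  ultimately show "norm (f x) \<le> norm x + e"
    using r by (simp add: r_def divide_le_eq)
qed

lemma star_homo_bounded_linear:
  assumes f: "star_homo f"
  shows "bounded_linear f"
  by (rule bounded_linear_intro[where K = 1])
    (simp_all add: star_homoD[OF f] scaleR_scaleC star_homo_norm_le[OF f])

section \<open>States\<close>

text \<open>A state without its normalisation. The functional pulled back from the Fock algebra is
  at first only known to be positive; its value at 1 is read off later from the monomial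
  formula.\<close>

definition positive_functional :: "('b::cstar_algebra \<Rightarrow> complex) \<Rightarrow> bool" where
  "positive_functional \<psi> \<longleftrightarrow> linear_functional \<psi>
     \<and> (\<forall>x. Im (\<psi> (star x * x)) = 0 \<and> 0 \<le> Re (\<psi> (star x * x)))"

lemma states_iff: "\<psi> \<in> states \<longleftrightarrow> positive_functional \<psi> \<and> \<psi> 1 = 1"
  by (auto simp: states_def positive_functional_def)

lemma linear_functional_iff:
  "linear_functional \<psi> \<longleftrightarrow> (\<forall>x y. \<psi> (x + y) = \<psi> x + \<psi> y) \<and> (\<forall>c x. \<psi> (c *\<^sub>C x) = c * \<psi> x)"
proof -
  have "vector_space ((*) :: complex \<Rightarrow> complex \<Rightarrow> complex)"
    by unfold_locales (simp_all add: algebra_simps)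
  then show ?thesis
    using cstar.vector_space_axioms[where 'a='a]
    by (simp add: linear_functional_def Vector_Spaces.linear_iff)
qed

lemma linear_functionalD:
  assumes "linear_functional \<psi>"
  shows "\<psi> (x + y) = \<psi> x + \<psi> y" "\<psi> (c *\<^sub>C x) = c * \<psi> x" "\<psi> 0 = 0" "\<psi> (- x) = - \<psi> x"
    "\<psi> (x - y) = \<psi> x - \<psi> y" "\<psi> (r *\<^sub>R x) = of_real r * \<psi> x"
proof -
  interpret Modules.additive \<psi>
    by standard (use assms in \<open>simp add: linear_functional_iff\<close>)
  show "\<psi> 0 = 0" "\<psi> (- x) = - \<psi> x" "\<psi> (x - y) = \<psi> x - \<psi> y"
    by (rule zero minus diff)+
qed (use assms in \<open>simp_all add: linear_functional_iff scaleR_scaleC\<close>)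

lemma positive_functionalD:
  assumes "positive_functional \<psi>"
  shows "linear_functional \<psi>" "Im (\<psi> (star x * x)) = 0" "0 \<le> Re (\<psi> (star x * x))"
  using assms by (simp_all add: positive_functional_def)

text \<open>The values at \<open>star w * w\<close> are real for w = x, 1, x + 1 and x + i.
  Expanding the last two relates the imaginary and the real parts of \<open>\<psi> x\<close> and
  \<open>\<psi> (star x)\<close>.\<close>

lemma positive_functional_star:
  assumes \<psi>: "positive_functional \<psi>"
  shows "\<psi> (star x) = cnj (\<psi> x)"
proof -
  note lin = linear_functionalD[OF positive_functionalD(1)[OF \<psi>]]
  have im: "Im (\<psi> (star y * y)) = 0" for y
    by (rule positive_functionalD[OF \<psi>])
  have "Im (\<psi> x) + Im (\<psi> (star x)) = 0"
    using im[of "x + 1"] im[of x] im[of 1] by (simp add: star_add algebra_simps lin)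
  moreover have "Re (\<psi> (star x)) - Re (\<psi> x) = 0"
    using im[of "x + \<i> *\<^sub>C 1"] im[of x] im[of 1]
    by (simp add: star_add star_scaleC algebra_simps lin mult_scaleC_left mult_scaleC_right)
  ultimately show ?thesis
    by (simp add: complex_eq_iff)
qed

text \<open>The discriminant argument behind Cauchy-Schwarz, stated for numbers because it serves
  positive functionals as well as the semi-inner products below. Only z = - t * cnj b with real t is
  tested.\<close>

lemma quadratic_form_bound:
  fixes b :: complex
  assumes "0 \<le> a" "0 \<le> c" "\<And>z. 0 \<le> a + 2 * Re (z * b) + (cmod z)\<^sup>2 * c"
  shows "(cmod b)\<^sup>2 \<le> a * c"
proof -
  have ge: "0 \<le> a - 2 * t * (cmod b)\<^sup>2 + t\<^sup>2 * (cmod b)\<^sup>2 * c" for t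
  proof -
    have "Re (cnj b * b) = (cmod b)\<^sup>2"
      by (metis Re_complex_of_real complex_norm_square mult.commute)
    then show ?thesis
      using assms(3)[of "- of_real t * cnj b"]
      by (simp add: norm_mult power_mult_distrib mult.assoc)
  qed
  show ?thesis
  proof (cases "c = 0")
    case True
    \<comment> \<open>With c = 0 the form is affine in t; at this t it equals -1, so b has to
      vanish.\<close>
    have "2 * ((a + 1) / (2 * (cmod b)\<^sup>2)) * (cmod b)\<^sup>2 = a + 1" if "b \<noteq> 0"
      using that by simp
    then show ?thesis
      using ge[of "(a + 1) / (2 * (cmod b)\<^sup>2)"] True by (cases "b = 0") auto
  next
    case False
    have "0 \<le> a - (cmod b)\<^sup>2 / c"
      using ge[of "1 / c"] False by (simp add: power2_eq_square)
    then show ?thesis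
      using False assms(2) by (simp add: field_simps)
  qed
qed

lemma positive_functional_Cauchy_Schwarz:
  assumes \<psi>: "positive_functional \<psi>"
  shows "(cmod (\<psi> (star x * y)))\<^sup>2 \<le> Re (\<psi> (star x * x)) * Re (\<psi> (star y * y))"
proof (rule quadratic_form_bound)
  note lin = linear_functionalD[OF positive_functionalD(1)[OF \<psi>]]
  fix z
  have "\<psi> (star y * x) = cnj (\<psi> (star x * y))"
    using positive_functional_star[OF \<psi>, of "star x * y"] by (simp add: star_mult star_star)
  moreover have "z * cnj z = of_real ((cmod z)\<^sup>2)"
    by (rule complex_norm_square[symmetric])
  moreover have "0 \<le> Re (\<psi> (star (x + z *\<^sub>C y) * (x + z *\<^sub>C y)))"
    by (rule positive_functionalD[OF \<psi>])
  ultimately show "0 \<le> Re (\<psi> (star x * x)) + 2 * Re (z * \<psi> (star x * y))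
      + (cmod z)\<^sup>2 * Re (\<psi> (star y * y))"
    by (simp add: star_add star_scaleC algebra_simps lin mult_scaleC_left mult_scaleC_right
        scaleC_scaleC del: of_real_power)
qed (rule positive_functionalD[OF \<psi>])+

text \<open>For r > norm x and w = x / r take a self-adjoint k with k^2 = 1 - star w * w. Positivity
  at \<open>k * y\<close> is the claim with r in place of norm x, since
  \<open>star (k * y) * (k * y) = star y * y - star (w * y) * (w * y)\<close>.\<close>

lemma positive_functional_mult_bound:
  assumes \<psi>: "positive_functional \<psi>"
  shows "Re (\<psi> (star (x * y) * (x * y))) \<le> (norm x)\<^sup>2 * Re (\<psi> (star y * y))"
proof -
  note lin = linear_functionalD[OF positive_functionalD(1)[OF \<psi>]]
  have le: "Re (\<psi> (star (x * y) * (x * y))) \<le> r\<^sup>2 * Re (\<psi> (star y * y))" if r: "norm x < r" for r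
  proof -
    have r0: "0 < r"
      using r norm_ge_zero[of x] by linarith
    define w where "w = (1 / r) *\<^sub>R x"
    have "norm w < 1"
      using r r0 by (simp add: w_def)
    then have "norm (star w * w) < 1"
      by (simp add: cstar_identity power_less_one_iff)
    moreover have "star (star w * w) = star w * w"
      by (simp add: star_mult star_star)
    ultimately obtain k where k: "star k = k" "k * k = 1 - star w * w"
      using selfadjoint_sqrt by blast
    have "star (k * y) * (k * y) = star y * (k * k) * y"
      by (simp add: star_mult k(1) mult.assoc)
    also have "\<dots> = star y * y - star (w * y) * (w * y)"
      by (simp add: k(2) algebra_simps star_mult)
    also have "star (w * y) * (w * y) = (1 / r\<^sup>2) *\<^sub>R (star (x * y) * (x * y))"
      by (simp add: w_def star_scaleR power2_eq_square)
    finally have "0 \<le> Re (\<psi> (star y * y)) - (1 / r\<^sup>2) * Re (\<psi> (star (x * y) * (x * y)))"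
      using positive_functionalD(3)[OF \<psi>, of "k * y"] by (simp add: lin)
    then show ?thesis
      using r0 by (simp add: field_simps)
  qed
  \<comment> \<open>The square root asks for a norm strictly below 1, so the bound is available for
    r > norm x only; now r decreases to norm x.\<close>
  have "((\<lambda>r. r\<^sup>2 * Re (\<psi> (star y * y))) \<longlongrightarrow> (norm x)\<^sup>2 * Re (\<psi> (star y * y)))
      (at_right (norm x))"
    by (intro tendsto_intros)
  then show ?thesis
    by (rule tendsto_lowerbound) (auto simp: eventually_at_filter intro!: always_eventually le)
qed

text \<open>Cauchy-Schwarz against 1, then \<open>positive_functional_mult_bound\<close> with y = 1.
  The constant is the same for all states, which gives the uniform limit in the continuity
  proof.\<close>

lemma state_norm_le:
  assumes "\<psi> \<in> states"
  shows "cmod (\<psi> x) \<le> norm x"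
proof -
  have \<psi>: "positive_functional \<psi>" "\<psi> 1 = 1"
    using assms by (simp_all add: states_iff)
  have "(cmod (\<psi> x))\<^sup>2 \<le> Re (\<psi> (star x * x))"
    using positive_functional_Cauchy_Schwarz[OF \<psi>(1), of 1 x] by (simp add: \<psi>(2))
  also have "\<dots> \<le> (norm x)\<^sup>2"
    using positive_functional_mult_bound[OF \<psi>(1), of x 1] by (simp add: \<psi>(2))
  finally show ?thesis
    by (rule power2_le_imp_le) simp
qed

lemma state_bounded_linear:
  assumes "\<psi> \<in> states"
  shows "bounded_linear \<psi>"
proof (rule bounded_linear_intro[where K = 1])
  have "linear_functional \<psi>"
    using assms by (simp add: states_def)
  note lin = linear_functionalD[OF this]
  show "\<psi> (r *\<^sub>R x) = r *\<^sub>R \<psi> x" for r x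
    using lin(6)[of r x] by (simp only: scaleR_conv_of_real)
  show "\<psi> (x + y) = \<psi> x + \<psi> y" for x y
    by (rule lin)
qed (simp add: state_norm_le[OF assms])

section \<open>Carrier-based algebras\<close>

text \<open>\<open>cstar_structure\<close> minus completeness and definiteness of the norm: what an
  algebra of operators on a degenerate inner product space satisfies before it is completed.\<close>

locale pre_cstar = ring B for B (structure) +
  assumes pre_scal_closed: "x \<in> carrier B \<Longrightarrow> scal B c x \<in> carrier B"
    and pre_scal_add_right: "x \<in> carrier B \<Longrightarrow> y \<in> carrier B \<Longrightarrow>
          scal B c (x \<oplus> y) = scal B c x \<oplus> scal B c y"
    and pre_scal_add_left: "x \<in> carrier B \<Longrightarrow> scal B (b + c) x = scal B b x \<oplus> scal B c x"
    and pre_scal_scal: "x \<in> carrier B \<Longrightarrow> scal B b (scal B c x) = scal B (b * c) x"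
    and pre_scal_one: "x \<in> carrier B \<Longrightarrow> scal B 1 x = x"
    and pre_scal_mult_left: "x \<in> carrier B \<Longrightarrow> y \<in> carrier B \<Longrightarrow>
          scal B c x \<otimes> y = scal B c (x \<otimes> y)"
    and pre_scal_mult_right: "x \<in> carrier B \<Longrightarrow> y \<in> carrier B \<Longrightarrow>
          x \<otimes> scal B c y = scal B c (x \<otimes> y)"
    and pre_adj_closed: "x \<in> carrier B \<Longrightarrow> adj B x \<in> carrier B"
    and pre_adj_add: "x \<in> carrier B \<Longrightarrow> y \<in> carrier B \<Longrightarrow> adj B (x \<oplus> y) = adj B x \<oplus> adj B y"
    and pre_adj_scal: "x \<in> carrier B \<Longrightarrow> adj B (scal B c x) = scal B (cnj c) (adj B x)"
    and pre_adj_mult: "x \<in> carrier B \<Longrightarrow> y \<in> carrier B \<Longrightarrow> adj B (x \<otimes> y) = adj B y \<otimes> adj B x"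
    and pre_adj_adj: "x \<in> carrier B \<Longrightarrow> adj B (adj B x) = x"
    and pre_nrm_nonneg: "x \<in> carrier B \<Longrightarrow> 0 \<le> nrm B x"
    and pre_nrm_triangle: "x \<in> carrier B \<Longrightarrow> y \<in> carrier B \<Longrightarrow> nrm B (x \<oplus> y) \<le> nrm B x + nrm B y"
    and pre_nrm_scal: "x \<in> carrier B \<Longrightarrow> nrm B (scal B c x) = cmod c * nrm B x"
    and pre_nrm_mult: "x \<in> carrier B \<Longrightarrow> y \<in> carrier B \<Longrightarrow> nrm B (x \<otimes> y) \<le> nrm B x * nrm B y"
    and pre_nrm_cstar: "x \<in> carrier B \<Longrightarrow> nrm B (adj B x \<otimes> x) = (nrm B x)\<^sup>2"
begin

lemma scal_zero: "x \<in> carrier B \<Longrightarrow> scal B 0 x = \<zero>"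
  using pre_scal_add_left[of x 0 0] pre_scal_closed[of x 0] by simp

lemma scal_minus_one: "x \<in> carrier B \<Longrightarrow> scal B (- 1) x = \<ominus> x"
  using pre_scal_add_left[of x "- 1" 1]
  by (intro minus_equality[symmetric]) (simp_all add: scal_zero pre_scal_one pre_scal_closed)

lemma nrm_zero: "nrm B \<zero> = 0"
  using pre_nrm_scal[of \<zero> 0] by (simp add: scal_zero)

lemma nrm_uminus: "x \<in> carrier B \<Longrightarrow> nrm B (\<ominus> x) = nrm B x"
  using pre_nrm_scal[of x "- 1"] by (simp add: scal_minus_one)

lemma nrm_diff_commute: "x \<in> carrier B \<Longrightarrow> y \<in> carrier B \<Longrightarrow> nrm B (x \<ominus> y) = nrm B (y \<ominus> x)"
  using nrm_uminus[of "y \<ominus> x"] by (simp add: a_minus_def minus_add a_ac)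

lemma nrm_diff_triangle:
  assumes "x \<in> carrier B" "y \<in> carrier B" "z \<in> carrier B"
  shows "nrm B (x \<ominus> z) \<le> nrm B (x \<ominus> y) + nrm B (y \<ominus> z)"
proof -
  have "x \<ominus> z = (x \<ominus> y) \<oplus> (y \<ominus> z)"
    using assms by (simp add: a_minus_def a_assoc) (simp add: l_neg flip: a_assoc)
  then show ?thesis
    using assms pre_nrm_triangle[of "x \<ominus> y" "y \<ominus> z"] by simp
qed

lemma diff_eq_zero_iff:
  assumes "x \<in> carrier B" "y \<in> carrier B"
  shows "x \<ominus> y = \<zero> \<longleftrightarrow> x = y"
  using assms minus_equality[of x "\<ominus> y"] by (auto simp: a_minus_def r_neg)

lemma nrm_adj_le:
  assumes x: "x \<in> carrier B"
  shows "nrm B x \<le> nrm B (adj B x)"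
proof (cases "nrm B x = 0")
  case True
  then show ?thesis
    using pre_nrm_nonneg[OF pre_adj_closed[OF x]] by simp
next
  case False
  then have pos: "nrm B x > 0"
    using pre_nrm_nonneg[OF x] by simp
  have "nrm B x * nrm B x \<le> nrm B (adj B x) * nrm B x"
    using pre_nrm_mult[of "adj B x" x] x pre_nrm_cstar[OF x]
    by (simp add: pre_adj_closed power2_eq_square)
  then show ?thesis
    using pos by simp
qed

lemma nrm_adj: "x \<in> carrier B \<Longrightarrow> nrm B (adj B x) = nrm B x"
  using nrm_adj_le[of x] nrm_adj_le[of "adj B x"] by (simp add: pre_adj_closed pre_adj_adj)

lemma adj_uminus: "x \<in> carrier B \<Longrightarrow> adj B (\<ominus> x) = \<ominus> adj B x"
  using pre_adj_scal[of x "- 1"] by (simp add: scal_minus_one pre_adj_closed)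

lemma scal_uminus: "x \<in> carrier B \<Longrightarrow> scal B c (\<ominus> x) = \<ominus> scal B c x"
  by (simp add: pre_scal_scal pre_scal_closed flip: scal_minus_one)

end

sublocale cstar_structure \<subseteq> pre_cstar
  by unfold_locales
    (rule scal_closed scal_add_right scal_add_left scal_scal scal_one scal_mult_left scal_mult_right
      adj_closed adj_add adj_scal adj_mult adj_adj nrm_nonneg nrm_triangle nrm_scal nrm_mult
      nrm_cstar; assumption)+

section \<open>Transport of structure along an injection\<close>

definition transport :: "('x \<Rightarrow> 'y) \<Rightarrow> 'x cstar_struct \<Rightarrow> 'y cstar_struct" where
  "transport J B = (let g = the_inv_into (carrier B) J in
     \<lparr>carrier = J ` carrier B, mult = (\<lambda>u v. J (g u \<otimes>\<^bsub>B\<^esub> g v)), one = J \<one>\<^bsub>B\<^esub>, zero = J \<zero>\<^bsub>B\<^esub>,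
      add = (\<lambda>u v. J (g u \<oplus>\<^bsub>B\<^esub> g v)), scal = (\<lambda>c u. J (scal B c (g u))),
      adj = (\<lambda>u. J (adj B (g u))), nrm = (\<lambda>u. nrm B (g u))\<rparr>)"

lemma transport_simps:
  assumes "inj_on J (carrier B)"
  shows "carrier (transport J B) = J ` carrier B"
    "\<one>\<^bsub>transport J B\<^esub> = J \<one>\<^bsub>B\<^esub>" "\<zero>\<^bsub>transport J B\<^esub> = J \<zero>\<^bsub>B\<^esub>"
    "x \<in> carrier B \<Longrightarrow> y \<in> carrier B \<Longrightarrow> J x \<otimes>\<^bsub>transport J B\<^esub> J y = J (x \<otimes>\<^bsub>B\<^esub> y)"
    "x \<in> carrier B \<Longrightarrow> y \<in> carrier B \<Longrightarrow> J x \<oplus>\<^bsub>transport J B\<^esub> J y = J (x \<oplus>\<^bsub>B\<^esub> y)"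
    "x \<in> carrier B \<Longrightarrow> scal (transport J B) c (J x) = J (scal B c x)"
    "x \<in> carrier B \<Longrightarrow> adj (transport J B) (J x) = J (adj B x)"
    "x \<in> carrier B \<Longrightarrow> nrm (transport J B) (J x) = nrm B x"
  using assms by (simp_all add: transport_def Let_def the_inv_into_f_f)

lemma cstar_structure_transport:
  assumes "cstar_structure B" and inj: "inj_on J (carrier B)"
  shows "cstar_structure (transport J B)" (is "cstar_structure ?C")
proof -
  interpret B: cstar_structure B by fact
  note simps = transport_simps[OF inj]
  have "abelian_group ?C"
  proof (rule abelian_groupI)
    fix u assume "u \<in> carrier ?C"
    then obtain x where "x \<in> carrier B" "u = J x"
      by (auto simp: simps)
    then show "\<exists>v\<in>carrier ?C. v \<oplus>\<^bsub>?C\<^esub> u = \<zero>\<^bsub>?C\<^esub>"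
      by (intro bexI[of _ "J (\<ominus>\<^bsub>B\<^esub> x)"]) (simp_all add: simps B.l_neg)
  qed (auto simp: simps B.a_ac)
  moreover have "Group.monoid ?C"
    by (rule monoidI) (auto simp: simps B.m_assoc)
  ultimately interpret C: ring ?C
    by (rule ringI) (auto simp: simps B.l_distr B.r_distr)
  have uminus: "\<ominus>\<^bsub>?C\<^esub> J x = J (\<ominus>\<^bsub>B\<^esub> x)" if "x \<in> carrier B" for x
    using that by (intro C.minus_equality) (simp_all add: simps B.l_neg)
  have minus: "J x \<ominus>\<^bsub>?C\<^esub> J y = J (x \<ominus>\<^bsub>B\<^esub> y)" if "x \<in> carrier B" "y \<in> carrier B" for x y
    using that by (simp add: a_minus_def uminus simps)
  show ?thesis
  proof
    fix s :: "nat \<Rightarrow> 'b"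
    assume s: "\<And>n. s n \<in> carrier ?C"
      and Cauchy: "\<And>e. 0 < e \<Longrightarrow> \<exists>N. \<forall>m\<ge>N. \<forall>n\<ge>N. nrm ?C (s m \<ominus>\<^bsub>?C\<^esub> s n) < e"
    have "\<exists>t. \<forall>n. t n \<in> carrier B \<and> s n = J (t n)"
      using s by (intro choice) (auto simp: simps image_iff)
    then obtain t where t: "\<And>n. t n \<in> carrier B" "\<And>n. s n = J (t n)"
      by blast
    have "\<exists>l\<in>carrier B. (\<lambda>n. nrm B (t n \<ominus>\<^bsub>B\<^esub> l)) \<longlonglongrightarrow> 0"
      using t(1) Cauchy by (intro B.nrm_complete) (simp_all add: t minus simps)
    then show "\<exists>l\<in>carrier ?C. (\<lambda>n. nrm ?C (s n \<ominus>\<^bsub>?C\<^esub> l)) \<longlonglongrightarrow> 0"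
      using t(1) by (auto simp: t(2) minus simps)
  next
    fix u assume "u \<in> carrier ?C"
    then show "nrm ?C u = 0 \<longleftrightarrow> u = \<zero>\<^bsub>?C\<^esub>"
      using inj_onD[OF inj, of _ "\<zero>\<^bsub>B\<^esub>"] by (auto simp: simps B.nrm_eq_zero)
  qed (auto simp: simps B.scal_closed B.scal_add_right B.scal_add_left B.scal_scal B.scal_one
        B.scal_mult_left B.scal_mult_right B.adj_closed B.adj_add B.adj_scal B.adj_mult B.adj_adj
        B.nrm_nonneg B.nrm_triangle B.nrm_scal B.nrm_mult B.nrm_cstar)
qed

lemma star_hom_transport:
  assumes "cstar_structure B" and inj: "inj_on J (carrier B)"
  shows "star_hom B (transport J B) J"
    and "star_hom (transport J B) B (the_inv_into (carrier B) J)"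
proof -
  interpret B: cstar_structure B by fact
  note simps = transport_simps[OF inj]
  show "star_hom B (transport J B) J"
    by (auto simp: star_hom_def ring_hom_def simps)
  show "star_hom (transport J B) B (the_inv_into (carrier B) J)"
    by (auto simp: star_hom_def ring_hom_def simps the_inv_into_f_f[OF inj] B.scal_closed
        B.adj_closed)
qed

lemma star_homD:
  assumes "star_hom A B f"
  shows "x \<in> carrier A \<Longrightarrow> f x \<in> carrier B"
    "x \<in> carrier A \<Longrightarrow> y \<in> carrier A \<Longrightarrow> f (x \<otimes>\<^bsub>A\<^esub> y) = f x \<otimes>\<^bsub>B\<^esub> f y"
    "x \<in> carrier A \<Longrightarrow> y \<in> carrier A \<Longrightarrow> f (x \<oplus>\<^bsub>A\<^esub> y) = f x \<oplus>\<^bsub>B\<^esub> f y"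
    "f \<one>\<^bsub>A\<^esub> = \<one>\<^bsub>B\<^esub>"
    "x \<in> carrier A \<Longrightarrow> f (scal A c x) = scal B c (f x)"
    "x \<in> carrier A \<Longrightarrow> f (adj A x) = adj B (f x)"
  using assms by (auto simp: star_hom_def ring_hom_def)

text \<open>\<open>ring_hom\<close> does not list the zero among what is preserved; here it comes
  from compatibility with the scalar 0.\<close>

lemma star_hom_zero:
  assumes "pre_cstar A" "pre_cstar B" "star_hom A B f"
  shows "f \<zero>\<^bsub>A\<^esub> = \<zero>\<^bsub>B\<^esub>"
proof -
  interpret A: pre_cstar A by fact
  interpret B: pre_cstar B by fact
  note f = star_homD[OF assms(3)]
  show ?thesis
    using f(5)[of "\<zero>\<^bsub>A\<^esub>" 0] f(1)[of "\<zero>\<^bsub>A\<^esub>"] by (simp add: A.scal_zero B.scal_zero)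
qed

lemma star_hom_comp:
  assumes "star_hom A B f" "star_hom B C g"
  shows "star_hom A C (g \<circ> f)"
  using assms by (auto simp: star_hom_def ring_hom_def Pi_iff)

lemma type_cstar_simps [simp]:
  "carrier type_cstar = UNIV" "\<one>\<^bsub>type_cstar\<^esub> = 1" "\<zero>\<^bsub>type_cstar\<^esub> = 0"
  "x \<otimes>\<^bsub>type_cstar\<^esub> y = x * y" "x \<oplus>\<^bsub>type_cstar\<^esub> y = x + y"
  "scal type_cstar c x = c *\<^sub>C x" "adj type_cstar x = star x" "nrm type_cstar x = norm x"
  by (simp_all add: type_cstar_def)

interpretation type_cstar: cstar_structure "type_cstar :: 'b::cstar_algebra cstar_struct"
  by (rule cstar_structure_type_cstar)

lemma type_cstar_diff [simp]: "x \<ominus>\<^bsub>type_cstar\<^esub> y = x - y"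
proof -
  have "\<ominus>\<^bsub>type_cstar\<^esub> y = - y"
    by (rule type_cstar.minus_equality) simp_all
  then show ?thesis
    by (simp add: a_minus_def)
qed

section \<open>Evaluation of star-polynomials, and the universal property over arbitrary
  types\<close>

primrec poly_eval ::
  "'x cstar_struct \<Rightarrow> ('a \<Rightarrow> 'x) \<Rightarrow> ('d \<Rightarrow> 'x) \<Rightarrow> ('a, 'd) star_poly \<Rightarrow> 'x"
where
  "poly_eval B \<pi> W (Coeff a) = \<pi> a"
| "poly_eval B \<pi> W (Gen i) = W i"
| "poly_eval B \<pi> W (Plus p q) = poly_eval B \<pi> W p \<oplus>\<^bsub>B\<^esub> poly_eval B \<pi> W q"
| "poly_eval B \<pi> W (Times p q) = poly_eval B \<pi> W p \<otimes>\<^bsub>B\<^esub> poly_eval B \<pi> W q"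
| "poly_eval B \<pi> W (Adj p) = adj B (poly_eval B \<pi> W p)"

lemma covariant_transfer:
  assumes "pre_cstar B" "pre_cstar C" and cov: "covariant \<alpha> B \<pi> W" and f: "star_hom B C f"
  shows "covariant \<alpha> C (f \<circ> \<pi>) (f \<circ> W)"
proof -
  interpret B: pre_cstar B by fact
  have \<pi>: "star_hom type_cstar B \<pi>" and W: "\<And>i. W i \<in> carrier B"
    using cov by (simp_all add: covariant_def)
  have \<pi>_closed: "\<pi> a \<in> carrier B" for a
    by (rule star_homD(1)[OF \<pi>]) simp
  show ?thesis
    unfolding covariant_def
  proof (intro conjI allI)
    show "star_hom type_cstar C (f \<circ> \<pi>)"
      using \<pi> f by (rule star_hom_comp)
    fix i j a
    show "(f \<circ> W) i \<in> carrier C"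
      using star_homD[OF f] W by simp
    have "adj C (f (W i)) \<otimes>\<^bsub>C\<^esub> f (W j) = f (adj B (W i) \<otimes>\<^bsub>B\<^esub> W j)"
      using star_homD[OF f] W by (simp add: B.pre_adj_closed)
    then show "adj C ((f \<circ> W) i) \<otimes>\<^bsub>C\<^esub> (f \<circ> W) j = (if i = j then \<one>\<^bsub>C\<^esub> else \<zero>\<^bsub>C\<^esub>)"
      using cov star_homD(4)[OF f] star_hom_zero[OF assms(1,2) f] by (simp add: covariant_def)
    have "f (\<pi> a \<otimes>\<^bsub>B\<^esub> W i) = f (W i \<otimes>\<^bsub>B\<^esub> \<pi> (\<alpha> i a))"
      using cov by (simp add: covariant_def)
    then show "(f \<circ> \<pi>) a \<otimes>\<^bsub>C\<^esub> (f \<circ> W) i = (f \<circ> W) i \<otimes>\<^bsub>C\<^esub> (f \<circ> \<pi>) (\<alpha> i a)"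
      using star_homD[OF f] W \<pi>_closed by simp
  qed
qed

text \<open>The universal property extends from the universe type to all types, by transport along the
  injection \<open>b \<mapsto> (\<lambda>p. \<parallel>b - p\<parallel>)\<close>.\<close>

lemma toeplitz_pimsner_universal:
  fixes \<alpha> :: "'d::finite \<Rightarrow> 'a::cstar_algebra \<Rightarrow> 'a"
  assumes tp: "toeplitz_pimsner \<alpha> \<iota> V"
    and B: "cstar_structure B" and cov: "covariant \<alpha> B \<pi> W"
    and dense: "\<And>x e. x \<in> carrier B \<Longrightarrow> 0 < e \<Longrightarrow> \<exists>p. nrm B (x \<ominus>\<^bsub>B\<^esub> poly_eval B \<pi> W p) < e"
  obtains \<Phi> where "star_hom type_cstar B \<Phi>" "\<And>a. \<Phi> (\<iota> a) = \<pi> a" "\<And>i. \<Phi> (V i) = W i"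
proof -
  interpret B: cstar_structure B by fact
  have \<pi>: "star_hom type_cstar B \<pi>" and W: "\<And>i. W i \<in> carrier B"
    using cov by (simp_all add: covariant_def)
  have \<pi>_closed: "\<pi> a \<in> carrier B" for a
    by (rule star_homD(1)[OF \<pi>]) simp
  have eval_closed: "poly_eval B \<pi> W p \<in> carrier B" for p
    by (induction p) (simp_all add: \<pi>_closed W B.adj_closed)
  define J where "J b = (\<lambda>p. nrm B (b \<ominus>\<^bsub>B\<^esub> poly_eval B \<pi> W p))" for b
  \<comment> \<open>A polynomial close to \<open>b\<close> is equally close to \<open>c\<close> when
    \<open>J b = J c\<close>; by density this forces \<open>b\<close> and \<open>c\<close>
    together.\<close>
  have inj: "inj_on J (carrier B)"
  proof (rule inj_onI)
    fix b c assume bc: "b \<in> carrier B" "c \<in> carrier B" "J b = J c"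
    have "nrm B (b \<ominus>\<^bsub>B\<^esub> c) \<le> 0"
    proof (rule field_le_epsilon)
      fix e :: real assume "0 < e"
      then obtain p where p: "nrm B (b \<ominus>\<^bsub>B\<^esub> poly_eval B \<pi> W p) < e / 2"
        using dense[OF bc(1), of "e / 2"] by auto
      moreover have "nrm B (c \<ominus>\<^bsub>B\<^esub> poly_eval B \<pi> W p) < e / 2"
        using p fun_cong[OF bc(3), of p] by (simp add: J_def)
      ultimately show "nrm B (b \<ominus>\<^bsub>B\<^esub> c) \<le> 0 + e"
        using B.nrm_diff_triangle[OF bc(1) eval_closed bc(2), of p]
          B.nrm_diff_commute[OF bc(2) eval_closed, of p] by simp
    qed
    then have "b \<ominus>\<^bsub>B\<^esub> c = \<zero>\<^bsub>B\<^esub>"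
      using bc(1,2) B.nrm_nonneg[of "b \<ominus>\<^bsub>B\<^esub> c"] B.nrm_eq_zero[of "b \<ominus>\<^bsub>B\<^esub> c"] by simp
    then show "b = c"
      using bc(1,2) B.diff_eq_zero_iff by blast
  qed
  \<comment> \<open>The values of \<open>J\<close> lie in \<open>universe\<close>, so the
    transported structure has the type over which \<open>toeplitz_pimsner\<close>
    quantifies.\<close>
  let ?C = "transport J B" and ?g = "the_inv_into (carrier B) J"
  have C: "cstar_structure ?C"
    using B inj by (rule cstar_structure_transport)
  interpret C: cstar_structure ?C by (rule C)
  note J = star_hom_transport[OF B inj]
  have "covariant \<alpha> ?C (J \<circ> \<pi>) (J \<circ> W)"
    using B.pre_cstar_axioms C.pre_cstar_axioms cov J(1) by (rule covariant_transfer)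
  then obtain \<Phi> where \<Phi>: "star_hom type_cstar ?C \<Phi>" "\<And>a. \<Phi> (\<iota> a) = J (\<pi> a)"
      "\<And>i. \<Phi> (V i) = J (W i)"
    using tp C unfolding toeplitz_pimsner_def by fastforce
  show thesis
  proof
    show "star_hom type_cstar B (?g \<circ> \<Phi>)"
      using \<Phi>(1) J(2) by (rule star_hom_comp)
  qed (simp_all add: \<Phi> the_inv_into_f_f[OF inj] \<pi>_closed W)
qed

section \<open>Completion\<close>

lemma null_seq_le:
  fixes f g :: "nat \<Rightarrow> real"
  assumes "\<And>n. 0 \<le> f n" "\<And>n. f n \<le> g n" "g \<longlonglongrightarrow> 0"
  shows "f \<longlonglongrightarrow> 0"
  by (rule tendsto_sandwich[of "\<lambda>_. 0" f sequentially g]) (simp_all add: assms)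

context pre_cstar
begin

definition Cauchy_seq :: "(nat \<Rightarrow> 'a) \<Rightarrow> bool" where
  "Cauchy_seq x \<longleftrightarrow> (\<forall>n. x n \<in> carrier B)
     \<and> (\<forall>e>0. \<exists>N. \<forall>m\<ge>N. \<forall>n\<ge>N. nrm B (x m \<ominus> x n) < e)"

definition seq_eq :: "(nat \<Rightarrow> 'a) \<Rightarrow> (nat \<Rightarrow> 'a) \<Rightarrow> bool" where
  "seq_eq x y \<longleftrightarrow> (\<lambda>n. nrm B (x n \<ominus> y n)) \<longlonglongrightarrow> 0"

text \<open>The completion consists of chosen representatives of the Cauchy sequences modulo null
  sequences, instead of classes.\<close>

definition rep :: "(nat \<Rightarrow> 'a) \<Rightarrow> nat \<Rightarrow> 'a" where
  "rep x = (SOME y. Cauchy_seq y \<and> seq_eq x y)"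

definition completion :: "(nat \<Rightarrow> 'a) cstar_struct" where
  "completion = \<lparr>carrier = rep ` Collect Cauchy_seq, mult = (\<lambda>x y. rep (\<lambda>n. x n \<otimes> y n)),
     one = rep (\<lambda>_. \<one>), zero = rep (\<lambda>_. \<zero>), add = (\<lambda>x y. rep (\<lambda>n. x n \<oplus> y n)),
     scal = (\<lambda>c x. rep (\<lambda>n. scal B c (x n))), adj = (\<lambda>x. rep (\<lambda>n. adj B (x n))),
     nrm = (\<lambda>x. lim (\<lambda>n. nrm B (x n)))\<rparr>"

lemma Cauchy_seq_closed [simp]: "Cauchy_seq x \<Longrightarrow> x n \<in> carrier B"
  by (simp add: Cauchy_seq_def)

lemma nrm_diff_nonneg: "x \<in> carrier B \<Longrightarrow> y \<in> carrier B \<Longrightarrow> 0 \<le> nrm B (x \<ominus> y)"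
  by (simp add: pre_nrm_nonneg)

lemma diff_self: "x \<in> carrier B \<Longrightarrow> x \<ominus> x = \<zero>"
  by (simp add: diff_eq_zero_iff)

lemma seq_eq_refl: "Cauchy_seq x \<Longrightarrow> seq_eq x x"
  by (simp add: seq_eq_def diff_self nrm_zero)

lemma seq_eq_sym: "Cauchy_seq x \<Longrightarrow> Cauchy_seq y \<Longrightarrow> seq_eq x y \<Longrightarrow> seq_eq y x"
proof -
  assume "Cauchy_seq x" "Cauchy_seq y" "seq_eq x y"
  moreover from this have "(\<lambda>n. nrm B (x n \<ominus> y n)) = (\<lambda>n. nrm B (y n \<ominus> x n))"
    by (intro ext nrm_diff_commute) simp_all
  ultimately show "seq_eq y x"
    by (simp only: seq_eq_def)
qed

lemma seq_eq_trans:
  assumes "Cauchy_seq x" "Cauchy_seq y" "Cauchy_seq z" "seq_eq x y" "seq_eq y z"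
  shows "seq_eq x z"
  unfolding seq_eq_def
proof (rule null_seq_le)
  show "(\<lambda>n. nrm B (x n \<ominus> y n) + nrm B (y n \<ominus> z n)) \<longlonglongrightarrow> 0"
    using tendsto_add[OF assms(4,5)[unfolded seq_eq_def]] by simp
qed (use assms in \<open>simp_all add: nrm_diff_triangle nrm_diff_nonneg\<close>)

lemma rep:
  assumes "Cauchy_seq x"
  shows "Cauchy_seq (rep x)" "seq_eq x (rep x)"
proof -
  have "Cauchy_seq (rep x) \<and> seq_eq x (rep x)"
    unfolding rep_def by (rule someI[of _ x]) (use assms seq_eq_refl in blast)
  then show "Cauchy_seq (rep x)" "seq_eq x (rep x)"
    by blast+
qed

text \<open>Equivalent sequences satisfy the same predicate, and \<open>SOME\<close> depends on the
  predicate only; so the chosen representative stands for the whole class.\<close>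

lemma rep_eq_iff:
  assumes "Cauchy_seq x" "Cauchy_seq y"
  shows "rep x = rep y \<longleftrightarrow> seq_eq x y"
proof
  assume "rep x = rep y"
  then have "seq_eq x (rep y)"
    using rep(2)[OF assms(1)] by simp
  moreover have "seq_eq (rep y) y"
    by (rule seq_eq_sym[OF assms(2) rep[OF assms(2)]])
  ultimately show "seq_eq x y"
    by (rule seq_eq_trans[OF assms(1) rep(1)[OF assms(2)] assms(2)])
next
  assume xy: "seq_eq x y"
  have "(\<lambda>z. Cauchy_seq z \<and> seq_eq x z) = (\<lambda>z. Cauchy_seq z \<and> seq_eq y z)"
  proof (intro ext conj_cong refl iffI)
    fix z assume z: "Cauchy_seq z"
    show "seq_eq y z" if "seq_eq x z"
      by (rule seq_eq_trans[OF assms(2,1) z seq_eq_sym[OF assms xy] that])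
    show "seq_eq x z" if "seq_eq y z"
      by (rule seq_eq_trans[OF assms z xy that])
  qed
  then show "rep x = rep y"
    by (simp only: rep_def)
qed

lemma nrm_abs_diff:
  assumes "x \<in> carrier B" "y \<in> carrier B"
  shows "\<bar>nrm B x - nrm B y\<bar> \<le> nrm B (x \<ominus> y)"
proof -
  have "z \<ominus> \<zero> = z" if "z \<in> carrier B" for z
    using that by (simp add: a_minus_def)
  then show ?thesis
    using nrm_diff_triangle[of x y \<zero>] nrm_diff_triangle[of y x \<zero>] assms
    by (simp add: abs_le_iff nrm_diff_commute[of y x])
qed

text \<open>The norm of the completion is defined along the stored representative. That one differs
  from \<open>x\<close> by a null sequence, so any sequence of the class computes the norm.\<close>

lemma nrm_tendsto:
  assumes x: "Cauchy_seq x"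
  shows "(\<lambda>n. nrm B (x n)) \<longlonglongrightarrow> nrm completion (rep x)"
proof -
  have "convergent (\<lambda>n. nrm B (y n))" if y: "Cauchy_seq y" for y
  proof (rule Cauchy_convergent, rule metric_CauchyI)
    fix e :: real assume "0 < e"
    then obtain N where "\<forall>m\<ge>N. \<forall>n\<ge>N. nrm B (y m \<ominus> y n) < e"
      using y unfolding Cauchy_seq_def by blast
    moreover have "dist (nrm B (y m)) (nrm B (y n)) \<le> nrm B (y m \<ominus> y n)" for m n
      unfolding dist_real_def by (intro nrm_abs_diff Cauchy_seq_closed y)
    ultimately show "\<exists>N. \<forall>m\<ge>N. \<forall>n\<ge>N. dist (nrm B (y m)) (nrm B (y n)) < e"
      by (meson le_less_trans)
  qed
  then have "(\<lambda>n. nrm B (rep x n)) \<longlonglongrightarrow> nrm completion (rep x)"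
    using rep(1)[OF x] by (simp add: completion_def convergent_LIMSEQ_iff)
  moreover have "(\<lambda>n. \<bar>nrm B (x n) - nrm B (rep x n)\<bar>) \<longlonglongrightarrow> 0"
    by (rule null_seq_le[OF _ _ rep(2)[OF x, unfolded seq_eq_def]])
      (simp_all add: nrm_abs_diff x rep(1)[OF x])
  then have "(\<lambda>n. nrm B (x n) - nrm B (rep x n)) \<longlonglongrightarrow> 0"
    by (simp only: tendsto_rabs_zero_iff)
  ultimately show ?thesis
    by (rule Lim_transform)
qed

lemma Cauchy_seq_const: "a \<in> carrier B \<Longrightarrow> Cauchy_seq (\<lambda>_. a)"
  by (simp add: Cauchy_seq_def diff_self nrm_zero)

lemma Cauchy_seq_lipschitz:
  assumes x: "Cauchy_seq x" and L: "\<And>a. a \<in> carrier B \<Longrightarrow> L a \<in> carrier B" "0 \<le> K"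
    "\<And>a b. a \<in> carrier B \<Longrightarrow> b \<in> carrier B \<Longrightarrow> nrm B (L a \<ominus> L b) \<le> K * nrm B (a \<ominus> b)"
  shows "Cauchy_seq (\<lambda>n. L (x n))"
  unfolding Cauchy_seq_def
proof (intro conjI allI impI)
  fix e :: real assume e: "0 < e"
  \<comment> \<open>K + 1 and not K, since K may be 0.\<close>
  have "0 < e / (K + 1)"
    using e L(2) by simp
  then obtain N where N: "\<And>m n. N \<le> m \<Longrightarrow> N \<le> n \<Longrightarrow> nrm B (x m \<ominus> x n) < e / (K + 1)"
    using x unfolding Cauchy_seq_def by blast
  have "nrm B (L (x m) \<ominus> L (x n)) < e" if "N \<le> m" "N \<le> n" for m n
  proof -
    have "nrm B (L (x m) \<ominus> L (x n)) \<le> K * nrm B (x m \<ominus> x n)"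
      using x by (simp add: L)
    also have "\<dots> \<le> (K + 1) * nrm B (x m \<ominus> x n)"
      using x by (simp add: nrm_diff_nonneg distrib_right)
    also have "\<dots> < e"
      using N[OF that] L(2) by (simp add: field_simps)
    finally show ?thesis .
  qed
  then show "\<exists>N. \<forall>m\<ge>N. \<forall>n\<ge>N. nrm B (L (x m) \<ominus> L (x n)) < e"
    by blast
qed (use x L in simp)

lemma seq_eq_lipschitz:
  assumes "Cauchy_seq x" "Cauchy_seq y" "seq_eq x y"
    and L: "\<And>a. a \<in> carrier B \<Longrightarrow> L a \<in> carrier B"
    "\<And>a b. a \<in> carrier B \<Longrightarrow> b \<in> carrier B \<Longrightarrow> nrm B (L a \<ominus> L b) \<le> K * nrm B (a \<ominus> b)"
  shows "seq_eq (\<lambda>n. L (x n)) (\<lambda>n. L (y n))"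
  unfolding seq_eq_def
proof (rule null_seq_le)
  show "(\<lambda>n. K * nrm B (x n \<ominus> y n)) \<longlonglongrightarrow> 0"
    using tendsto_mult[OF tendsto_const[of K] assms(3)[unfolded seq_eq_def]] by simp
qed (use assms in \<open>simp_all add: nrm_diff_nonneg\<close>)

lemma nrm_scal_diff:
  assumes "x \<in> carrier B" "y \<in> carrier B"
  shows "nrm B (scal B c x \<ominus> scal B c y) \<le> cmod c * nrm B (x \<ominus> y)"
proof -
  have "scal B c x \<ominus> scal B c y = scal B c (x \<ominus> y)"
    using assms by (simp add: a_minus_def scal_uminus pre_scal_add_right)
  then show ?thesis
    using assms by (simp add: pre_nrm_scal)
qed

lemma nrm_adj_diff:
  assumes "x \<in> carrier B" "y \<in> carrier B"
  shows "nrm B (adj B x \<ominus> adj B y) \<le> 1 * nrm B (x \<ominus> y)"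
proof -
  have "adj B x \<ominus> adj B y = adj B (x \<ominus> y)"
    using assms by (simp add: a_minus_def adj_uminus pre_adj_add)
  then show ?thesis
    using assms by (simp add: nrm_adj)
qed

lemma nrm_add_diff:
  assumes "x \<in> carrier B" "y \<in> carrier B" "x' \<in> carrier B" "y' \<in> carrier B"
  shows "nrm B ((x \<oplus> y) \<ominus> (x' \<oplus> y')) \<le> nrm B (x \<ominus> x') + nrm B (y \<ominus> y')"
proof -
  have "(x \<oplus> y) \<ominus> (x' \<oplus> y') = (x \<ominus> x') \<oplus> (y \<ominus> y')"
    using assms by (simp add: a_minus_def minus_add a_ac)
  then show ?thesis
    using assms pre_nrm_triangle by simp
qed

text \<open>Insert the mixed product of \<open>x\<close> and \<open>y'\<close>. The remaining
  factors \<open>nrm B x\<close> and \<open>nrm B y'\<close> stay bounded along Cauchy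
  sequences.\<close>

lemma nrm_mult_diff:
  assumes "x \<in> carrier B" "y \<in> carrier B" "x' \<in> carrier B" "y' \<in> carrier B"
  shows "nrm B (x \<otimes> y \<ominus> x' \<otimes> y') \<le> nrm B x * nrm B (y \<ominus> y') + nrm B y' * nrm B (x \<ominus> x')"
proof -
  have "x \<otimes> (y \<ominus> y') = x \<otimes> y \<ominus> x \<otimes> y'" "(x \<ominus> x') \<otimes> y' = x \<otimes> y' \<ominus> x' \<otimes> y'"
    using assms by (simp_all add: a_minus_def r_distr l_distr r_minus l_minus)
  then show ?thesis
    using nrm_diff_triangle[of "x \<otimes> y" "x \<otimes> y'" "x' \<otimes> y'"] pre_nrm_mult[of x "y \<ominus> y'"]
      pre_nrm_mult[of "x \<ominus> x'" y'] assms
    by (simp add: mult.commute)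
qed

lemma Cauchy_seq_add:
  assumes x: "Cauchy_seq x" and y: "Cauchy_seq y"
  shows "Cauchy_seq (\<lambda>n. x n \<oplus> y n)"
  unfolding Cauchy_seq_def
proof (intro conjI allI impI)
  fix e :: real assume "0 < e"
  then obtain N M where N: "\<And>m n. N \<le> m \<Longrightarrow> N \<le> n \<Longrightarrow> nrm B (x m \<ominus> x n) < e / 2"
    and M: "\<And>m n. M \<le> m \<Longrightarrow> M \<le> n \<Longrightarrow> nrm B (y m \<ominus> y n) < e / 2"
    using x y unfolding Cauchy_seq_def by (meson half_gt_zero)
  have "nrm B ((x m \<oplus> y m) \<ominus> (x n \<oplus> y n)) < e" if "max N M \<le> m" "max N M \<le> n" for m n
    using nrm_add_diff[of "x m" "y m" "x n" "y n"] N[of m n] M[of m n] that x y by simp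
  then show "\<exists>N. \<forall>m\<ge>N. \<forall>n\<ge>N. nrm B ((x m \<oplus> y m) \<ominus> (x n \<oplus> y n)) < e"
    by blast
qed (use x y in simp)

lemma seq_eq_add:
  assumes "Cauchy_seq x" "Cauchy_seq y" "Cauchy_seq x'" "Cauchy_seq y'" "seq_eq x x'" "seq_eq y y'"
  shows "seq_eq (\<lambda>n. x n \<oplus> y n) (\<lambda>n. x' n \<oplus> y' n)"
  unfolding seq_eq_def
proof (rule null_seq_le)
  show "(\<lambda>n. nrm B (x n \<ominus> x' n) + nrm B (y n \<ominus> y' n)) \<longlonglongrightarrow> 0"
    using tendsto_add[OF assms(5,6)[unfolded seq_eq_def]] by simp
qed (use assms in \<open>simp_all add: nrm_diff_nonneg nrm_add_diff\<close>)

lemma Cauchy_seq_bounded: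
  assumes x: "Cauchy_seq x"
  obtains K where "0 < K" "\<And>n. nrm B (x n) \<le> K"
proof -
  have "Bseq (\<lambda>n. nrm B (x n))"
    using nrm_tendsto[OF x] convergentI convergent_imp_Bseq by blast
  then obtain K where "0 < K" "\<And>n. norm (nrm B (x n)) \<le> K"
    unfolding Bseq_def by blast
  then show thesis
    using that by (metis abs_le_D1 real_norm_def)
qed

lemma Cauchy_seq_mult:
  assumes x: "Cauchy_seq x" and y: "Cauchy_seq y"
  shows "Cauchy_seq (\<lambda>n. x n \<otimes> y n)"
  unfolding Cauchy_seq_def
proof (intro conjI allI impI)
  fix e :: real assume e: "0 < e"
  obtain K where K: "0 < K" "\<And>n. nrm B (x n) \<le> K"
    using Cauchy_seq_bounded[OF x] by blast
  obtain L where L: "0 < L" "\<And>n. nrm B (y n) \<le> L"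
    using Cauchy_seq_bounded[OF y] by blast
  have pos: "0 < e / (2 * L)" "0 < e / (2 * K)"
    using e K(1) L(1) by simp_all
  obtain N where N: "\<And>m n. N \<le> m \<Longrightarrow> N \<le> n \<Longrightarrow> nrm B (x m \<ominus> x n) < e / (2 * L)"
    using x pos(1) unfolding Cauchy_seq_def by blast
  obtain M where M: "\<And>m n. M \<le> m \<Longrightarrow> M \<le> n \<Longrightarrow> nrm B (y m \<ominus> y n) < e / (2 * K)"
    using y pos(2) unfolding Cauchy_seq_def by blast
  have "nrm B (x m \<otimes> y m \<ominus> x n \<otimes> y n) < e" if "max N M \<le> m" "max N M \<le> n" for m n
  proof -
    have "nrm B (x m \<otimes> y m \<ominus> x n \<otimes> y n)
        \<le> nrm B (x m) * nrm B (y m \<ominus> y n) + nrm B (y n) * nrm B (x m \<ominus> x n)"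
      using x y by (simp add: nrm_mult_diff)
    also have "\<dots> \<le> K * nrm B (y m \<ominus> y n) + L * nrm B (x m \<ominus> x n)"
      using x y by (intro add_mono mult_right_mono K L nrm_diff_nonneg) simp_all
    also have "\<dots> < K * (e / (2 * K)) + L * (e / (2 * L))"
      using N[of m n] M[of m n] that K(1) L(1) by (intro add_strict_mono mult_strict_left_mono) auto
    also have "\<dots> = e"
      using K(1) L(1) by simp
    finally show ?thesis .
  qed
  then show "\<exists>N. \<forall>m\<ge>N. \<forall>n\<ge>N. nrm B (x m \<otimes> y m \<ominus> x n \<otimes> y n) < e"
    by blast
qed (use x y in simp)

lemma seq_eq_mult:
  assumes "Cauchy_seq x" "Cauchy_seq y" "Cauchy_seq x'" "Cauchy_seq y'" "seq_eq x x'" "seq_eq y y'"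
  shows "seq_eq (\<lambda>n. x n \<otimes> y n) (\<lambda>n. x' n \<otimes> y' n)"
  unfolding seq_eq_def
proof (rule null_seq_le)
  have "(\<lambda>n. nrm B (x n) * nrm B (y n \<ominus> y' n) + nrm B (y' n) * nrm B (x n \<ominus> x' n))
      \<longlonglongrightarrow> nrm completion (rep x) * 0 + nrm completion (rep y') * 0"
    by (intro tendsto_add tendsto_mult nrm_tendsto assms(1,4) assms(5,6)[unfolded seq_eq_def])
  then show "(\<lambda>n. nrm B (x n) * nrm B (y n \<ominus> y' n) + nrm B (y' n) * nrm B (x n \<ominus> x' n)) \<longlonglongrightarrow> 0"
    by simp
qed (use assms in \<open>simp_all add: nrm_diff_nonneg nrm_mult_diff\<close>)

lemma Cauchy_seq_scal: "Cauchy_seq x \<Longrightarrow> Cauchy_seq (\<lambda>n. scal B c (x n))"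
  by (rule Cauchy_seq_lipschitz[where K = "cmod c"]) (simp_all add: nrm_scal_diff pre_scal_closed)

lemma Cauchy_seq_adj: "Cauchy_seq x \<Longrightarrow> Cauchy_seq (\<lambda>n. adj B (x n))"
  by (rule Cauchy_seq_lipschitz[where K = 1]) (use nrm_adj_diff in \<open>simp_all add: pre_adj_closed\<close>)

lemma Cauchy_seq_uminus: "Cauchy_seq x \<Longrightarrow> Cauchy_seq (\<lambda>n. \<ominus> x n)"
  using Cauchy_seq_scal[of x "- 1"] by (simp add: scal_minus_one)

lemma Cauchy_seq_one_zero [simp]: "Cauchy_seq (\<lambda>_. \<one>)" "Cauchy_seq (\<lambda>_. \<zero>)"
  by (simp_all add: Cauchy_seq_const)

lemmas Cauchy_seq_intros [simp] =
  Cauchy_seq_add Cauchy_seq_mult Cauchy_seq_scal Cauchy_seq_adj Cauchy_seq_uminus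

text \<open>Well-definedness: on the left the operations act on stored representatives, on the right
  on arbitrary sequences of the classes. Afterwards each algebraic law of the completion is the
  termwise law of \<open>B\<close>.\<close>

lemma completion_simps:
  "carrier completion = rep ` Collect Cauchy_seq"
  "\<one>\<^bsub>completion\<^esub> = rep (\<lambda>_. \<one>)" "\<zero>\<^bsub>completion\<^esub> = rep (\<lambda>_. \<zero>)"
  "Cauchy_seq x \<Longrightarrow> Cauchy_seq y \<Longrightarrow> rep x \<oplus>\<^bsub>completion\<^esub> rep y = rep (\<lambda>n. x n \<oplus> y n)"
  "Cauchy_seq x \<Longrightarrow> Cauchy_seq y \<Longrightarrow> rep x \<otimes>\<^bsub>completion\<^esub> rep y = rep (\<lambda>n. x n \<otimes> y n)"
  "Cauchy_seq x \<Longrightarrow> scal completion c (rep x) = rep (\<lambda>n. scal B c (x n))"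
  "Cauchy_seq x \<Longrightarrow> adj completion (rep x) = rep (\<lambda>n. adj B (x n))"
proof -
  assume x: "Cauchy_seq x"
  note r = rep(1)[OF x] seq_eq_sym[OF x rep[OF x]]
  have "rep (\<lambda>n. scal B c (rep x n)) = rep (\<lambda>n. scal B c (x n))"
    using x r by (simp add: rep_eq_iff seq_eq_lipschitz[OF _ _ _ pre_scal_closed nrm_scal_diff])
  then show "scal completion c (rep x) = rep (\<lambda>n. scal B c (x n))"
    by (simp add: completion_def)
  have "rep (\<lambda>n. adj B (rep x n)) = rep (\<lambda>n. adj B (x n))"
    using x r by (simp add: rep_eq_iff seq_eq_lipschitz[OF _ _ _ pre_adj_closed nrm_adj_diff])
  then show "adj completion (rep x) = rep (\<lambda>n. adj B (x n))"
    by (simp add: completion_def)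
  assume y: "Cauchy_seq y"
  note s = rep(1)[OF y] seq_eq_sym[OF y rep[OF y]]
  have "rep (\<lambda>n. rep x n \<oplus> rep y n) = rep (\<lambda>n. x n \<oplus> y n)"
    using x y r s by (simp add: rep_eq_iff seq_eq_add)
  then show "rep x \<oplus>\<^bsub>completion\<^esub> rep y = rep (\<lambda>n. x n \<oplus> y n)"
    by (simp add: completion_def)
  have "rep (\<lambda>n. rep x n \<otimes> rep y n) = rep (\<lambda>n. x n \<otimes> y n)"
    using x y r s by (simp add: rep_eq_iff seq_eq_mult)
  then show "rep x \<otimes>\<^bsub>completion\<^esub> rep y = rep (\<lambda>n. x n \<otimes> y n)"
    by (simp add: completion_def)
qed (simp_all add: completion_def)

lemma nrm_completion_eqI: "Cauchy_seq x \<Longrightarrow> (\<lambda>n. nrm B (x n)) \<longlonglongrightarrow> l \<Longrightarrow> nrm completion (rep x) = l"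
  using nrm_tendsto by (rule LIMSEQ_unique)

text \<open>Identities hold termwise under \<open>rep\<close>; the norm axioms are limits of those
  of \<open>B\<close>, by \<open>nrm_tendsto\<close>.\<close>

lemma pre_cstar_completion: "pre_cstar completion"
proof -
  note simps = completion_simps
  have "abelian_group completion"
  proof (rule abelian_groupI)
    fix u assume "u \<in> carrier completion"
    then obtain x where "Cauchy_seq x" "u = rep x"
      by (auto simp: simps)
    then show "\<exists>v\<in>carrier completion. v \<oplus>\<^bsub>completion\<^esub> u = \<zero>\<^bsub>completion\<^esub>"
      by (intro bexI[of _ "rep (\<lambda>n. \<ominus> x n)"]) (simp_all add: simps l_neg)
  qed (auto simp: simps a_ac)
  moreover have "Group.monoid completion"
    by (rule monoidI) (auto simp: simps m_assoc)
  ultimately interpret C: ring completion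
    by (rule ringI) (auto simp: simps l_distr r_distr)
  show ?thesis
  proof
    fix u v :: "nat \<Rightarrow> 'a" and c assume "u \<in> carrier completion"
    then obtain x where x: "Cauchy_seq x" "u = rep x"
      by (auto simp: simps)
    show "0 \<le> nrm completion u"
      unfolding x(2)
      by (rule LIMSEQ_le_const[OF nrm_tendsto[OF x(1)]]) (use x in \<open>simp add: pre_nrm_nonneg\<close>)
    show "nrm completion (scal completion c u) = cmod c * nrm completion u"
      using x tendsto_mult[OF tendsto_const[of "cmod c"] nrm_tendsto[OF x(1)]]
      by (simp add: simps nrm_completion_eqI pre_nrm_scal)
    show "nrm completion (adj completion u \<otimes>\<^bsub>completion\<^esub> u) = (nrm completion u)\<^sup>2"
      using x tendsto_power[OF nrm_tendsto[OF x(1)], of 2]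
      by (simp add: simps nrm_completion_eqI pre_nrm_cstar)
    assume "v \<in> carrier completion"
    then obtain y where y: "Cauchy_seq y" "v = rep y"
      by (auto simp: simps)
    have "nrm completion (rep (\<lambda>n. x n \<oplus> y n)) \<le> nrm completion (rep x) + nrm completion (rep y)"
      using x(1) y(1)
      by (intro LIMSEQ_le[OF nrm_tendsto tendsto_add[OF nrm_tendsto nrm_tendsto]])
        (simp_all add: pre_nrm_triangle)
    then show "nrm completion (u \<oplus>\<^bsub>completion\<^esub> v) \<le> nrm completion u + nrm completion v"
      using x y by (simp add: simps)
    have "nrm completion (rep (\<lambda>n. x n \<otimes> y n)) \<le> nrm completion (rep x) * nrm completion (rep y)"
      using x(1) y(1)
      by (intro LIMSEQ_le[OF nrm_tendsto tendsto_mult[OF nrm_tendsto nrm_tendsto]])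
        (simp_all add: pre_nrm_mult)
    then show "nrm completion (u \<otimes>\<^bsub>completion\<^esub> v) \<le> nrm completion u * nrm completion v"
      using x y by (simp add: simps)
  qed (auto simp: simps pre_scal_closed pre_scal_add_right pre_scal_add_left pre_scal_scal
      pre_scal_one pre_scal_mult_left pre_scal_mult_right pre_adj_closed pre_adj_add pre_adj_scal
      pre_adj_mult pre_adj_adj)
qed

lemma completion_diff:
  assumes "Cauchy_seq x" "Cauchy_seq y"
  shows "rep x \<ominus>\<^bsub>completion\<^esub> rep y = rep (\<lambda>n. x n \<ominus> y n)"
proof -
  interpret C: pre_cstar completion
    by (rule pre_cstar_completion)
  have "\<ominus>\<^bsub>completion\<^esub> rep y = rep (\<lambda>n. \<ominus> y n)"
    using assms by (intro C.minus_equality) (simp_all add: completion_simps l_neg)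
  then show ?thesis
    using assms by (simp add: a_minus_def completion_simps)
qed

lemma Cauchy_seq_diff [simp]: "Cauchy_seq x \<Longrightarrow> Cauchy_seq y \<Longrightarrow> Cauchy_seq (\<lambda>n. x n \<ominus> y n)"
  by (simp add: a_minus_def)

definition embed :: "'a \<Rightarrow> nat \<Rightarrow> 'a" where
  "embed a = rep (\<lambda>_. a)"

lemma nrm_embed: "a \<in> carrier B \<Longrightarrow> nrm completion (embed a) = nrm B a"
  unfolding embed_def by (rule nrm_completion_eqI) (simp_all add: Cauchy_seq_const)

lemma nrm_rep_le:
  assumes "Cauchy_seq x" "\<And>n. n \<ge> N \<Longrightarrow> nrm B (x n) \<le> e"
  shows "nrm completion (rep x) \<le> e"
  using nrm_tendsto[OF assms(1)] assms(2) by (intro LIMSEQ_le_const2) auto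

lemma embed_dense:
  assumes "Cauchy_seq x" "0 < e"
  shows "\<exists>N. \<forall>n\<ge>N. nrm completion (rep x \<ominus>\<^bsub>completion\<^esub> embed (x n)) < e"
proof -
  obtain N where N: "\<And>m n. N \<le> m \<Longrightarrow> N \<le> n \<Longrightarrow> nrm B (x m \<ominus> x n) < e / 2"
    using assms unfolding Cauchy_seq_def by (metis half_gt_zero)
  show ?thesis
  proof (intro exI[of _ N] allI impI)
    fix n assume n: "N \<le> n"
    have const: "Cauchy_seq (\<lambda>_. x n)"
      by (rule Cauchy_seq_const) (simp add: assms(1))
    \<comment> \<open>A limit of numbers below e / 2 is only at most e / 2; the halving leaves room
      for the strict inequality.\<close>
    have "nrm completion (rep (\<lambda>m. x m \<ominus> x n)) \<le> e / 2"
    proof (rule nrm_rep_le)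
      show "nrm B (x m \<ominus> x n) \<le> e / 2" if "N \<le> m" for m
        using N[OF that n] by simp
    qed (use assms(1) const in simp)
    then show "nrm completion (rep x \<ominus>\<^bsub>completion\<^esub> embed (x n)) < e"
      using assms const by (simp add: embed_def completion_diff)
  qed
qed

text \<open>The limit of a Cauchy sequence in the completion is the class of a sequence of elements of
  the original algebra, the \<open>n\<close>-th of which is at distance at most \<open>1/(n+1)\<close> from the \<open>n\<close>-th term.\<close>

lemma cstar_structure_completion: "cstar_structure completion"
proof -
  interpret C: pre_cstar completion
    by (rule pre_cstar_completion)
  note C.Cauchy_seq_closed [simp del] and C.pre_scal_closed [simp] and C.pre_adj_closed [simp]
  have closed: "rep x \<in> carrier completion" if "Cauchy_seq x" for x
    using that by (simp add: completion_simps)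
  have embed_closed: "embed a \<in> carrier completion" if "a \<in> carrier B" for a
    using that by (simp add: embed_def closed Cauchy_seq_const)
  show ?thesis
  proof
    fix u assume "u \<in> carrier completion"
    then obtain x where x: "Cauchy_seq x" "u = rep x"
      unfolding completion_simps(1) by blast
    \<comment> \<open>Definiteness is created here: norm 0 means that the sequence is null, and the
      null sequences are the class of zero.\<close>
    have "nrm completion (rep x) = 0 \<longleftrightarrow> (\<lambda>n. nrm B (x n)) \<longlonglongrightarrow> 0"
      using nrm_tendsto[OF x(1)] nrm_completion_eqI[OF x(1), of 0] by metis
    also have "\<dots> \<longleftrightarrow> rep x = rep (\<lambda>_. \<zero>)"
      using x by (simp add: rep_eq_iff seq_eq_def a_minus_def)
    finally show "nrm completion u = 0 \<longleftrightarrow> u = \<zero>\<^bsub>completion\<^esub>"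
      by (simp add: x completion_simps)
  next
    fix s :: "nat \<Rightarrow> nat \<Rightarrow> 'a"
    assume s: "\<And>n. s n \<in> carrier completion"
      and Cauchy: "\<And>e. 0 < e \<Longrightarrow> \<exists>N. \<forall>m\<ge>N. \<forall>n\<ge>N. nrm completion (s m \<ominus>\<^bsub>completion\<^esub> s n) < e"
    have "\<exists>z. z \<in> carrier B \<and> nrm completion (s n \<ominus>\<^bsub>completion\<^esub> embed z) < 1 / real (Suc n)" for n
    proof -
      obtain x where x: "Cauchy_seq x" "s n = rep x"
        using s[of n] unfolding completion_simps(1) by blast
      obtain N where "\<forall>k\<ge>N.
          nrm completion (rep x \<ominus>\<^bsub>completion\<^esub> embed (x k)) < 1 / real (Suc n)"
        using embed_dense[OF x(1), of "1 / real (Suc n)"] by (simp only: zero_less_divide_1_iff of_nat_0_less_iff zero_less_Suc) blast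
      then show ?thesis
        using x by (intro exI[of _ "x N"]) simp
    qed
    then obtain z where z: "\<And>n. z n \<in> carrier B"
      "\<And>n. nrm completion (s n \<ominus>\<^bsub>completion\<^esub> embed (z n)) < 1 / real (Suc n)"
      by metis
    have small: "\<exists>N. \<forall>n\<ge>N. 1 / real (Suc n) < e" if "0 < e" for e
      using LIMSEQ_D[OF LIMSEQ_inverse_real_of_nat that] by (simp add: inverse_eq_divide)
    have zc: "Cauchy_seq z"
      unfolding Cauchy_seq_def
    proof (intro conjI allI impI)
      fix e :: real assume e: "0 < e"
      obtain N where N: "\<And>m n. N \<le> m \<Longrightarrow> N \<le> n \<Longrightarrow> nrm completion (s m \<ominus>\<^bsub>completion\<^esub> s n) < e / 3"
        using Cauchy[of "e / 3"] e by (metis divide_pos_pos zero_less_numeral)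
      obtain M where M: "\<And>n. M \<le> n \<Longrightarrow> 1 / real (Suc n) < e / 3"
        using small[of "e / 3"] e by (metis divide_pos_pos zero_less_numeral)
      have "nrm B (z m \<ominus> z n) < e" if "max N M \<le> m" "max N M \<le> n" for m n
      proof -
        have "nrm B (z m \<ominus> z n) = nrm completion (embed (z m) \<ominus>\<^bsub>completion\<^esub> embed (z n))"
          using nrm_embed[of "z m \<ominus> z n"] z(1)
          by (simp add: embed_def completion_diff Cauchy_seq_const)
        also have "\<dots> \<le> nrm completion (embed (z m) \<ominus>\<^bsub>completion\<^esub> s m)
            + nrm completion (s m \<ominus>\<^bsub>completion\<^esub> embed (z n))"
          using z(1) s by (intro C.nrm_diff_triangle embed_closed)
        also have "\<dots> \<le> nrm completion (s m \<ominus>\<^bsub>completion\<^esub> embed (z m))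
            + (nrm completion (s m \<ominus>\<^bsub>completion\<^esub> s n) + nrm completion (s n \<ominus>\<^bsub>completion\<^esub> embed (z n)))"
          using z(1) s C.nrm_diff_commute[of "embed (z m)" "s m"]
            C.nrm_diff_triangle[of "s m" "s n" "embed (z n)"] by (simp add: embed_closed)
        also have "\<dots> < e / 3 + (e / 3 + e / 3)"
          using z(2)[of m] z(2)[of n] N[of m n] M[of m] M[of n] that by simp
        finally show ?thesis by simp
      qed
      then show "\<exists>N. \<forall>m\<ge>N. \<forall>n\<ge>N. nrm B (z m \<ominus> z n) < e"
        by blast
    qed (rule z(1))
    have "(\<lambda>n. nrm completion (s n \<ominus>\<^bsub>completion\<^esub> rep z)) \<longlonglongrightarrow> 0"
    proof (rule LIMSEQ_I)
      fix e :: real assume e: "0 < e"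
      obtain N where N: "\<And>n. n \<ge> N \<Longrightarrow> nrm completion (rep z \<ominus>\<^bsub>completion\<^esub> embed (z n)) < e / 2"
        using embed_dense[OF zc, of "e / 2"] e by (meson half_gt_zero)
      obtain M where M: "\<And>n. M \<le> n \<Longrightarrow> 1 / real (Suc n) < e / 2"
        using small[of "e / 2"] e by (meson half_gt_zero)
      have "nrm completion (s n \<ominus>\<^bsub>completion\<^esub> rep z) < e" if "max N M \<le> n" for n
      proof -
        have "nrm completion (s n \<ominus>\<^bsub>completion\<^esub> rep z)
            \<le> nrm completion (s n \<ominus>\<^bsub>completion\<^esub> embed (z n)) + nrm completion (rep z \<ominus>\<^bsub>completion\<^esub> embed (z n))"
          using C.nrm_diff_triangle[OF s embed_closed[OF z(1)] closed[OF zc], of n n]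
            C.nrm_diff_commute[OF closed[OF zc] embed_closed[OF z(1)], of n] by simp
        then show ?thesis
          using z(2)[of n] N[of n] M[of n] that by simp
      qed
      then show "\<exists>N. \<forall>n\<ge>N. norm (nrm completion (s n \<ominus>\<^bsub>completion\<^esub> rep z) - 0) < e"
        using C.nrm_diff_nonneg[OF s closed[OF zc]] by (intro exI[of _ "max N M"]) simp
    qed
    then show "\<exists>l\<in>carrier completion. (\<lambda>n. nrm completion (s n \<ominus>\<^bsub>completion\<^esub> l)) \<longlonglongrightarrow> 0"
      using closed[OF zc] by blast
  qed (simp_all add: C.pre_scal_add_right C.pre_scal_add_left C.pre_scal_scal C.pre_scal_one
      C.pre_scal_mult_left C.pre_scal_mult_right C.pre_adj_add C.pre_adj_scal C.pre_adj_mult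
      C.pre_adj_adj C.pre_nrm_nonneg C.pre_nrm_triangle C.pre_nrm_scal C.pre_nrm_mult
      C.pre_nrm_cstar)
qed

text \<open>The bound by the norm does two things: Cauchy sequences have convergent images, and
  equivalent sequences have the same limit. Positivity is a closed condition and passes to the
  limit.\<close>

lemma functional_extension:
  fixes \<omega> :: "'a \<Rightarrow> complex"
  assumes add: "\<And>x y. x \<in> carrier B \<Longrightarrow> y \<in> carrier B \<Longrightarrow> \<omega> (x \<oplus> y) = \<omega> x + \<omega> y"
    and scal: "\<And>c x. x \<in> carrier B \<Longrightarrow> \<omega> (scal B c x) = c * \<omega> x"
    and bound: "\<And>x. x \<in> carrier B \<Longrightarrow> cmod (\<omega> x) \<le> nrm B x"
    and pos: "\<And>x. x \<in> carrier B \<Longrightarrow> Im (\<omega> (adj B x \<otimes> x)) = 0 \<and> 0 \<le> Re (\<omega> (adj B x \<otimes> x))"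
  obtains \<omega>' where
    "\<And>x y. x \<in> carrier completion \<Longrightarrow> y \<in> carrier completion \<Longrightarrow>
      \<omega>' (x \<oplus>\<^bsub>completion\<^esub> y) = \<omega>' x + \<omega>' y"
    "\<And>c x. x \<in> carrier completion \<Longrightarrow> \<omega>' (scal completion c x) = c * \<omega>' x"
    "\<And>x. x \<in> carrier completion \<Longrightarrow> Im (\<omega>' (adj completion x \<otimes>\<^bsub>completion\<^esub> x)) = 0
      \<and> 0 \<le> Re (\<omega>' (adj completion x \<otimes>\<^bsub>completion\<^esub> x))"
    "\<And>a. a \<in> carrier B \<Longrightarrow> \<omega>' (embed a) = \<omega> a"
proof -
  define \<omega>' where "\<omega>' x = lim (\<lambda>n. \<omega> (x n))" for x
  have diff: "cmod (\<omega> x - \<omega> y) \<le> nrm B (x \<ominus> y)" if "x \<in> carrier B" "y \<in> carrier B" for x y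
  proof -
    have "\<omega> (\<ominus> y) = - \<omega> y"
      using that scal[of y "- 1"] by (simp add: scal_minus_one)
    then have "\<omega> (x \<ominus> y) = \<omega> x - \<omega> y"
      using that add[of x "\<ominus> y"] by (simp add: a_minus_def)
    then show ?thesis
      using bound[of "x \<ominus> y"] that by simp
  qed
  have lim: "(\<lambda>n. \<omega> (x n)) \<longlonglongrightarrow> \<omega>' (rep x)" if x: "Cauchy_seq x" for x
  proof -
    have "convergent (\<lambda>n. \<omega> (y n))" if y: "Cauchy_seq y" for y
    proof (rule Cauchy_convergent, rule metric_CauchyI)
      fix e :: real assume "0 < e"
      then obtain N where "\<forall>m\<ge>N. \<forall>n\<ge>N. nrm B (y m \<ominus> y n) < e"
        using y unfolding Cauchy_seq_def by blast
      moreover have "dist (\<omega> (y m)) (\<omega> (y n)) \<le> nrm B (y m \<ominus> y n)" for m n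
        unfolding dist_norm by (intro diff Cauchy_seq_closed y)
      ultimately show "\<exists>N. \<forall>m\<ge>N. \<forall>n\<ge>N. dist (\<omega> (y m)) (\<omega> (y n)) < e"
        by (meson le_less_trans)
    qed
    then have "(\<lambda>n. \<omega> (rep x n)) \<longlonglongrightarrow> \<omega>' (rep x)"
      using rep(1)[OF x] by (simp add: \<omega>'_def convergent_LIMSEQ_iff)
    moreover have "(\<lambda>n. cmod (\<omega> (x n) - \<omega> (rep x n))) \<longlonglongrightarrow> 0"
      using x rep(1)[OF x] by (intro null_seq_le[OF _ _ rep(2)[OF x, unfolded seq_eq_def]] diff) auto
    then have "(\<lambda>n. \<omega> (x n) - \<omega> (rep x n)) \<longlonglongrightarrow> 0"
      by (simp add: tendsto_norm_zero_iff)
    ultimately show ?thesis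
      by (rule Lim_transform)
  qed
  have eqI: "\<omega>' (rep x) = l" if "Cauchy_seq x" "(\<lambda>n. \<omega> (x n)) \<longlonglongrightarrow> l" for x l
    using lim that LIMSEQ_unique by blast
  show thesis
  proof
    fix u v c assume "u \<in> carrier completion"
    then obtain x where x: "Cauchy_seq x" "u = rep x"
      by (auto simp: completion_simps)
    show "\<omega>' (scal completion c u) = c * \<omega>' u"
      using x tendsto_mult[OF tendsto_const[of c] lim[OF x(1)]]
      by (simp add: completion_simps eqI scal)
    have l: "(\<lambda>n. \<omega> (adj B (x n) \<otimes> x n)) \<longlonglongrightarrow> \<omega>' (adj completion u \<otimes>\<^bsub>completion\<^esub> u)"
      using x lim[of "\<lambda>n. adj B (x n) \<otimes> x n"] by (simp add: completion_simps)
    have "(\<lambda>n. Im (\<omega> (adj B (x n) \<otimes> x n))) \<longlonglongrightarrow> 0"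
      using x pos by simp
    then have "Im (\<omega>' (adj completion u \<otimes>\<^bsub>completion\<^esub> u)) = 0"
      using tendsto_Im[OF l] LIMSEQ_unique by blast
    moreover have "0 \<le> Re (\<omega>' (adj completion u \<otimes>\<^bsub>completion\<^esub> u))"
      using x pos by (intro LIMSEQ_le_const[OF tendsto_Re[OF l]]) auto
    ultimately show "Im (\<omega>' (adj completion u \<otimes>\<^bsub>completion\<^esub> u)) = 0
        \<and> 0 \<le> Re (\<omega>' (adj completion u \<otimes>\<^bsub>completion\<^esub> u))"
      by blast
    assume "v \<in> carrier completion"
    then obtain y where y: "Cauchy_seq y" "v = rep y"
      by (auto simp: completion_simps)
    show "\<omega>' (u \<oplus>\<^bsub>completion\<^esub> v) = \<omega>' u + \<omega>' v"
      using x y tendsto_add[OF lim[OF x(1)] lim[OF y(1)]]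
      by (simp add: completion_simps eqI add)
  next
    fix a assume "a \<in> carrier B"
    then show "\<omega>' (embed a) = \<omega> a"
      by (simp add: embed_def eqI Cauchy_seq_const)
  qed
qed

end

lemma star_hom_embed:
  assumes "pre_cstar B"
  shows "star_hom B (pre_cstar.completion B) (pre_cstar.embed B)"
proof -
  interpret pre_cstar B by fact
  show ?thesis
    by (auto simp: star_hom_def ring_hom_def embed_def completion_simps pre_scal_closed
        pre_adj_closed Cauchy_seq_const)
qed

section \<open>Adjointable operators\<close>

text \<open>\<open>H\<close> is a subspace of a type because Fock space sits inside all functions on
  words. Definiteness is left out because a state need not be faithful; null vectors are never
  divided out.\<close>

locale semi_inner_space = vector_space scale
  for scale :: "complex \<Rightarrow> 'h::ab_group_add \<Rightarrow> 'h" +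
  fixes H :: "'h set" and ip :: "'h \<Rightarrow> 'h \<Rightarrow> complex"
  assumes subspace_H: "subspace H"
    and ip_add_right: "f \<in> H \<Longrightarrow> g \<in> H \<Longrightarrow> h \<in> H \<Longrightarrow> ip f (g + h) = ip f g + ip f h"
    and ip_scale_right: "f \<in> H \<Longrightarrow> g \<in> H \<Longrightarrow> ip f (scale c g) = c * ip f g"
    and ip_cnj: "f \<in> H \<Longrightarrow> g \<in> H \<Longrightarrow> ip g f = cnj (ip f g)"
    and ip_nonneg: "f \<in> H \<Longrightarrow> 0 \<le> Re (ip f f)"
begin

lemma H_closed [simp]:
  "0 \<in> H" "f \<in> H \<Longrightarrow> g \<in> H \<Longrightarrow> f + g \<in> H" "f \<in> H \<Longrightarrow> scale c f \<in> H"
  using subspace_H by (simp_all add: subspace_0 subspace_add subspace_scale)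

lemma ip_add_left: "f \<in> H \<Longrightarrow> g \<in> H \<Longrightarrow> h \<in> H \<Longrightarrow> ip (f + g) h = ip f h + ip g h"
  by (simp add: ip_cnj[of h] ip_add_right)

lemma ip_scale_left: "f \<in> H \<Longrightarrow> g \<in> H \<Longrightarrow> ip (scale c f) g = cnj c * ip f g"
  by (simp add: ip_cnj[of g] ip_scale_right)

lemma Im_ip_self: "f \<in> H \<Longrightarrow> Im (ip f f) = 0"
  using arg_cong[OF ip_cnj[of f f], of Im] by simp

definition snorm :: "'h \<Rightarrow> real" where
  "snorm f = sqrt (Re (ip f f))"

lemma snorm_nonneg: "f \<in> H \<Longrightarrow> 0 \<le> snorm f"
  by (simp add: snorm_def ip_nonneg)

lemma snorm_power2: "f \<in> H \<Longrightarrow> (snorm f)\<^sup>2 = Re (ip f f)"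
  by (simp add: snorm_def ip_nonneg)

lemma Cauchy_Schwarz:
  assumes "f \<in> H" "g \<in> H"
  shows "cmod (ip f g) \<le> snorm f * snorm g"
proof -
  have "(cmod (ip f g))\<^sup>2 \<le> Re (ip f f) * Re (ip g g)"
  proof (rule quadratic_form_bound)
    fix z
    have "z * cnj z = of_real ((cmod z)\<^sup>2)"
      by (rule complex_norm_square[symmetric])
    moreover have "ip (f + scale z g) (f + scale z g)
        = ip f f + z * ip f g + cnj z * cnj (ip f g) + z * cnj z * ip g g"
      using assms by (simp add: ip_add_left ip_add_right ip_scale_left ip_scale_right
          ip_cnj[of f g] algebra_simps)
    moreover have "0 \<le> Re (ip (f + scale z g) (f + scale z g))"
      using assms by (intro ip_nonneg) simp
    ultimately show "0 \<le> Re (ip f f) + 2 * Re (z * ip f g) + (cmod z)\<^sup>2 * Re (ip g g)"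
      by (simp del: of_real_power)
  qed (use assms ip_nonneg in simp_all)
  then have "(cmod (ip f g))\<^sup>2 \<le> (snorm f * snorm g)\<^sup>2"
    using assms by (simp add: power_mult_distrib snorm_power2)
  then show ?thesis
    by (rule power2_le_imp_le) (simp add: assms snorm_nonneg)
qed

lemma snorm_triangle:
  assumes "f \<in> H" "g \<in> H"
  shows "snorm (f + g) \<le> snorm f + snorm g"
proof (rule power2_le_imp_le)
  have "(snorm (f + g))\<^sup>2 = (snorm f)\<^sup>2 + (snorm g)\<^sup>2 + 2 * Re (ip f g)"
    using assms by (simp add: snorm_power2 ip_add_left ip_add_right ip_cnj[of f g])
  also have "Re (ip f g) \<le> snorm f * snorm g"
    using Cauchy_Schwarz[OF assms] complex_Re_le_cmod order_trans by blast
  finally show "(snorm (f + g))\<^sup>2 \<le> (snorm f + snorm g)\<^sup>2"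
    by (simp add: power2_sum)
qed (simp add: assms snorm_nonneg)

lemma snorm_scale:
  assumes "f \<in> H"
  shows "snorm (scale c f) = cmod c * snorm f"
proof -
  have "ip (scale c f) (scale c f) = (c * cnj c) * ip f f"
    using assms by (simp add: ip_scale_left ip_scale_right)
  also have "\<dots> = of_real ((cmod c)\<^sup>2) * ip f f"
    by (simp only: complex_norm_square)
  finally show ?thesis
    by (simp add: snorm_def real_sqrt_mult del: of_real_power)
qed

text \<open>Linearity is imposed on the whole type, invariance only on \<open>H\<close>: the ring
  laws of \<open>ops\<close> are equalities of functions at every argument, and distributivity of
  composition over sums uses linearity there.\<close>

definition linear_op :: "('h \<Rightarrow> 'h) \<Rightarrow> bool" where
  "linear_op T \<longleftrightarrow> (\<forall>f g. T (f + g) = T f + T g) \<and> (\<forall>c f. T (scale c f) = scale c (T f))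
     \<and> (\<forall>f\<in>H. T f \<in> H)"

definition bounded_op :: "('h \<Rightarrow> 'h) \<Rightarrow> bool" where
  "bounded_op T \<longleftrightarrow> (\<exists>K\<ge>0. \<forall>f\<in>H. snorm (T f) \<le> K * snorm f)"

text \<open>An infimum of admissible constants, because the quotients
  \<open>snorm (T f) / snorm f\<close> may have denominator 0 at nonzero f. The condition on the
  sign of K bounds the set from below.\<close>

definition op_norm :: "('h \<Rightarrow> 'h) \<Rightarrow> real" where
  "op_norm T = Inf {K. 0 \<le> K \<and> (\<forall>f\<in>H. snorm (T f) \<le> K * snorm f)}"

text \<open>As the inner product may be degenerate, adjoints need not be unique; so the elements are
  pairs of an operator and one of its adjoints.\<close>

definition ops :: "(('h \<Rightarrow> 'h) \<times> ('h \<Rightarrow> 'h)) cstar_struct" where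
  "ops = \<lparr>carrier = {(T, S). linear_op T \<and> linear_op S
        \<and> (\<forall>f\<in>H. \<forall>g\<in>H. ip (T f) g = ip f (S g)) \<and> bounded_op T},
     mult = (\<lambda>(T, S) (T', S'). (T \<circ> T', S' \<circ> S)), one = (id, id),
     zero = ((\<lambda>_. 0), (\<lambda>_. 0)),
     add = (\<lambda>(T, S) (T', S'). ((\<lambda>f. T f + T' f), (\<lambda>f. S f + S' f))),
     scal = (\<lambda>c (T, S). ((\<lambda>f. scale c (T f)), (\<lambda>f. scale (cnj c) (S f)))),
     adj = (\<lambda>(T, S). (S, T)), nrm = (\<lambda>(T, S). op_norm T)\<rparr>"

lemma ops_simps [simp]:
  "(T, S) \<otimes>\<^bsub>ops\<^esub> (T', S') = (T \<circ> T', S' \<circ> S)" "\<one>\<^bsub>ops\<^esub> = (id, id)"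
  "\<zero>\<^bsub>ops\<^esub> = ((\<lambda>_. 0), (\<lambda>_. 0))"
  "(T, S) \<oplus>\<^bsub>ops\<^esub> (T', S') = ((\<lambda>f. T f + T' f), (\<lambda>f. S f + S' f))"
  "scal ops c (T, S) = ((\<lambda>f. scale c (T f)), (\<lambda>f. scale (cnj c) (S f)))"
  "adj ops (T, S) = (S, T)" "nrm ops (T, S) = op_norm T"
  by (simp_all add: ops_def)

lemma ops_carrier: "(T, S) \<in> carrier ops \<longleftrightarrow> linear_op T \<and> linear_op S
    \<and> (\<forall>f\<in>H. \<forall>g\<in>H. ip (T f) g = ip f (S g)) \<and> bounded_op T"
  by (simp add: ops_def)

lemma op_norm_nonneg:
  assumes "bounded_op T"
  shows "0 \<le> op_norm T"
  unfolding op_norm_def using assms by (intro cInf_greatest) (auto simp: bounded_op_def)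

lemma op_norm_le:
  assumes "0 \<le> K" "\<And>f. f \<in> H \<Longrightarrow> snorm (T f) \<le> K * snorm f"
  shows "op_norm T \<le> K"
  unfolding op_norm_def using assms by (intro cInf_lower bdd_belowI[of _ 0]) auto

lemma op_norm_bound:
  assumes T: "bounded_op T" and f: "f \<in> H"
  shows "snorm (T f) \<le> op_norm T * snorm f"
proof (cases "snorm f = 0")
  \<comment> \<open>A bounded operator sends null vectors to null vectors, so both sides are 0
    here.\<close>
  case True
  then show ?thesis
    using T f unfolding bounded_op_def by fastforce
next
  case False
  then have pos: "0 < snorm f"
    using snorm_nonneg[OF f] by simp
  have "snorm (T f) / snorm f \<le> op_norm T"
    unfolding op_norm_def
  proof (rule cInf_greatest)
    show "{K. 0 \<le> K \<and> (\<forall>f\<in>H. snorm (T f) \<le> K * snorm f)} \<noteq> {}"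
      using T unfolding bounded_op_def by blast
    fix K assume "K \<in> {K. 0 \<le> K \<and> (\<forall>f\<in>H. snorm (T f) \<le> K * snorm f)}"
    then show "snorm (T f) / snorm f \<le> K"
      using f pos by (simp add: divide_le_eq)
  qed
  then show ?thesis
    using pos by (simp add: divide_le_eq)
qed

lemma linear_opD:
  assumes "linear_op T"
  shows "T (f + g) = T f + T g" "T (scale c f) = scale c (T f)" "f \<in> H \<Longrightarrow> T f \<in> H" "T 0 = 0"
proof -
  show add: "T (f + g) = T f + T g" for f g
    using assms by (simp add: linear_op_def)
  show "T 0 = 0"
    using add[of 0 0] by simp
qed (use assms in \<open>simp_all add: linear_op_def\<close>)

lemma ops_carrierD:
  assumes "(T, S) \<in> carrier ops"
  shows "linear_op T" "linear_op S" "f \<in> H \<Longrightarrow> g \<in> H \<Longrightarrow> ip (T f) g = ip f (S g)" "bounded_op T"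
  using assms by (simp_all add: ops_carrier)

text \<open>The square of \<open>snorm (S g)\<close> is the real part of
  \<open>ip (T (S g)) g\<close>, and Cauchy-Schwarz leaves one factor \<open>snorm (S g)\<close> to
  cancel. So the bound that \<open>ops\<close> imposes on \<open>T\<close> is inherited by the
  adjoint.\<close>

lemma snorm_adjoint_le:
  assumes TS: "(T, S) \<in> carrier ops" and g: "g \<in> H"
  shows "snorm (S g) \<le> op_norm T * snorm g"
proof (cases "snorm (S g) = 0")
  case True
  then show ?thesis
    using g op_norm_nonneg[OF ops_carrierD(4)[OF TS]] snorm_nonneg by simp
next
  case False
  note TS' = ops_carrierD[OF TS]
  have Sg: "S g \<in> H" and TSg: "T (S g) \<in> H"
    using linear_opD[OF TS'(2)] linear_opD[OF TS'(1)] g by simp_all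
  have "snorm (S g) * snorm (S g) = Re (ip (S g) (S g))"
    using snorm_power2[OF Sg] by (simp add: power2_eq_square)
  also have "\<dots> = Re (ip (T (S g)) g)"
    using TS'(3)[OF Sg g] by simp
  also have "\<dots> \<le> snorm (T (S g)) * snorm g"
    using Cauchy_Schwarz[OF TSg g] complex_Re_le_cmod order_trans by blast
  also have "\<dots> \<le> (op_norm T * snorm (S g)) * snorm g"
    by (intro mult_right_mono op_norm_bound TS' Sg snorm_nonneg g)
  finally have "snorm (S g) * snorm (S g) \<le> snorm (S g) * (op_norm T * snorm g)"
    by (simp add: mult_ac)
  then show ?thesis
    using False snorm_nonneg[OF Sg] by simp
qed

lemma ops_adj_closed:
  assumes TS: "(T, S) \<in> carrier ops"
  shows "(S, T) \<in> carrier ops"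
proof -
  note TS' = ops_carrierD[OF TS]
  have "ip (S f) g = ip f (T g)" if "f \<in> H" "g \<in> H" for f g
    using TS'(3)[OF that(2,1)] that linear_opD[OF TS'(2)] linear_opD[OF TS'(1)]
    by (simp add: ip_cnj[of f] ip_cnj[of "S f"])
  moreover have "bounded_op S"
    unfolding bounded_op_def
    using snorm_adjoint_le[OF TS] op_norm_nonneg[OF TS'(4)] by blast
  ultimately show ?thesis
    using TS' by (simp add: ops_carrier)
qed

lemma ops_add_closed:
  assumes "(T, S) \<in> carrier ops" "(T', S') \<in> carrier ops"
  shows "((\<lambda>f. T f + T' f), (\<lambda>f. S f + S' f)) \<in> carrier ops"
    and "op_norm (\<lambda>f. T f + T' f) \<le> op_norm T + op_norm T'"
proof -
  note T = ops_carrierD[OF assms(1)] and T' = ops_carrierD[OF assms(2)]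
  note lin = linear_opD[OF T(1)] linear_opD[OF T(2)] linear_opD[OF T'(1)] linear_opD[OF T'(2)]
  have le: "snorm (T f + T' f) \<le> (op_norm T + op_norm T') * snorm f" if "f \<in> H" for f
    using snorm_triangle[of "T f" "T' f"] op_norm_bound[OF T(4) that] op_norm_bound[OF T'(4) that]
      that lin by (simp add: distrib_right)
  have nonneg: "0 \<le> op_norm T + op_norm T'"
    using op_norm_nonneg T(4) T'(4) by simp
  show "op_norm (\<lambda>f. T f + T' f) \<le> op_norm T + op_norm T'"
    by (rule op_norm_le[OF nonneg le])
  have "bounded_op (\<lambda>f. T f + T' f)"
    unfolding bounded_op_def using le nonneg by blast
  then show "((\<lambda>f. T f + T' f), (\<lambda>f. S f + S' f)) \<in> carrier ops"
    unfolding ops_carrier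
    by (simp add: linear_op_def lin algebra_simps ip_add_left ip_add_right T(3) T'(3))
qed

lemma ops_mult_closed:
  assumes "(T, S) \<in> carrier ops" "(T', S') \<in> carrier ops"
  shows "(T \<circ> T', S' \<circ> S) \<in> carrier ops" and "op_norm (T \<circ> T') \<le> op_norm T * op_norm T'"
proof -
  note T = ops_carrierD[OF assms(1)] and T' = ops_carrierD[OF assms(2)]
  note lin = linear_opD[OF T(1)] linear_opD[OF T(2)] linear_opD[OF T'(1)] linear_opD[OF T'(2)]
  have le: "snorm ((T \<circ> T') f) \<le> op_norm T * op_norm T' * snorm f" if "f \<in> H" for f
  proof -
    have "snorm (T (T' f)) \<le> op_norm T * snorm (T' f)"
      using that lin by (intro op_norm_bound T) simp
    also have "\<dots> \<le> op_norm T * (op_norm T' * snorm f)"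
      using that by (intro mult_left_mono op_norm_bound op_norm_nonneg T T')
    finally show ?thesis
      by (simp add: mult.assoc)
  qed
  have nonneg: "0 \<le> op_norm T * op_norm T'"
    using op_norm_nonneg T(4) T'(4) by simp
  show "op_norm (T \<circ> T') \<le> op_norm T * op_norm T'"
    by (rule op_norm_le[OF nonneg le])
  have "bounded_op (T \<circ> T')"
    unfolding bounded_op_def using le nonneg by blast
  then show "(T \<circ> T', S' \<circ> S) \<in> carrier ops"
    unfolding ops_carrier by (simp add: linear_op_def lin T(3) T'(3))
qed

lemma ops_scal_closed:
  assumes "(T, S) \<in> carrier ops"
  shows "((\<lambda>f. scale c (T f)), (\<lambda>f. scale (cnj c) (S f))) \<in> carrier ops"
    and "op_norm (\<lambda>f. scale c (T f)) \<le> cmod c * op_norm T"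
proof -
  note T = ops_carrierD[OF assms(1)]
  note lin = linear_opD[OF T(1)] linear_opD[OF T(2)]
  have le: "snorm (scale c (T f)) \<le> cmod c * op_norm T * snorm f" if "f \<in> H" for f
    using op_norm_bound[OF T(4) that] that lin by (simp add: snorm_scale mult.assoc mult_left_mono)
  have nonneg: "0 \<le> cmod c * op_norm T"
    using op_norm_nonneg T(4) by simp
  show "op_norm (\<lambda>f. scale c (T f)) \<le> cmod c * op_norm T"
    by (rule op_norm_le[OF nonneg le])
  have "bounded_op (\<lambda>f. scale c (T f))"
    unfolding bounded_op_def using le nonneg by blast
  then show "((\<lambda>f. scale c (T f)), (\<lambda>f. scale (cnj c) (S f))) \<in> carrier ops"
    unfolding ops_carrier
    by (simp add: linear_op_def lin scale_right_distrib ip_scale_left ip_scale_right T(3) mult.commute)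
qed

lemma ops_one_zero_closed: "(id, id) \<in> carrier ops" "((\<lambda>_. 0), (\<lambda>_. 0)) \<in> carrier ops"
proof -
  have "bounded_op id"
    unfolding bounded_op_def by (intro exI[of _ 1]) simp
  then show one: "(id, id) \<in> carrier ops"
    by (simp add: ops_carrier linear_op_def)
  show "((\<lambda>_. 0), (\<lambda>_. 0)) \<in> carrier ops"
    using ops_scal_closed(1)[OF one, of 0] by simp
qed

lemma op_norm_scale:
  assumes TS: "(T, S) \<in> carrier ops"
  shows "op_norm (\<lambda>f. scale c (T f)) = cmod c * op_norm T"
proof (cases "c = 0")
  case True
  then show ?thesis
    using ops_scal_closed(2)[OF TS, of 0] op_norm_nonneg[OF ops_carrierD(4)[OF ops_one_zero_closed(2)]]
    by simp
next
  case False
  have "op_norm T \<le> cmod (inverse c) * op_norm (\<lambda>f. scale c (T f))"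
    using ops_scal_closed(2)[OF ops_scal_closed(1)[OF TS], of "inverse c" c] False by simp
  then have "cmod c * op_norm T \<le> op_norm (\<lambda>f. scale c (T f))"
    using False by (simp add: norm_divide field_simps)
  then show ?thesis
    using ops_scal_closed(2)[OF TS, of c] by simp
qed

text \<open>One inequality is submultiplicativity with op_norm S <= op_norm T. For the other, the
  square of \<open>snorm (T f)\<close> is the real part of \<open>ip f (S (T f))\<close>, to which
  Cauchy-Schwarz applies.\<close>

lemma op_norm_cstar:
  assumes TS: "(T, S) \<in> carrier ops"
  shows "op_norm (S \<circ> T) = (op_norm T)\<^sup>2"
proof (rule antisym)
  note T = ops_carrierD[OF TS]
  note nonneg = op_norm_nonneg[OF T(4)]
  have "op_norm S \<le> op_norm T"
    by (rule op_norm_le[OF nonneg snorm_adjoint_le[OF TS]])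
  then show "op_norm (S \<circ> T) \<le> (op_norm T)\<^sup>2"
    using ops_mult_closed(2)[OF ops_adj_closed[OF TS] TS] mult_right_mono[OF _ nonneg]
    by (fastforce simp: power2_eq_square)
  have ST: "bounded_op (S \<circ> T)"
    using ops_mult_closed(1)[OF ops_adj_closed[OF TS] TS] by (rule ops_carrierD(4))
  have "op_norm T \<le> sqrt (op_norm (S \<circ> T))"
  proof (rule op_norm_le)
    fix f assume f: "f \<in> H"
    have Tf: "T f \<in> H" "S (T f) \<in> H"
      using linear_opD[OF T(1)] linear_opD[OF T(2)] f by simp_all
    have "(snorm (T f))\<^sup>2 = Re (ip f (S (T f)))"
      using T(3)[OF f Tf(1)] Tf by (simp add: snorm_power2)
    also have "\<dots> \<le> snorm f * snorm (S (T f))"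
      using Cauchy_Schwarz[OF f Tf(2)] complex_Re_le_cmod order_trans by blast
    also have "\<dots> \<le> snorm f * (op_norm (S \<circ> T) * snorm f)"
      using op_norm_bound[OF ST f] by (intro mult_left_mono snorm_nonneg f) simp
    also have "\<dots> = (sqrt (op_norm (S \<circ> T)) * snorm f)\<^sup>2"
      using op_norm_nonneg[OF ST] by (simp add: power_mult_distrib power2_eq_square mult_ac)
    finally show "snorm (T f) \<le> sqrt (op_norm (S \<circ> T)) * snorm f"
      by (rule power2_le_imp_le) (simp add: op_norm_nonneg[OF ST] snorm_nonneg f)
  qed (simp add: op_norm_nonneg[OF ST])
  then have "(op_norm T)\<^sup>2 \<le> (sqrt (op_norm (S \<circ> T)))\<^sup>2"
    using nonneg by (rule power_mono)
  then show "(op_norm T)\<^sup>2 \<le> op_norm (S \<circ> T)"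
    by (simp add: op_norm_nonneg[OF ST])
qed

lemma pre_cstar_ops: "pre_cstar ops"
proof -
  note closed = ops_add_closed(1) ops_mult_closed(1) ops_scal_closed(1) ops_one_zero_closed
  have "abelian_group ops"
  proof (rule abelian_groupI)
    fix x assume "x \<in> carrier ops"
    then show "\<exists>y\<in>carrier ops. y \<oplus>\<^bsub>ops\<^esub> x = \<zero>\<^bsub>ops\<^esub>"
      using ops_scal_closed(1)[of "fst x" "snd x" "- 1"]
      by (intro bexI[of _ "scal ops (- 1) x"]; cases x) simp_all
  qed (auto simp: closed add_ac)
  moreover have "Group.monoid ops"
    by (rule monoidI) (auto simp: closed comp_assoc)
  ultimately interpret ring ops
    by (rule ringI) (auto simp: fun_eq_iff linear_opD dest: ops_carrierD)
  show ?thesis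
  proof
    fix x y c b assume "x \<in> carrier ops"
    moreover obtain T S where x: "x = (T, S)"
      by (cases x)
    ultimately have TS: "(T, S) \<in> carrier ops"
      by simp
    note T = ops_carrierD[OF TS]
    show "0 \<le> nrm ops x"
      by (simp add: x op_norm_nonneg T)
    show "nrm ops (scal ops c x) = cmod c * nrm ops x"
      by (simp add: x op_norm_scale[OF TS])
    show "nrm ops (adj ops x \<otimes>\<^bsub>ops\<^esub> x) = (nrm ops x)\<^sup>2"
      by (simp add: x op_norm_cstar[OF TS])
    show "scal ops c x \<in> carrier ops" "adj ops x \<in> carrier ops"
      by (simp_all add: x closed TS ops_adj_closed)
    show "scal ops (b + c) x = scal ops b x \<oplus>\<^bsub>ops\<^esub> scal ops c x"
      "scal ops b (scal ops c x) = scal ops (b * c) x" "scal ops 1 x = x"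
      "adj ops (scal ops c x) = scal ops (cnj c) (adj ops x)" "adj ops (adj ops x) = x"
      by (simp_all add: x scale_left_distrib)
    assume "y \<in> carrier ops"
    moreover obtain T' S' where y: "y = (T', S')"
      by (cases y)
    ultimately have TS': "(T', S') \<in> carrier ops"
      by simp
    note T' = ops_carrierD[OF TS']
    show "nrm ops (x \<oplus>\<^bsub>ops\<^esub> y) \<le> nrm ops x + nrm ops y"
      "nrm ops (x \<otimes>\<^bsub>ops\<^esub> y) \<le> nrm ops x * nrm ops y"
      using ops_add_closed(2)[OF TS TS'] ops_mult_closed(2)[OF TS TS'] by (simp_all add: x y)
    show "scal ops c (x \<oplus>\<^bsub>ops\<^esub> y) = scal ops c x \<oplus>\<^bsub>ops\<^esub> scal ops c y"
      "adj ops (x \<oplus>\<^bsub>ops\<^esub> y) = adj ops x \<oplus>\<^bsub>ops\<^esub> adj ops y"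
      "adj ops (x \<otimes>\<^bsub>ops\<^esub> y) = adj ops y \<otimes>\<^bsub>ops\<^esub> adj ops x"
      by (simp_all add: x y scale_right_distrib)
    show "scal ops c x \<otimes>\<^bsub>ops\<^esub> y = scal ops c (x \<otimes>\<^bsub>ops\<^esub> y)"
      "x \<otimes>\<^bsub>ops\<^esub> scal ops c y = scal ops c (x \<otimes>\<^bsub>ops\<^esub> y)"
      by (simp_all add: x y fun_eq_iff linear_opD[OF T(1)] linear_opD[OF T'(2)])
  qed
qed

definition vector_functional :: "'h \<Rightarrow> ('h \<Rightarrow> 'h) \<times> ('h \<Rightarrow> 'h) \<Rightarrow> complex" where
  "vector_functional e x = ip e (fst x e)"

text \<open>For a unit vector these are the hypotheses on \<open>\<omega>\<close> in
  \<open>toeplitz_pimsner_functional\<close>. Positivity holds since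
  \<open>ip e (S (T e)) = ip (T e) (T e)\<close>.\<close>

lemma vector_functional:
  assumes e: "e \<in> H" "ip e e = 1" and x: "x \<in> carrier ops"
  shows "y \<in> carrier ops \<Longrightarrow>
      vector_functional e (x \<oplus>\<^bsub>ops\<^esub> y) = vector_functional e x + vector_functional e y"
    and "vector_functional e (scal ops c x) = c * vector_functional e x"
    and "cmod (vector_functional e x) \<le> nrm ops x"
    and "Im (vector_functional e (adj ops x \<otimes>\<^bsub>ops\<^esub> x)) = 0
      \<and> 0 \<le> Re (vector_functional e (adj ops x \<otimes>\<^bsub>ops\<^esub> x))"
proof -
  obtain T S where x_eq: "x = (T, S)"
    by (cases x)
  note T = ops_carrierD[OF x[unfolded x_eq]]
  have Te: "T e \<in> H"
    using linear_opD[OF T(1)] e by simp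
  show "vector_functional e (scal ops c x) = c * vector_functional e x"
    using e Te by (simp add: vector_functional_def x_eq ip_scale_right)
  have "snorm e = 1"
    by (simp add: snorm_def e)
  then show "cmod (vector_functional e x) \<le> nrm ops x"
    using Cauchy_Schwarz[OF e(1) Te] op_norm_bound[OF T(4) e(1)]
    by (simp add: vector_functional_def x_eq)
  have "ip e (S (T e)) = ip (T e) (T e)"
    using T(3)[OF e(1) Te] by simp
  then show "Im (vector_functional e (adj ops x \<otimes>\<^bsub>ops\<^esub> x)) = 0
      \<and> 0 \<le> Re (vector_functional e (adj ops x \<otimes>\<^bsub>ops\<^esub> x))"
    using ip_nonneg[OF Te] Im_ip_self[OF Te] by (simp add: vector_functional_def x_eq)
  assume "y \<in> carrier ops"
  moreover obtain T' S' where y_eq: "y = (T', S')"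
    by (cases y)
  ultimately have "T' e \<in> H"
    using linear_opD[OF ops_carrierD(1)] e by simp
  then show "vector_functional e (x \<oplus>\<^bsub>ops\<^esub> y) = vector_functional e x + vector_functional e y"
    using e Te by (simp add: vector_functional_def x_eq y_eq ip_add_right)
qed

end

section \<open>From a covariant pair in a pre-C*-algebra to a functional on the Toeplitz-Pimsner
  algebra\<close>

lemma pre_cstar_subalgebra:
  assumes "pre_cstar B" "S \<subseteq> carrier B" "\<zero>\<^bsub>B\<^esub> \<in> S" "\<one>\<^bsub>B\<^esub> \<in> S"
    and closed: "\<And>x y. x \<in> S \<Longrightarrow> y \<in> S \<Longrightarrow> x \<oplus>\<^bsub>B\<^esub> y \<in> S"
    "\<And>x y. x \<in> S \<Longrightarrow> y \<in> S \<Longrightarrow> x \<otimes>\<^bsub>B\<^esub> y \<in> S"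
    "\<And>c x. x \<in> S \<Longrightarrow> scal B c x \<in> S" "\<And>x. x \<in> S \<Longrightarrow> adj B x \<in> S"
  shows "pre_cstar (B\<lparr>carrier := S\<rparr>)" (is "pre_cstar ?C")
proof -
  interpret B: pre_cstar B by fact
  have S: "x \<in> carrier B" if "x \<in> S" for x
    using that assms(2) by blast
  have "abelian_group ?C"
  proof (rule abelian_groupI)
    fix x assume "x \<in> carrier ?C"
    then have x: "x \<in> S"
      by simp
    moreover have "scal B (- 1) x \<oplus>\<^bsub>B\<^esub> x = \<zero>\<^bsub>B\<^esub>"
      using S[OF x] by (simp add: B.scal_minus_one B.l_neg)
    ultimately show "\<exists>y\<in>carrier ?C. y \<oplus>\<^bsub>?C\<^esub> x = \<zero>\<^bsub>?C\<^esub>"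
      by (intro bexI[of _ "scal B (- 1) x"]) (simp_all add: closed)
  qed (simp_all add: S assms B.a_ac)
  moreover have "Group.monoid ?C"
    by (rule monoidI) (simp_all add: S assms B.m_assoc)
  ultimately interpret C: ring ?C
    by (rule ringI) (simp_all add: S B.l_distr B.r_distr)
  show ?thesis
    by unfold_locales
      (simp_all add: S closed B.pre_scal_add_right B.pre_scal_add_left B.pre_scal_scal
        B.pre_scal_one B.pre_scal_mult_left B.pre_scal_mult_right B.pre_adj_add B.pre_adj_scal
        B.pre_adj_mult B.pre_adj_adj B.pre_nrm_nonneg B.pre_nrm_triangle B.pre_nrm_scal
        B.pre_nrm_mult B.pre_nrm_cstar)
qed

lemma poly_eval_subalgebra: "poly_eval (B\<lparr>carrier := S\<rparr>) \<pi> W p = poly_eval B \<pi> W p"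
  by (induction p) simp_all

lemma poly_eval_closed:
  assumes "pre_cstar B" "covariant \<alpha> B \<pi> W"
  shows "poly_eval B \<pi> W p \<in> carrier B"
proof -
  interpret pre_cstar B by fact
  have \<pi>: "star_hom type_cstar B \<pi>" and W: "\<And>i. W i \<in> carrier B"
    using assms(2) by (simp_all add: covariant_def)
  show ?thesis
    by (induction p) (simp_all add: star_homD(1)[OF \<pi>] W pre_adj_closed)
qed

lemma star_hom_poly_eval:
  assumes "pre_cstar B" "covariant \<alpha> B \<pi> W" "star_hom B C f"
  shows "f (poly_eval B \<pi> W p) = poly_eval C (f \<circ> \<pi>) (f \<circ> W) p"
  by (induction p) (simp_all add: star_homD[OF assms(3)] poly_eval_closed[OF assms(1,2)])

text \<open>A covariant representation in a pre-\<open>C\<^sup>*\<close>-algebra generates a subalgebra in whose completion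
  its \<open>*\<close>-polynomials are dense.\<close>

lemma toeplitz_pimsner_functional:
  fixes \<alpha> :: "'d::finite \<Rightarrow> 'a::cstar_algebra \<Rightarrow> 'a"
    and \<iota> :: "'a \<Rightarrow> 'b::cstar_algebra"
  assumes tp: "toeplitz_pimsner \<alpha> \<iota> V"
    and B: "pre_cstar B" and cov: "covariant \<alpha> B \<pi> W"
    and add: "\<And>x y. x \<in> carrier B \<Longrightarrow> y \<in> carrier B \<Longrightarrow> \<omega> (x \<oplus>\<^bsub>B\<^esub> y) = \<omega> x + \<omega> y"
    and scal: "\<And>c x. x \<in> carrier B \<Longrightarrow> \<omega> (scal B c x) = c * \<omega> x"
    and bound: "\<And>x. x \<in> carrier B \<Longrightarrow> cmod (\<omega> x) \<le> nrm B x"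
    and pos: "\<And>x. x \<in> carrier B \<Longrightarrow>
      Im (\<omega> (adj B x \<otimes>\<^bsub>B\<^esub> x)) = 0 \<and> 0 \<le> Re (\<omega> (adj B x \<otimes>\<^bsub>B\<^esub> x))"
  obtains \<psi> where "positive_functional \<psi>"
    "\<And>p. \<psi> (poly_eval type_cstar \<iota> V p) = \<omega> (poly_eval B \<pi> W p)"
proof -
  interpret B: pre_cstar B by fact
  have \<pi>: "star_hom type_cstar B \<pi>" and W: "\<And>i. W i \<in> carrier B"
    using cov by (simp_all add: covariant_def)
  let ?E = "poly_eval B \<pi> W"
  let ?C = "B\<lparr>carrier := range ?E\<rparr>"
  have E_closed: "?E p \<in> carrier B" for p
    by (rule poly_eval_closed[OF B cov])
  \<comment> \<open>\<open>star_poly\<close> has no constructor for scalars; they enter as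
    coefficients c 1 from the algebra of coefficients, so the range of evaluation is a complex
    subspace.\<close>
  have scal_E: "scal B c (?E p) = ?E (Times (Coeff (c *\<^sub>C 1)) p)" for c p
  proof -
    have "\<pi> (c *\<^sub>C 1) = scal B c \<one>\<^bsub>B\<^esub>"
      using star_homD(4,5)[OF \<pi>] by simp
    then show ?thesis
      by (simp add: B.pre_scal_mult_left E_closed)
  qed
  have C: "pre_cstar ?C"
  proof (rule pre_cstar_subalgebra[OF B])
    have one: "\<one>\<^bsub>B\<^esub> = ?E (Coeff 1)"
      using star_homD(4)[OF \<pi>] by simp
    then show "\<one>\<^bsub>B\<^esub> \<in> range ?E"
      by (rule range_eqI)
    have "\<zero>\<^bsub>B\<^esub> = scal B 0 (?E (Coeff 1))"
      by (simp only: B.scal_zero E_closed)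
    then show "\<zero>\<^bsub>B\<^esub> \<in> range ?E"
      by (simp only: scal_E) (rule rangeI)
    show "x \<oplus>\<^bsub>B\<^esub> y \<in> range ?E" "x \<otimes>\<^bsub>B\<^esub> y \<in> range ?E"
      if xy: "x \<in> range ?E" "y \<in> range ?E" for x y
    proof -
      obtain p q where "x = ?E p" "y = ?E q"
        using xy by blast
      then show "x \<oplus>\<^bsub>B\<^esub> y \<in> range ?E" "x \<otimes>\<^bsub>B\<^esub> y \<in> range ?E"
        using rangeI[of ?E "Plus p q"] rangeI[of ?E "Times p q"] by simp_all
    qed
    show "scal B c x \<in> range ?E" "adj B x \<in> range ?E" if x: "x \<in> range ?E" for c x
    proof -
      obtain p where p: "x = ?E p"
        using x by blast
      show "adj B x \<in> range ?E"
        using rangeI[of ?E "Adj p"] by (simp add: p)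
      show "scal B c x \<in> range ?E"
        unfolding p scal_E by (rule rangeI)
    qed
  qed (use E_closed in blast)
  interpret C: pre_cstar ?C by (rule C)
  have "\<pi> a \<in> range ?E" "W i \<in> range ?E" for a i
    using rangeI[of ?E "Coeff a"] rangeI[of ?E "Gen i"] by simp_all
  then have covC: "covariant \<alpha> ?C \<pi> W"
    using cov by (simp add: covariant_def star_hom_def ring_hom_def Pi_iff)
  let ?D = "C.completion" and ?j = "C.embed"
  have D: "cstar_structure ?D"
    by (rule C.cstar_structure_completion)
  interpret D: cstar_structure ?D by (rule D)
  have j: "star_hom ?C ?D ?j"
    by (rule star_hom_embed[OF C])
  have covD: "covariant \<alpha> ?D (?j \<circ> \<pi>) (?j \<circ> W)"
    by (rule covariant_transfer[OF C D.pre_cstar_axioms covC j])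
  have j_E: "?j (?E p) = poly_eval ?D (?j \<circ> \<pi>) (?j \<circ> W) p" for p
    using star_hom_poly_eval[OF C covC j, of p] by (simp only: poly_eval_subalgebra)
  \<comment> \<open>The carrier of \<open>?C\<close> consists of polynomial values, so the terms of
    a Cauchy sequence are themselves polynomial approximants of its class.\<close>
  have dense: "\<exists>p. nrm ?D (x \<ominus>\<^bsub>?D\<^esub> poly_eval ?D (?j \<circ> \<pi>) (?j \<circ> W) p) < e"
    if x: "x \<in> carrier ?D" and e: "0 < e" for x e
  proof -
    obtain s where s: "C.Cauchy_seq s" "x = C.rep s"
      using x unfolding C.completion_simps(1) by blast
    obtain N where N: "nrm ?D (x \<ominus>\<^bsub>?D\<^esub> ?j (s N)) < e"
      using C.embed_dense[OF s(1) e] unfolding s(2) by blast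
    have "s N \<in> range ?E"
      using C.Cauchy_seq_closed[OF s(1), of N] by simp
    then obtain p where "s N = ?E p"
      by blast
    then show ?thesis
      using N by (intro exI[of _ p]) (simp only: j_E)
  qed
  obtain \<Phi> where \<Phi>: "star_hom type_cstar ?D \<Phi>" "\<And>a. \<Phi> (\<iota> a) = (?j \<circ> \<pi>) a"
      "\<And>i. \<Phi> (V i) = (?j \<circ> W) i"
    using toeplitz_pimsner_universal[OF tp D covD dense] by blast
  have C_closed: "x \<in> carrier ?C \<Longrightarrow> x \<in> carrier B" for x
    using E_closed by auto
  obtain \<omega>' where \<omega>':
    "\<And>x y. x \<in> carrier ?D \<Longrightarrow> y \<in> carrier ?D \<Longrightarrow> \<omega>' (x \<oplus>\<^bsub>?D\<^esub> y) = \<omega>' x + \<omega>' y"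
    "\<And>c x. x \<in> carrier ?D \<Longrightarrow> \<omega>' (scal ?D c x) = c * \<omega>' x"
    "\<And>x. x \<in> carrier ?D \<Longrightarrow> Im (\<omega>' (adj ?D x \<otimes>\<^bsub>?D\<^esub> x)) = 0 \<and> 0 \<le> Re (\<omega>' (adj ?D x \<otimes>\<^bsub>?D\<^esub> x))"
    "\<And>a. a \<in> carrier ?C \<Longrightarrow> \<omega>' (?j a) = \<omega> a"
    by (rule C.functional_extension[of \<omega>]) (use C_closed add scal bound pos in auto)
  have \<Phi>_closed: "\<Phi> x \<in> carrier ?D" for x
    using star_homD(1)[OF \<Phi>(1), of x] by simp
  have \<Phi>_hom: "\<Phi> (x + y) = \<Phi> x \<oplus>\<^bsub>?D\<^esub> \<Phi> y" "\<Phi> (x * y) = \<Phi> x \<otimes>\<^bsub>?D\<^esub> \<Phi> y"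
    "\<Phi> (star x) = adj ?D (\<Phi> x)" "\<Phi> (c *\<^sub>C x) = scal ?D c (\<Phi> x)" for x y c
    using star_homD[OF \<Phi>(1)] by simp_all
  show thesis
  proof
    show "positive_functional (\<lambda>x. \<omega>' (\<Phi> x))"
      unfolding positive_functional_def linear_functional_iff
      using \<omega>' \<Phi>_closed by (simp add: \<Phi>_hom)
    fix p
    have "\<Phi> (poly_eval type_cstar \<iota> V p) = poly_eval ?D (?j \<circ> \<pi>) (?j \<circ> W) p"
      by (induction p) (simp_all add: \<Phi> \<Phi>_hom)
    also have "\<dots> = ?j (?E p)"
      by (simp only: j_E)
    finally show "\<omega>' (\<Phi> (poly_eval type_cstar \<iota> V p)) = \<omega> (?E p)"
      by (simp add: \<omega>'(4))
  qed
qed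

section \<open>Fock representation\<close>

definition scale_fun :: "complex \<Rightarrow> ('i \<Rightarrow> 'a) \<Rightarrow> 'i \<Rightarrow> 'a::cstar_algebra" where
  "scale_fun c f = (\<lambda>i. c *\<^sub>C f i)"

definition finite_support :: "('i \<Rightarrow> 'a::zero) set" where
  "finite_support = {f. finite {i. f i \<noteq> 0}}"

locale fock =
  fixes \<alpha> :: "'d::finite \<Rightarrow> 'a::cstar_algebra \<Rightarrow> 'a" and \<tau> :: "'a \<Rightarrow> complex"
  assumes endo: "\<And>i. star_homo (\<alpha> i)"
    and pos: "positive_functional \<tau>"
begin

lemmas tau = linear_functionalD[OF positive_functionalD(1)[OF pos]]

text \<open>The first letter acts first. The order comes from a V_i = V_i alpha_i(a): moved to the
  right through V_mu, the coefficient meets the leftmost letter first.\<close>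

primrec endo_word :: "'d list \<Rightarrow> 'a \<Rightarrow> 'a" where
  "endo_word [] a = a"
| "endo_word (i # \<mu>) a = endo_word \<mu> (\<alpha> i a)"

lemma star_homo_endo_word: "star_homo (endo_word \<mu>)"
  by (induction \<mu>) (simp_all add: star_homo_def star_homoD[OF endo])

lemmas endo_word_hom = star_homoD[OF star_homo_endo_word]

text \<open>The sum has to run over a finite set; the support of the first argument is taken, and
  \<open>ip_eq_sum\<close> restores the symmetry.\<close>

definition ip :: "('d list \<Rightarrow> 'a) \<Rightarrow> ('d list \<Rightarrow> 'a) \<Rightarrow> complex" where
  "ip f g = (\<Sum>\<mu> | f \<mu> \<noteq> 0. \<tau> (star (f \<mu>) * g \<mu>))"

text \<open>Terms vanish outside the support of either argument. So the sum can be moved to a union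
  of supports, for Hermitian symmetry, or to a shifted support, for the adjoint of
  \<open>create\<close>.\<close>

lemma ip_eq_sum:
  assumes f: "f \<in> finite_support" and A: "finite A"
    and sub: "{\<mu>. f \<mu> \<noteq> 0} \<subseteq> A \<or> {\<mu>. g \<mu> \<noteq> 0} \<subseteq> A"
  shows "ip f g = (\<Sum>\<mu>\<in>A. \<tau> (star (f \<mu>) * g \<mu>))"
proof -
  let ?h = "\<lambda>\<mu>. \<tau> (star (f \<mu>) * g \<mu>)"
  have "ip f g = sum ?h ({\<mu>. f \<mu> \<noteq> 0} \<inter> A)"
    unfolding ip_def using f sub
    by (intro sum.mono_neutral_right) (auto simp: finite_support_def tau)
  also have "\<dots> = sum ?h A"
    using A by (intro sum.mono_neutral_left) (auto simp: tau)
  finally show ?thesis .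
qed

sublocale F: semi_inner_space scale_fun finite_support ip
proof -
  have vs: "vector_space (scale_fun :: complex \<Rightarrow> ('d list \<Rightarrow> 'a) \<Rightarrow> 'd list \<Rightarrow> 'a)"
    by unfold_locales
      (simp_all add: scale_fun_def fun_eq_iff scaleC_add_right scaleC_add_left scaleC_scaleC scaleC_one)
  interpret vector_space "scale_fun :: complex \<Rightarrow> ('d list \<Rightarrow> 'a) \<Rightarrow> 'd list \<Rightarrow> 'a"
    by (rule vs)
  show "semi_inner_space (scale_fun :: complex \<Rightarrow> ('d list \<Rightarrow> 'a) \<Rightarrow> 'd list \<Rightarrow> 'a) finite_support ip"
  proof
    show "subspace (finite_support :: ('d list \<Rightarrow> 'a) set)"
    proof (rule subspaceI)
      fix f g :: "'d list \<Rightarrow> 'a" and c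
      assume f: "f \<in> finite_support"
      have "{\<mu>. scale_fun c f \<mu> \<noteq> 0} \<subseteq> {\<mu>. f \<mu> \<noteq> 0}"
        by (auto simp: scale_fun_def)
      then show "scale_fun c f \<in> finite_support"
        using f finite_subset by (auto simp: finite_support_def)
      assume g: "g \<in> finite_support"
      have "{\<mu>. (f + g) \<mu> \<noteq> 0} \<subseteq> {\<mu>. f \<mu> \<noteq> 0} \<union> {\<mu>. g \<mu> \<noteq> 0}"
        by auto
      then show "f + g \<in> finite_support"
        using f g finite_subset[of "{\<mu>. (f + g) \<mu> \<noteq> 0}"] by (simp add: finite_support_def)
    qed (simp add: finite_support_def)
  next
    fix f g h :: "'d list \<Rightarrow> 'a" and c
    show "ip f (g + h) = ip f g + ip f h"
      by (simp add: ip_def distrib_left tau sum.distrib)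
    show "ip f (scale_fun c g) = c * ip f g"
      by (simp add: ip_def scale_fun_def mult_scaleC_right tau sum_distrib_left)
    show "0 \<le> Re (ip f f)"
      unfolding ip_def Re_sum by (intro sum_nonneg positive_functionalD[OF pos])
    assume f: "f \<in> finite_support" and g: "g \<in> finite_support"
    let ?A = "{\<mu>. f \<mu> \<noteq> 0} \<union> {\<mu>. g \<mu> \<noteq> 0}"
    have A: "finite ?A"
      using f g by (simp add: finite_support_def)
    have "\<tau> (star (g \<mu>) * f \<mu>) = cnj (\<tau> (star (f \<mu>) * g \<mu>))" for \<mu>
      using positive_functional_star[OF pos, of "star (f \<mu>) * g \<mu>"]
      by (simp add: star_mult star_star)
    then show "ip g f = cnj (ip f g)"
      using ip_eq_sum[OF f A, of g] ip_eq_sum[OF g A, of f] by simp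
  qed
qed

definition diag :: "'a \<Rightarrow> ('d list \<Rightarrow> 'a) \<Rightarrow> 'd list \<Rightarrow> 'a" where
  "diag a f = (\<lambda>\<mu>. endo_word \<mu> a * f \<mu>)"

definition create :: "'d \<Rightarrow> ('d list \<Rightarrow> 'a) \<Rightarrow> 'd list \<Rightarrow> 'a" where
  "create i f = (\<lambda>\<mu>. case \<mu> of [] \<Rightarrow> 0 | j # \<nu> \<Rightarrow> if j = i then f \<nu> else 0)"

definition annihilate :: "'d \<Rightarrow> ('d list \<Rightarrow> 'a) \<Rightarrow> 'd list \<Rightarrow> 'a" where
  "annihilate i f = (\<lambda>\<mu>. f (i # \<mu>))"

lemma linear_op_diag: "F.linear_op (diag a)"
proof -
  have "diag a f \<in> finite_support" if "f \<in> finite_support" for f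
  proof -
    have "{\<mu>. diag a f \<mu> \<noteq> 0} \<subseteq> {\<mu>. f \<mu> \<noteq> 0}"
      by (auto simp: diag_def)
    then show ?thesis
      using that finite_subset by (auto simp: finite_support_def)
  qed
  then show ?thesis
    by (simp add: F.linear_op_def fun_eq_iff diag_def scale_fun_def distrib_left mult_scaleC_right)
qed

lemma create_support: "{\<mu>. create i f \<mu> \<noteq> 0} \<subseteq> (#) i ` {\<mu>. f \<mu> \<noteq> 0}"
proof
  fix \<mu> assume \<mu>: "\<mu> \<in> {\<mu>. create i f \<mu> \<noteq> 0}"
  then show "\<mu> \<in> (#) i ` {\<mu>. f \<mu> \<noteq> 0}"
    by (cases \<mu>) (auto simp: create_def split: if_splits)
qed

lemma linear_op_create: "F.linear_op (create i)"
proof -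
  have "create i f \<in> finite_support" if "f \<in> finite_support" for f
    using that finite_subset[OF create_support] by (auto simp: finite_support_def)
  then show ?thesis
    by (auto simp: F.linear_op_def fun_eq_iff create_def scale_fun_def split: list.splits)
qed

lemma linear_op_annihilate: "F.linear_op (annihilate i)"
proof -
  have "annihilate i f \<in> finite_support" if "f \<in> finite_support" for f
  proof -
    have "finite ((#) i -` {\<mu>. f \<mu> \<noteq> 0})"
      using that by (intro finite_vimageI) (simp_all add: finite_support_def)
    then show ?thesis
      by (simp add: finite_support_def annihilate_def vimage_def)
  qed
  then show ?thesis
    by (simp add: F.linear_op_def fun_eq_iff annihilate_def scale_fun_def)
qed

text \<open>At \<open>\<mu>\<close> the operator multiplies by \<open>endo_word \<mu> a\<close>, of
  norm at most norm a since star-homomorphisms contract;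
  \<open>positive_functional_mult_bound\<close> then bounds each summand separately.\<close>

lemma bounded_op_diag: "F.bounded_op (diag a)"
  unfolding F.bounded_op_def
proof (intro exI[of _ "norm a"] conjI ballI)
  fix f :: "'d list \<Rightarrow> 'a" assume f: "f \<in> finite_support"
  have df: "diag a f \<in> finite_support"
    by (rule F.linear_opD(3)[OF linear_op_diag f])
  have "ip (diag a f) (diag a f) = (\<Sum>\<mu> | f \<mu> \<noteq> 0. \<tau> (star (diag a f \<mu>) * diag a f \<mu>))"
    using f by (intro ip_eq_sum df) (auto simp: finite_support_def diag_def)
  then have "Re (ip (diag a f) (diag a f)) = (\<Sum>\<mu> | f \<mu> \<noteq> 0. Re (\<tau> (star (diag a f \<mu>) * diag a f \<mu>)))"
    by simp
  also have "\<dots> \<le> (\<Sum>\<mu> | f \<mu> \<noteq> 0. (norm a)\<^sup>2 * Re (\<tau> (star (f \<mu>) * f \<mu>)))"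
  proof (rule sum_mono)
    fix \<mu>
    have "Re (\<tau> (star (diag a f \<mu>) * diag a f \<mu>))
        \<le> (norm (endo_word \<mu> a))\<^sup>2 * Re (\<tau> (star (f \<mu>) * f \<mu>))"
      unfolding diag_def by (rule positive_functional_mult_bound[OF pos])
    also have "\<dots> \<le> (norm a)\<^sup>2 * Re (\<tau> (star (f \<mu>) * f \<mu>))"
      by (intro mult_right_mono power_mono star_homo_norm_le star_homo_endo_word
          positive_functionalD[OF pos] norm_ge_zero)
    finally show "Re (\<tau> (star (diag a f \<mu>) * diag a f \<mu>)) \<le> (norm a)\<^sup>2 * Re (\<tau> (star (f \<mu>) * f \<mu>))" .
  qed
  also have "\<dots> = (norm a)\<^sup>2 * Re (ip f f)"
    by (simp add: ip_def sum_distrib_left)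
  finally have "(F.snorm (diag a f))\<^sup>2 \<le> (norm a * F.snorm f)\<^sup>2"
    by (simp add: F.snorm_power2 df f power_mult_distrib)
  then show "F.snorm (diag a f) \<le> norm a * F.snorm f"
    by (rule power2_le_imp_le) (simp add: F.snorm_nonneg f)
qed simp

lemma ip_diag: "f \<in> finite_support \<Longrightarrow> ip (diag a f) g = ip f (diag (star a) g)"
proof -
  assume f: "f \<in> finite_support"
  have "ip (diag a f) g = (\<Sum>\<mu> | f \<mu> \<noteq> 0. \<tau> (star (diag a f \<mu>) * g \<mu>))"
    using f by (intro ip_eq_sum F.linear_opD(3)[OF linear_op_diag])
      (auto simp: finite_support_def diag_def)
  then show ?thesis
    by (simp add: ip_def diag_def star_mult endo_word_hom mult.assoc)
qed

text \<open>The support of \<open>create i f\<close> lies in the image of that of \<open>f\<close>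
  under prepending \<open>i\<close>; reindexing along this injection moves the letter into the
  argument of \<open>g\<close>.\<close>

lemma ip_create: "f \<in> finite_support \<Longrightarrow> ip (create i f) g = ip f (annihilate i g)"
proof -
  assume f: "f \<in> finite_support"
  have "ip (create i f) g = (\<Sum>\<mu> \<in> (#) i ` {\<mu>. f \<mu> \<noteq> 0}. \<tau> (star (create i f \<mu>) * g \<mu>))"
    using f create_support
    by (intro ip_eq_sum F.linear_opD(3)[OF linear_op_create]) (auto simp: finite_support_def)
  also have "\<dots> = ip f (annihilate i g)"
    by (subst sum.reindex) (auto simp: ip_def create_def annihilate_def inj_on_def)
  finally show ?thesis .
qed

lemma annihilate_create: "annihilate i (create j f) = (if i = j then f else 0)"
  by (auto simp: annihilate_def create_def fun_eq_iff)

lemma diag_closed: "(diag a, diag (star a)) \<in> carrier F.ops"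
  by (simp add: F.ops_carrier linear_op_diag bounded_op_diag ip_diag)

lemma create_closed: "(create i, annihilate i) \<in> carrier F.ops"
proof -
  have "F.snorm (create i f) = F.snorm f" if "f \<in> finite_support" for f
    using that by (simp add: F.snorm_def ip_create annihilate_create)
  then have "F.bounded_op (create i)"
    unfolding F.bounded_op_def by (intro exI[of _ 1]) simp
  then show ?thesis
    by (simp add: F.ops_carrier linear_op_create linear_op_annihilate ip_create)
qed

text \<open>Elements of \<open>ops\<close> are pairs, so each relation is also checked for the
  adjoint components, in reversed order; hence the identity between \<open>annihilate\<close> and
  \<open>diag (star a)\<close>.\<close>

lemma covariant_fock:
  "covariant \<alpha> F.ops (\<lambda>a. (diag a, diag (star a))) (\<lambda>i. (create i, annihilate i))"
proof -
  have hom: "diag (x * y) = diag x \<circ> diag y" "diag (x + y) = (\<lambda>f. diag x f + diag y f)"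
    "diag (c *\<^sub>C x) = (\<lambda>f. scale_fun c (diag x f))" "diag 1 = id" for x y c
    by (simp_all add: fun_eq_iff diag_def endo_word_hom mult.assoc distrib_right scale_fun_def
        mult_scaleC_left)
  have "diag a \<circ> create i = create i \<circ> diag (\<alpha> i a)" for a i
    by (auto simp: fun_eq_iff diag_def create_def split: list.splits)
  moreover have "annihilate i \<circ> diag (star a) = diag (star (\<alpha> i a)) \<circ> annihilate i" for a i
    by (simp add: fun_eq_iff diag_def annihilate_def star_homoD[OF endo])
  moreover have "annihilate i \<circ> create j = (if i = j then id else (\<lambda>_. 0))" for i j
    by (auto simp: annihilate_create fun_eq_iff)
  ultimately show ?thesis
    by (auto simp: covariant_def star_hom_def ring_hom_def diag_closed create_closed hom star_mult
        star_add star_scaleC star_star)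
qed

definition vacuum :: "'d list \<Rightarrow> 'a" where
  "vacuum = (\<lambda>\<mu>. if \<mu> = [] then 1 else 0)"

lemma vacuum_support: "{\<mu>. vacuum \<mu> \<noteq> 0} = {[]}"
  by (auto simp: vacuum_def)

lemma vacuum: "vacuum \<in> finite_support" "ip vacuum f = \<tau> (f [])"
  by (simp_all add: finite_support_def vacuum_support ip_def) (simp add: vacuum_def)

end

text \<open>A polynomial with value \<open>V_word V \<mu>\<close>: the functional supplied by the
  universal property is given explicitly on polynomial values only.\<close>

primrec word_poly :: "'d list \<Rightarrow> ('a::cstar_algebra, 'd) star_poly" where
  "word_poly [] = Coeff 1"
| "word_poly (i # \<mu>) = Times (Gen i) (word_poly \<mu>)"

text \<open>The vector functional at the vacuum reads off the coordinate at \<open>[]\<close>. A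
  nonempty \<open>\<mu>\<close> creates nothing there, the adjoint of a nonempty
  \<open>\<nu>\<close> kills the vacuum, and for two empty words \<open>diag a\<close> leaves a
  there.\<close>

lemma toeplitz_pimsner_vacuum_state:
  fixes \<alpha> :: "'d::finite \<Rightarrow> 'a::cstar_algebra \<Rightarrow> 'a"
    and \<iota> :: "'a \<Rightarrow> 'b::cstar_algebra"
  assumes tp: "toeplitz_pimsner \<alpha> \<iota> V" and endo: "\<And>i. star_homo (\<alpha> i)" and \<tau>: "\<tau> \<in> states"
  obtains \<psi> where "\<psi> \<in> states"
    "\<And>\<mu> a \<nu>. \<psi> (monom_elt \<iota> V \<mu> a \<nu>) = (if \<mu> = [] \<and> \<nu> = [] then \<tau> a else 0)"
proof -
  interpret fock \<alpha> \<tau>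
    using endo \<tau> by unfold_locales (simp_all add: states_iff)
  have one: "\<tau> 1 = 1"
    using \<tau> by (simp add: states_iff)
  let ?\<pi> = "\<lambda>a. (diag a, diag (star a))" and ?W = "\<lambda>i. (create i, annihilate i)"
  let ?E = "poly_eval F.ops ?\<pi> ?W" and ?G = "poly_eval type_cstar \<iota> V"
  let ?\<omega> = "F.vector_functional vacuum"
  have unit: "vacuum \<in> finite_support" "ip vacuum vacuum = 1"
    by (simp_all add: vacuum) (simp add: vacuum_def one)
  note \<omega> = F.vector_functional[OF unit]
  obtain \<psi> where \<psi>: "positive_functional \<psi>" "\<And>p. \<psi> (?G p) = ?\<omega> (?E p)"
    by (rule toeplitz_pimsner_functional[OF tp F.pre_cstar_ops covariant_fock, of ?\<omega>])
      (use \<omega> in auto)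
  have iota: "star_homo \<iota>"
    using tp by (simp add: toeplitz_pimsner_def covariant_def star_hom_type_cstar)
  have word: "?G (word_poly \<mu>) = V_word V \<mu>" for \<mu>
    by (induction \<mu>) (simp_all add: V_word_def star_homoD[OF iota])
  have closed: "?E p \<in> carrier F.ops" for p
    by (rule poly_eval_closed[OF F.pre_cstar_ops covariant_fock])
  have diag_one: "diag 1 = id"
    by (simp add: fun_eq_iff diag_def endo_word_hom)
  have E_Cons: "fst (?E (word_poly (i # \<mu>))) = create i \<circ> fst (?E (word_poly \<mu>))"
    "snd (?E (word_poly (i # \<mu>))) = snd (?E (word_poly \<mu>)) \<circ> annihilate i" for i \<mu>
    by (simp_all add: case_prod_beta F.ops_def)
  \<comment> \<open>In the adjoint component the first letter of \<open>\<nu>\<close> is annihilated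
    first, and the vacuum has no nonempty word in its support.\<close>
  have snd_word: "snd (?E (word_poly \<nu>)) vacuum = 0" if nonempty: "\<nu> \<noteq> []" for \<nu>
  proof -
    obtain i \<kappa> where \<nu>: "\<nu> = i # \<kappa>"
      using nonempty by (cases \<nu>) auto
    have "F.linear_op (snd (?E (word_poly \<kappa>)))"
      using closed[of "word_poly \<kappa>"] by (cases "?E (word_poly \<kappa>)") (auto dest: F.ops_carrierD)
    moreover have "annihilate i vacuum = 0"
      by (simp add: fun_eq_iff annihilate_def vacuum_def)
    ultimately show ?thesis
      unfolding \<nu> E_Cons by (simp add: F.linear_opD(4) flip: zero_fun_def)
  qed
  have fst_word: "fst (?E (word_poly \<mu>)) f [] = 0" if "\<mu> \<noteq> []" for \<mu> f
    using that by (cases \<mu>) (simp_all add: E_Cons create_def del: word_poly.simps)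
  have monom: "\<psi> (monom_elt \<iota> V \<mu> a \<nu>) = (if \<mu> = [] \<and> \<nu> = [] then \<tau> a else 0)" for \<mu> a \<nu>
  proof -
    let ?p = "Times (Times (word_poly \<mu>) (Coeff a)) (Adj (word_poly \<nu>))"
    have "\<psi> (monom_elt \<iota> V \<mu> a \<nu>) = ?\<omega> (?E ?p)"
      using \<psi>(2)[of ?p] by (simp add: word monom_elt_def)
    also have "\<dots> = \<tau> (fst (?E (word_poly \<mu>)) (diag a (snd (?E (word_poly \<nu>)) vacuum)) [])"
      by (simp add: F.vector_functional_def vacuum case_prod_beta F.ops_def)
    also have "\<dots> = (if \<mu> = [] \<and> \<nu> = [] then \<tau> a else 0)"
    proof (cases "\<mu> = []")
      case False
      then show ?thesis
        by (simp add: fst_word tau)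
    next
      case True
      then show ?thesis
        using snd_word[of \<nu>] by (cases "\<nu> = []") (simp_all add: diag_one diag_def vacuum_def tau)
    qed
    finally show ?thesis .
  qed
  have "\<psi> 1 = 1"
    using monom[of "[]" 1 "[]"] by (simp add: monom_elt_def V_word_def star_homoD[OF iota] one)
  then have "\<psi> \<in> states"
    using \<psi>(1) by (simp add: states_iff)
  then show thesis
    using monom by (rule that)
qed

section \<open>Dense subspaces and the gauge action\<close>

lemma closure_sequentialI:
  fixes l :: "'a::metric_space"
  shows "(\<And>n. f n \<in> S) \<Longrightarrow> f \<longlonglongrightarrow> l \<Longrightarrow> l \<in> closure S"
  unfolding closure_sequential by blast

lemma subspace_closure:
  fixes S :: "'b::cstar_algebra set"
  assumes "cstar.subspace S"
  shows "cstar.subspace (closure S)"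
proof (rule cstar.subspaceI)
  show "0 \<in> closure S"
    using assms closure_subset cstar.subspace_0 by blast
  fix x y assume "x \<in> closure S" "y \<in> closure S"
  then obtain f g where "\<And>n. f n \<in> S" "f \<longlonglongrightarrow> x" "\<And>n. g n \<in> S" "g \<longlonglongrightarrow> y"
    unfolding closure_sequential by blast
  then show "x + y \<in> closure S"
    by (intro closure_sequentialI[of "\<lambda>n. f n + g n"])
      (simp_all add: tendsto_add cstar.subspace_add[OF assms])
next
  fix c and x assume "x \<in> closure S"
  then obtain f where "\<And>n. f n \<in> S" "f \<longlonglongrightarrow> x"
    unfolding closure_sequential by blast
  then show "c *\<^sub>C x \<in> closure S"
    by (intro closure_sequentialI[of "\<lambda>n. c *\<^sub>C f n"])
      (simp_all add: scaleC.tendsto cstar.subspace_scale[OF assms])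
qed

text \<open>The elements that, together with their adjoints, multiply \<open>M\<close> into itself
  from the left form a closed star-subalgebra, hence everything; apply them to 1. So only products
  of a generator with an element of \<open>M\<close> have to be computed.\<close>

lemma generates_left_invariant:
  fixes M :: "'b::cstar_algebra set"
  assumes G: "generates G" and M: "closed M" "cstar.subspace M" "1 \<in> M"
    and inv: "\<And>g y. g \<in> G \<Longrightarrow> y \<in> M \<Longrightarrow> g * y \<in> M" "\<And>g y. g \<in> G \<Longrightarrow> y \<in> M \<Longrightarrow> star g * y \<in> M"
  shows "M = UNIV"
proof -
  define T where "T = {x. \<forall>y\<in>M. x * y \<in> M \<and> star x * y \<in> M}"
  have "T = (\<Inter>y\<in>M. (\<lambda>x. x * y) -` M \<inter> (\<lambda>x. star x * y) -` M)"
    by (auto simp: T_def)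
  moreover have "closed \<dots>"
    by (intro closed_INT ballI closed_Int continuous_closed_vimage M
        linear_continuous_at bounded_linear_compose[OF bounded_linear_mult_left bounded_linear_star]
        bounded_linear_mult_left)
  ultimately have "closed T"
    by simp
  moreover have "cstar.subspace T"
    using M(2) by (auto simp: T_def cstar.subspace_def distrib_right star_add mult_scaleC_left
        star_scaleC)
  moreover have "x * y \<in> T" "star x \<in> T" if "x \<in> T" "y \<in> T" for x y
    using that by (auto simp: T_def star_mult mult.assoc star_star)
  moreover have "G \<subseteq> T"
    using inv by (auto simp: T_def)
  ultimately have "T = UNIV"
    using G by (simp add: generates_def)
  then have "x \<in> T" for x
    by simp
  then have "x * 1 \<in> M" for x
    using M(3) unfolding T_def by blast
  then show ?thesis
    by auto
qed

text \<open>The equaliser is a star-subalgebra, and closed because star-homomorphisms are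
  automatically continuous.\<close>

lemma star_homo_eqI:
  assumes G: "generates G" and f: "star_homo f" and g: "star_homo g"
    and eq: "\<And>x. x \<in> G \<Longrightarrow> f x = g x"
  shows "f = g"
proof -
  have "{x. f x = g x} = UNIV"
  proof (rule G[unfolded generates_def, rule_format], intro conjI ballI)
    show "closed {x. f x = g x}"
      by (intro closed_Collect_eq linear_continuous_on star_homo_bounded_linear f g)
    show "cstar.subspace {x. f x = g x}"
      by (simp add: cstar.subspace_def star_homoD[OF f] star_homoD[OF g])
  qed (use eq in \<open>auto simp: star_homoD[OF f] star_homoD[OF g]\<close>)
  then show ?thesis
    by auto
qed

section \<open>Density of the monomials, gauge automorphisms\<close>

locale toeplitz_system =
  fixes \<alpha> :: "'d::finite \<Rightarrow> 'a::cstar_algebra \<Rightarrow> 'a"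
    and \<iota> :: "'a \<Rightarrow> 'b::cstar_algebra"
    and V :: "'d \<Rightarrow> 'b"
  assumes dyn: "dynamical_system \<alpha>"
    and tp: "toeplitz_pimsner \<alpha> \<iota> V"
begin

lemma endo: "star_homo (\<alpha> i)"
  using dyn by (simp add: dynamical_system_def star_hom_type_cstar)

lemma iota: "star_homo \<iota>"
  using tp by (simp add: toeplitz_pimsner_def covariant_def star_hom_type_cstar)

lemma star_V_mult_V: "star (V i) * V j = (if i = j then 1 else 0)"
  using tp by (simp add: toeplitz_pimsner_def covariant_def)

lemma iota_mult_V: "\<iota> a * V i = V i * \<iota> (\<alpha> i a)"
  using tp by (simp add: toeplitz_pimsner_def covariant_def)

lemma star_V_mult_iota: "star (V i) * \<iota> a = \<iota> (\<alpha> i a) * star (V i)"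
proof -
  have "star (\<iota> (star a) * V i) = star (V i * \<iota> (\<alpha> i (star a)))"
    by (simp add: iota_mult_V)
  then show ?thesis
    by (simp add: star_mult star_star star_homoD[OF iota] star_homoD[OF endo])
qed

lemma generates_iota_V: "generates (range \<iota> \<union> range V)"
  using tp by (simp add: toeplitz_pimsner_def)

lemma V_word_simps [simp]: "V_word V [] = 1" "V_word V (i # \<mu>) = V i * V_word V \<mu>"
  by (simp_all add: V_word_def)

lemma V_word_snoc: "V_word V (\<mu> @ [i]) = V_word V \<mu> * V i"
  by (simp add: V_word_def)

lemma iota_mult_V_word: "\<exists>b. \<iota> a * V_word V \<mu> = V_word V \<mu> * \<iota> b"
proof (induction \<mu> arbitrary: a)
  case (Cons i \<mu>)
  obtain b where "\<iota> (\<alpha> i a) * V_word V \<mu> = V_word V \<mu> * \<iota> b"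
    using Cons by blast
  then have "\<iota> a * V_word V (i # \<mu>) = V_word V (i # \<mu>) * \<iota> b"
    by (simp add: iota_mult_V mult.assoc flip: mult.assoc[of "\<iota> a"])
  then show ?case
    by blast
qed auto

lemma monom_elt_in_span: "monom_elt \<iota> V \<mu> a \<nu> \<in> monom_span \<iota> V"
  unfolding monom_span_def by (rule cstar.span_base) blast

lemma subspace_monom_span: "cstar.subspace (monom_span \<iota> V)"
  by (simp add: monom_span_def cstar.subspace_span)

lemma monom_span_induct [consumes 1, case_names zero add scale monom]:
  assumes "x \<in> monom_span \<iota> V" "P 0" "\<And>x y. P x \<Longrightarrow> P y \<Longrightarrow> P (x + y)"
    "\<And>c x. P x \<Longrightarrow> P (c *\<^sub>C x)" "\<And>\<mu> a \<nu>. P (monom_elt \<iota> V \<mu> a \<nu>)"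
  shows "P x"
proof -
  have "cstar.subspace (Collect P)"
    using assms(2-4) by (simp add: cstar.subspace_def)
  then have "monom_span \<iota> V \<subseteq> Collect P"
    unfolding monom_span_def using assms(5) by (intro cstar.span_minimal) auto
  then show ?thesis
    using assms(1) by blast
qed

lemma monom_span_left_invariant:
  assumes "\<And>\<mu> a \<nu>. g * monom_elt \<iota> V \<mu> a \<nu> \<in> monom_span \<iota> V" "y \<in> monom_span \<iota> V"
  shows "g * y \<in> monom_span \<iota> V"
  using assms(2)
  by (induction rule: monom_span_induct)
    (simp_all add: assms(1) distrib_left mult_scaleC_right cstar.subspace_0 cstar.subspace_add
      cstar.subspace_scale subspace_monom_span)

lemma iota_mult_monom_span:
  assumes "y \<in> monom_span \<iota> V"
  shows "\<iota> a * y \<in> monom_span \<iota> V"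
proof (rule monom_span_left_invariant[OF _ assms])
  fix \<mu> b \<nu>
  obtain c where c: "\<iota> a * V_word V \<mu> = V_word V \<mu> * \<iota> c"
    using iota_mult_V_word by blast
  have "\<iota> a * monom_elt \<iota> V \<mu> b \<nu> = (\<iota> a * V_word V \<mu>) * (\<iota> b * star (V_word V \<nu>))"
    by (simp add: monom_elt_def mult.assoc)
  also have "\<dots> = monom_elt \<iota> V \<mu> (c * b) \<nu>"
    by (simp add: c monom_elt_def mult.assoc star_homoD[OF iota])
  finally show "\<iota> a * monom_elt \<iota> V \<mu> b \<nu> \<in> monom_span \<iota> V"
    by (simp add: monom_elt_in_span)
qed

lemma V_mult_monom_span:
  assumes "y \<in> monom_span \<iota> V"
  shows "V i * y \<in> monom_span \<iota> V"
proof (rule monom_span_left_invariant[OF _ assms])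
  fix \<mu> b \<nu>
  have "V i * monom_elt \<iota> V \<mu> b \<nu> = monom_elt \<iota> V (i # \<mu>) b \<nu>"
    by (simp add: monom_elt_def mult.assoc)
  then show "V i * monom_elt \<iota> V \<mu> b \<nu> \<in> monom_span \<iota> V"
    by (simp add: monom_elt_in_span)
qed

text \<open>Either \<open>star (V i)\<close> meets a letter and cancels to 0 or 1, or
  \<open>\<mu>\<close> is empty and it slides past the coefficient into the adjoint of
  \<open>V_word V \<nu>\<close>. There its letter joins \<open>\<nu>\<close> at the end, since
  adjoints reverse products.\<close>

lemma star_V_mult_monom_span:
  assumes "y \<in> monom_span \<iota> V"
  shows "star (V i) * y \<in> monom_span \<iota> V"
proof (rule monom_span_left_invariant[OF _ assms])
  fix \<mu> b \<nu>
  show "star (V i) * monom_elt \<iota> V \<mu> b \<nu> \<in> monom_span \<iota> V"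
  proof (cases \<mu>)
    case Nil
    have "star (V i) * monom_elt \<iota> V \<mu> b \<nu> = \<iota> (\<alpha> i b) * (star (V i) * star (V_word V \<nu>))"
      by (simp add: Nil monom_elt_def star_V_mult_iota mult.assoc flip: mult.assoc[of "star (V i)"])
    also have "\<dots> = monom_elt \<iota> V [] (\<alpha> i b) (\<nu> @ [i])"
      by (simp add: monom_elt_def V_word_snoc star_mult)
    finally show ?thesis
      by (simp add: monom_elt_in_span)
  next
    case (Cons j \<mu>')
    have "star (V i) * monom_elt \<iota> V \<mu> b \<nu> = (star (V i) * V j) * monom_elt \<iota> V \<mu>' b \<nu>"
      by (simp add: Cons monom_elt_def mult.assoc)
    then show ?thesis
      by (simp add: star_V_mult_V monom_elt_in_span cstar.subspace_0 subspace_monom_span)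
  qed
qed

lemma one_in_monom_span: "1 \<in> monom_span \<iota> V"
  using monom_elt_in_span[of "[]" 1 "[]"] by (simp add: monom_elt_def star_homoD[OF iota])

lemma closure_monom_span: "closure (monom_span \<iota> V) = UNIV"
proof (rule generates_left_invariant[OF generates_iota_V])
  show "cstar.subspace (closure (monom_span \<iota> V))"
    by (intro subspace_closure subspace_monom_span)
  show "1 \<in> closure (monom_span \<iota> V)"
    using one_in_monom_span closure_subset by blast
  have left: "g * y \<in> closure (monom_span \<iota> V)"
    if "\<And>x. x \<in> monom_span \<iota> V \<Longrightarrow> g * x \<in> monom_span \<iota> V" "y \<in> closure (monom_span \<iota> V)" for g y
  proof -
    have "(\<lambda>y. g * y) ` closure (monom_span \<iota> V) \<subseteq> closure (monom_span \<iota> V)"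
      using that(1) closure_subset by (intro image_closure_subset continuous_intros) blast+
    then show ?thesis
      using that(2) by blast
  qed
  fix g y assume g: "g \<in> range \<iota> \<union> range V" and y: "y \<in> closure (monom_span \<iota> V)"
  show "g * y \<in> closure (monom_span \<iota> V)"
    using g by (auto intro!: left[OF _ y] iota_mult_monom_span V_mult_monom_span)
  show "star g * y \<in> closure (monom_span \<iota> V)"
    using g
    by (auto simp flip: star_homoD(4)[OF iota]
        intro!: left[OF _ y] iota_mult_monom_span star_V_mult_monom_span)
qed simp

lemma continuous_eq_on_monoms:
  assumes "continuous_on UNIV \<psi>" "linear_functional \<psi>" "continuous_on UNIV \<phi>" "linear_functional \<phi>"
    and eq: "\<And>\<mu> a \<nu>. \<psi> (monom_elt \<iota> V \<mu> a \<nu>) = \<phi> (monom_elt \<iota> V \<mu> a \<nu>)"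
  shows "\<psi> = \<phi>"
proof -
  have "\<psi> x = \<phi> x" if "x \<in> monom_span \<iota> V" for x
    using that
    by (induction rule: monom_span_induct)
      (simp_all add: eq linear_functionalD[OF assms(2)] linear_functionalD[OF assms(4)])
  then have "closure (monom_span \<iota> V) \<subseteq> {x. \<psi> x = \<phi> x}"
    by (intro closure_minimal closed_Collect_eq assms) auto
  then show ?thesis
    by (auto simp: closure_monom_span)
qed

lemma psi_formula_unique: "psi_formula \<iota> V \<tau> \<psi> \<Longrightarrow> psi_formula \<iota> V \<tau> \<phi> \<Longrightarrow> \<psi> = \<phi>"
  unfolding psi_formula_def by (intro continuous_eq_on_monoms) auto

lemma psi_eqI: "psi_formula \<iota> V \<tau> \<psi> \<Longrightarrow> psi \<iota> V \<tau> = \<psi>"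
  unfolding psi_def by (rule the_equality) (auto intro: psi_formula_unique)

text \<open>For |z| = 1 the elements z V_i again satisfy the covariance relations with
  \<open>\<iota>\<close> inside the algebra itself, so the universal property supplies the
  map.\<close>

lemma gauge_exists:
  assumes z: "cmod z = 1"
  obtains \<theta> where "star_homo \<theta>" "\<And>a. \<theta> (\<iota> a) = \<iota> a" "\<And>i. \<theta> (V i) = z *\<^sub>C V i"
proof -
  let ?W = "\<lambda>i. z *\<^sub>C V i"
  have zz: "z * cnj z = 1"
    by (simp flip: complex_norm_square add: z)
  have "covariant \<alpha> type_cstar \<iota> ?W"
    unfolding covariant_def
  proof (intro conjI allI)
    show "star_hom type_cstar type_cstar \<iota>"
      by (simp add: star_hom_type_cstar iota)
    show "adj type_cstar (?W i) \<otimes>\<^bsub>type_cstar\<^esub> ?W j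
        = (if i = j then \<one>\<^bsub>type_cstar\<^esub> else \<zero>\<^bsub>type_cstar\<^esub>)" for i j
      by (simp add: star_scaleC mult_scaleC_left mult_scaleC_right scaleC_scaleC zz star_V_mult_V
          scaleC_one mult.commute)
  qed (simp_all add: iota_mult_V mult_scaleC_left mult_scaleC_right)
  moreover have "\<exists>p. nrm type_cstar (x \<ominus>\<^bsub>type_cstar\<^esub> poly_eval type_cstar \<iota> ?W p) < e"
    if e: "0 < e" for x e
  proof -
    let ?E = "poly_eval type_cstar \<iota> ?W"
    have scal: "c *\<^sub>C ?E p = ?E (Times (Coeff (c *\<^sub>C 1)) p)" for c p
      by (simp add: star_homoD[OF iota] mult_scaleC_left)
    have sub: "cstar.subspace (range ?E)"
      unfolding cstar.subspace_def
    proof (intro conjI ballI allI)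
      show "0 \<in> range ?E"
        by (rule range_eqI[of _ _ "Coeff 0"]) (simp add: star_homoD[OF iota])
      fix x y assume "x \<in> range ?E" "y \<in> range ?E"
      then obtain p q where "x = ?E p" "y = ?E q"
        by blast
      then show "x + y \<in> range ?E"
        by (intro range_eqI[of _ _ "Plus p q"]) simp
    qed (use scal in blast)
    have "closure (range ?E) = UNIV"
    proof (rule generates_iota_V[unfolded generates_def, rule_format], intro conjI ballI)
      have "\<iota> a \<in> range ?E" for a
        by (rule range_eqI[of _ _ "Coeff a"]) simp
      moreover have "V i \<in> range ?E" for i
      proof -
        \<comment> \<open>Rescaling recovers the original generators, so the polynomials in the
          rescaled ones are dense too.\<close>
        have "V i = cnj z *\<^sub>C ?E (Gen i)"
          by (simp add: scaleC_scaleC zz scaleC_one mult.commute)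
        then show ?thesis
          by (simp only: scal) (rule rangeI)
      qed
      ultimately show "range \<iota> \<union> range V \<subseteq> closure (range ?E)"
        using closure_subset by blast
      show "cstar.subspace (closure (range ?E))"
        by (rule subspace_closure[OF sub])
      fix x assume x: "x \<in> closure (range ?E)"
      then obtain f where f: "\<And>n. f n \<in> range ?E" "f \<longlonglongrightarrow> x"
        unfolding closure_sequential by blast
      have "star (f n) \<in> range ?E" for n
      proof -
        obtain p where "f n = ?E p"
          using f(1)[of n] by blast
        then show ?thesis
          by (intro range_eqI[of _ _ "Adj p"]) simp
      qed
      then show "star x \<in> closure (range ?E)"
        using bounded_linear.tendsto[OF bounded_linear_star f(2)] by (rule closure_sequentialI)
      fix y assume "y \<in> closure (range ?E)"
      then obtain g where g: "\<And>n. g n \<in> range ?E" "g \<longlonglongrightarrow> y"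
        unfolding closure_sequential by blast
      have "f n * g n \<in> range ?E" for n
      proof -
        obtain p q where "f n = ?E p" "g n = ?E q"
          using f(1)[of n] g(1)[of n] by blast
        then show ?thesis
          by (intro range_eqI[of _ _ "Times p q"]) simp
      qed
      then show "x * y \<in> closure (range ?E)"
        using tendsto_mult[OF f(2) g(2)] by (rule closure_sequentialI)
    qed simp
    then have "x \<in> closure (range ?E)"
      by simp
    then obtain y where "y \<in> range ?E" "dist y x < e"
      using e unfolding closure_approachable by blast
    then show ?thesis
      by (auto simp: dist_norm norm_minus_commute)
  qed
  ultimately show thesis
  proof (rule toeplitz_pimsner_universal[OF tp cstar_structure_type_cstar])
    fix \<Phi> assume \<Phi>: "star_hom type_cstar type_cstar \<Phi>" "\<And>a. \<Phi> (\<iota> a) = \<iota> a"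
      "\<And>i. \<Phi> (V i) = z *\<^sub>C V i"
    show thesis
      by (rule that[of \<Phi>]) (use \<Phi> in \<open>simp_all add: star_hom_type_cstar\<close>)
  qed
qed

text \<open>The definite description includes bijectivity. The inverse is the map for
  \<open>cnj z\<close>, as both compositions fix the generators; uniqueness is again agreement on
  generators.\<close>

lemma gauge_action:
  assumes z: "cmod z = 1"
  shows "star_homo (gauge_action \<iota> V z)" "gauge_action \<iota> V z (\<iota> a) = \<iota> a"
    "gauge_action \<iota> V z (V i) = z *\<^sub>C V i"
proof -
  let ?P = "\<lambda>z \<theta>. star_homo \<theta> \<and> (\<forall>a. \<theta> (\<iota> a) = \<iota> a) \<and> (\<forall>i. \<theta> (V i) = z *\<^sub>C V i)"
  have zz: "z * cnj z = 1"
    by (simp flip: complex_norm_square add: z)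
  obtain \<theta> where \<theta>: "?P z \<theta>"
    using gauge_exists[OF z] by metis
  obtain \<theta>' where \<theta>': "?P (cnj z) \<theta>'"
    by (rule gauge_exists[of "cnj z"]) (use z in auto)
  have id: "f \<circ> g = id" if "?P w f" "?P (cnj w) g" "w * cnj w = 1" for f g w
  proof (rule star_homo_eqI[OF generates_iota_V])
    show "star_homo (f \<circ> g)" "star_homo (id :: 'b \<Rightarrow> 'b)"
      using that by (simp_all add: star_homo_def)
    have f: "star_homo f"
      using that(1) by blast
    fix x assume "x \<in> range \<iota> \<union> range V"
    then show "(f \<circ> g) x = id x"
      using that by (auto simp: star_homoD[OF f] scaleC_scaleC scaleC_one mult.commute)
  qed
  have "\<theta> \<circ> \<theta>' = id"
    by (rule id[OF \<theta> \<theta>' zz])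
  moreover have "\<theta>' \<circ> \<theta> = id"
    by (rule id[OF \<theta>']) (use \<theta> zz in \<open>simp_all add: mult.commute\<close>)
  ultimately have "bij \<theta>"
    by (intro o_bij[of \<theta>'])
  have uniq: "\<theta>'' = \<theta>" if "?P z \<theta>''" for \<theta>''
  proof (rule star_homo_eqI[OF generates_iota_V])
    show "star_homo \<theta>''" "star_homo \<theta>"
      using that \<theta> by blast+
    fix x assume "x \<in> range \<iota> \<union> range V"
    then show "\<theta>'' x = \<theta> x"
      using that \<theta> by (metis UnE imageE)
  qed
  have "gauge_action \<iota> V z = \<theta>"
    unfolding gauge_action_def star_hom_type_cstar
  proof (rule the_equality)
    show "star_homo \<theta> \<and> bij \<theta> \<and> (\<forall>a. \<theta> (\<iota> a) = \<iota> a) \<and> (\<forall>i. \<theta> (V i) = z *\<^sub>C V i)"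
      using \<theta> \<open>bij \<theta>\<close> by blast
  qed (rule uniq, blast)
  then show "star_homo (gauge_action \<iota> V z)" "gauge_action \<iota> V z (\<iota> a) = \<iota> a"
    "gauge_action \<iota> V z (V i) = z *\<^sub>C V i"
    using \<theta> by blast+
qed

lemma gauge_action_V_word:
  assumes z: "cmod z = 1"
  shows "gauge_action \<iota> V z (V_word V \<mu>) = z ^ length \<mu> *\<^sub>C V_word V \<mu>"
proof (induction \<mu>)
  case Nil
  then show ?case
    by (simp add: star_homoD[OF gauge_action(1)[OF z]] scaleC_one)
next
  case (Cons i \<mu>)
  then show ?case
    by (simp add: star_homoD[OF gauge_action(1)[OF z]] gauge_action[OF z] mult_scaleC_left
        mult_scaleC_right scaleC_scaleC)
qed

lemma star_homo_time_evolution: "star_homo (time_evolution \<iota> V t)"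
  by (simp add: time_evolution_def gauge_action)

lemma time_evolution_monom:
  "time_evolution \<iota> V t (monom_elt \<iota> V \<mu> a \<nu>)
     = exp (\<i> * (of_nat (length \<mu>) - of_nat (length \<nu>)) * of_real t) *\<^sub>C monom_elt \<iota> V \<mu> a \<nu>"
proof -
  let ?z = "exp (\<i> * complex_of_real t)"
  have z: "cmod ?z = 1"
    by simp
  have "time_evolution \<iota> V t (monom_elt \<iota> V \<mu> a \<nu>)
      = (?z ^ length \<mu> * cnj ?z ^ length \<nu>) *\<^sub>C monom_elt \<iota> V \<mu> a \<nu>"
    unfolding time_evolution_def monom_elt_def
    by (simp add: star_homoD[OF gauge_action(1)[OF z]] gauge_action[OF z] gauge_action_V_word[OF z]
        mult_scaleC_left mult_scaleC_right scaleC_scaleC star_scaleC mult.commute)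
  also have "?z ^ length \<mu> * cnj ?z ^ length \<nu>
      = exp (\<i> * (of_nat (length \<mu>) - of_nat (length \<nu>)) * of_real t)"
    by (simp add: exp_cnj algebra_simps flip: exp_of_nat_mult exp_add)
  finally show ?thesis .
qed

end

section \<open>Ground states\<close>

lemma entire_extension_exp:
  assumes "\<And>t. \<sigma> t y = exp (c * of_real t) *\<^sub>C y"
  shows "entire_extension \<sigma> y (\<lambda>z. exp (c * z) *\<^sub>C y)"
  unfolding entire_extension_def
proof (intro conjI allI)
  fix z
  have "((\<lambda>z. exp (c * z)) has_field_derivative exp (c * z) * c) (at z)"
    by (auto intro!: derivative_eq_intros)
  then have "((\<lambda>w. ((exp (c * w) - exp (c * z)) / (w - z)) *\<^sub>C y) \<longlongrightarrow> (exp (c * z) * c) *\<^sub>C y) (at z)"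
    unfolding has_field_derivative_iff by (intro scaleC.tendsto tendsto_const)
  moreover have "((exp (c * w) - exp (c * z)) / (w - z)) *\<^sub>C y
      = inverse (w - z) *\<^sub>C (exp (c * w) *\<^sub>C y - exp (c * z) *\<^sub>C y)" for w
    by (simp add: scaleC.diff_left scaleC_scaleC divide_inverse mult.commute flip: scaleC.diff_left)
  ultimately show "\<exists>D. ((\<lambda>w. inverse (w - z) *\<^sub>C (exp (c * w) *\<^sub>C y - exp (c * z) *\<^sub>C y)) \<longlongrightarrow> D) (at z)"
    by auto
qed (simp add: assms)

lemma entire_extension_add:
  assumes "entire_extension \<sigma> x F" "entire_extension \<sigma> y G" "\<And>t. \<sigma> t (x + y) = \<sigma> t x + \<sigma> t y"
  shows "entire_extension \<sigma> (x + y) (\<lambda>z. F z + G z)"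
  unfolding entire_extension_def
proof (intro conjI allI)
  fix z
  obtain D E where "((\<lambda>w. inverse (w - z) *\<^sub>C (F w - F z)) \<longlongrightarrow> D) (at z)"
    "((\<lambda>w. inverse (w - z) *\<^sub>C (G w - G z)) \<longlongrightarrow> E) (at z)"
    using assms(1,2) unfolding entire_extension_def by blast
  then have "((\<lambda>w. inverse (w - z) *\<^sub>C (F w - F z) + inverse (w - z) *\<^sub>C (G w - G z)) \<longlongrightarrow> D + E) (at z)"
    by (rule tendsto_add)
  moreover have "inverse (w - z) *\<^sub>C (F w - F z) + inverse (w - z) *\<^sub>C (G w - G z)
      = inverse (w - z) *\<^sub>C (F w + G w - (F z + G z))" for w
    by (simp flip: scaleC_add_right)
  ultimately show "\<exists>D. ((\<lambda>w. inverse (w - z) *\<^sub>C (F w + G w - (F z + G z))) \<longlongrightarrow> D) (at z)"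
    by auto
qed (use assms in \<open>simp add: entire_extension_def\<close>)

lemma entire_extension_scaleC:
  assumes "entire_extension \<sigma> x F" "\<And>t. \<sigma> t (c *\<^sub>C x) = c *\<^sub>C \<sigma> t x"
  shows "entire_extension \<sigma> (c *\<^sub>C x) (\<lambda>z. c *\<^sub>C F z)"
  unfolding entire_extension_def
proof (intro conjI allI)
  fix z
  obtain D where "((\<lambda>w. inverse (w - z) *\<^sub>C (F w - F z)) \<longlongrightarrow> D) (at z)"
    using assms(1) unfolding entire_extension_def by blast
  then have "((\<lambda>w. c *\<^sub>C inverse (w - z) *\<^sub>C (F w - F z)) \<longlongrightarrow> c *\<^sub>C D) (at z)"
    by (intro scaleC.tendsto tendsto_const)
  moreover have "c *\<^sub>C inverse (w - z) *\<^sub>C (F w - F z)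
      = inverse (w - z) *\<^sub>C (c *\<^sub>C F w - c *\<^sub>C F z)" for w
    by (simp add: scaleC_scaleC mult.commute flip: scaleC.diff_right)
  ultimately show "\<exists>D. ((\<lambda>w. inverse (w - z) *\<^sub>C (c *\<^sub>C F w - c *\<^sub>C F z)) \<longlongrightarrow> D) (at z)"
    by auto
qed (use assms in \<open>simp add: entire_extension_def\<close>)

text \<open>\<open>ground_states\<close> offers some entire extension, given explicitly on the real
  axis only. Scalar holomorphy gives access to the identity theorem, which determines the function
  elsewhere; continuity of \<open>\<psi>\<close> moves it inside the limit of difference
  quotients.\<close>

lemma entire_extension_holomorphic:
  assumes F: "entire_extension \<sigma> y F" and \<psi>: "bounded_linear \<psi>" "linear_functional \<psi>"
  shows "(\<lambda>z. \<psi> (x * F z)) holomorphic_on UNIV"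
  unfolding holomorphic_on_open[OF open_UNIV]
proof (intro ballI)
  fix z
  note lin = linear_functionalD[OF \<psi>(2)]
  obtain D where "((\<lambda>w. inverse (w - z) *\<^sub>C (F w - F z)) \<longlongrightarrow> D) (at z)"
    using F unfolding entire_extension_def by blast
  then have "((\<lambda>w. \<psi> (x * (inverse (w - z) *\<^sub>C (F w - F z)))) \<longlongrightarrow> \<psi> (x * D)) (at z)"
    by (intro bounded_linear.tendsto[OF \<psi>(1)] tendsto_mult tendsto_const)
  moreover have "\<psi> (x * (inverse (w - z) *\<^sub>C (F w - F z))) = (\<psi> (x * F w) - \<psi> (x * F z)) / (w - z)" for w
    by (simp add: mult_scaleC_right right_diff_distrib lin divide_inverse mult.commute)
  ultimately show "\<exists>f'. ((\<lambda>z. \<psi> (x * F z)) has_field_derivative f') (at z)"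
    by (auto simp: has_field_derivative_iff)
qed

text \<open>The entire function \<open>z \<mapsto> e\<^sup>i\<^sup>n\<^sup>z g(z)\<close> is constant on the reals, so \<open>g(z) = c e\<^sup>-\<^sup>i\<^sup>n\<^sup>z\<close> everywhere,
  which grows like \<open>e\<^sup>n\<^sup>y\<close> along the positive imaginary axis.\<close>

lemma bounded_exp_negative_frequency:
  assumes hol: "g holomorphic_on UNIV" and n: "0 < n"
    and g: "\<And>t. g (complex_of_real t) = exp (- \<i> * of_nat n * of_real t) * c"
    and bdd: "bounded (g ` {z. 0 < Im z})"
  shows "c = 0"
proof (rule ccontr)
  assume c: "c \<noteq> 0"
  have eq: "exp (\<i> * of_nat n * z) * g z - c = 0" for z
  proof (rule analytic_continuation[of "\<lambda>z. exp (\<i> * of_nat n * z) * g z - c" UNIV \<real> 0])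
    show "(\<lambda>z. exp (\<i> * of_nat n * z) * g z - c) holomorphic_on UNIV"
      by (intro holomorphic_intros hol)
    show "(0::complex) islimpt \<real>"
      unfolding islimpt_sequential
    proof (intro exI[of _ "\<lambda>n. of_real (1 / real (Suc n))"] conjI allI)
      have "(\<lambda>n. complex_of_real (1 / real (Suc n))) \<longlonglongrightarrow> of_real 0"
        by (intro tendsto_of_real LIMSEQ_inverse_real_of_nat[unfolded inverse_eq_divide])
      then show "(\<lambda>n. complex_of_real (1 / real (Suc n))) \<longlonglongrightarrow> 0"
        by simp
    qed (auto simp del: of_nat_Suc)
    fix z :: complex assume "z \<in> \<real>"
    then obtain t where "z = of_real t"
      by (auto elim: Reals_cases)
    then show "exp (\<i> * of_nat n * z) * g z - c = 0"
      by (simp add: g mult.assoc flip: exp_add mult.assoc[of "exp _"])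
  qed auto
  obtain K where K: "\<And>z. 0 < Im z \<Longrightarrow> cmod (g z) \<le> K"
    using bdd by (auto simp: bounded_iff)
  \<comment> \<open>At this height (y - 1) |c| = K, and y <= n y < exp (n y) then puts the modulus
    exp (n y) |c| of g at i y above its bound K.\<close>
  define y where "y = K / cmod c + 1"
  have "0 \<le> K"
    using order_trans[OF norm_ge_zero K[of \<i>]] by simp
  then have y: "0 < y"
    by (simp add: y_def add_nonneg_pos)
  have "\<i> * of_nat n * (\<i> * of_real y) = of_real (- (n * y))"
    by (simp add: complex_eq_iff)
  then have "exp (\<i> * of_nat n * (\<i> * of_real y)) = of_real (exp (- (n * y)))"
    by (simp only: exp_of_real)
  then have "of_real (exp (- (n * y))) * g (\<i> * of_real y) = c"
    using eq[of "\<i> * of_real y"] by simp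
  then have "cmod (of_real (exp (- (n * y))) * g (\<i> * of_real y)) = cmod c"
    by simp
  then have "exp (- (n * y)) * cmod (g (\<i> * of_real y)) = cmod c"
    by (simp add: norm_mult)
  moreover have "exp (n * y) * exp (- (n * y)) = 1"
    by (simp flip: exp_add)
  ultimately have "cmod (g (\<i> * of_real y)) = exp (n * y) * cmod c"
    by (metis mult.assoc mult_1)
  moreover have "cmod (g (\<i> * of_real y)) \<le> K"
    using y by (intro K) simp
  moreover have "y < exp (n * y)"
  proof -
    have "y \<le> n * y"
      using n y by simp
    also have "\<dots> < exp (n * y)"
      using exp_ge_add_one_self[of "n * y"] by linarith
    finally show ?thesis .
  qed
  then have "(y - 1) * cmod c < exp (n * y) * cmod c"
    using c by (intro mult_strict_right_mono) auto
  then have "K < exp (n * y) * cmod c"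
    using c by (simp add: y_def)
  ultimately show False
    by simp
qed

context toeplitz_system
begin

text \<open>Entire extensions add and scale along with \<open>y\<close>, so induction over the span
  leaves single monomials, whose extension is an explicit exponential.\<close>

lemma ground_state_if_annihilates:
  assumes \<psi>: "linear_functional \<psi>"
    and null: "\<And>x \<mu> a \<nu>. \<nu> \<noteq> [] \<Longrightarrow> \<psi> (x * monom_elt \<iota> V \<mu> a \<nu>) = 0"
    and y: "y \<in> monom_span \<iota> V"
  shows "\<exists>F. entire_extension (time_evolution \<iota> V) y F
    \<and> bounded ((\<lambda>z. \<psi> (x * F z)) ` {z. 0 < Im z})"
  using y
proof (induction rule: monom_span_induct)
  case zero
  have "entire_extension (time_evolution \<iota> V) 0 (\<lambda>z. exp (0 * z) *\<^sub>C 0)"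
    by (rule entire_extension_exp) (simp add: star_homoD[OF star_homo_time_evolution])
  then show ?case
    by (intro exI[of _ "\<lambda>z. 0"] conjI boundedI[of _ 0]) (auto simp: linear_functionalD[OF \<psi>])
next
  case (add u v)
  then obtain F G where F: "entire_extension (time_evolution \<iota> V) u F"
      "bounded ((\<lambda>z. \<psi> (x * F z)) ` {z. 0 < Im z})"
    and G: "entire_extension (time_evolution \<iota> V) v G"
      "bounded ((\<lambda>z. \<psi> (x * G z)) ` {z. 0 < Im z})"
    by blast
  have "entire_extension (time_evolution \<iota> V) (u + v) (\<lambda>z. F z + G z)"
    by (rule entire_extension_add[OF F(1) G(1)]) (simp add: star_homoD[OF star_homo_time_evolution])
  moreover have "bounded ((\<lambda>z. \<psi> (x * (F z + G z))) ` {z. 0 < Im z})"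
    using bounded_plus_comp[OF F(2) G(2)] by (simp add: distrib_left linear_functionalD[OF \<psi>])
  ultimately show ?case
    by (intro exI conjI)
next
  case (scale c u)
  then obtain F where F: "entire_extension (time_evolution \<iota> V) u F"
      "bounded ((\<lambda>z. \<psi> (x * F z)) ` {z. 0 < Im z})"
    by blast
  have "entire_extension (time_evolution \<iota> V) (c *\<^sub>C u) (\<lambda>z. c *\<^sub>C F z)"
    by (rule entire_extension_scaleC[OF F(1)]) (simp add: star_homoD[OF star_homo_time_evolution])
  moreover have "bounded ((\<lambda>w. c * w) ` (\<lambda>z. \<psi> (x * F z)) ` {z. 0 < Im z})"
    by (intro bounded_linear_image[OF F(2)] bounded_linear_mult_right)
  then have "bounded ((\<lambda>z. \<psi> (x * (c *\<^sub>C F z))) ` {z. 0 < Im z})"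
    by (simp add: mult_scaleC_right linear_functionalD[OF \<psi>] image_image)
  ultimately show ?case
    by (intro exI conjI)
next
  case (monom \<mu> a \<nu>)
  let ?c = "\<i> * (of_nat (length \<mu>) - of_nat (length \<nu>))"
  have "entire_extension (time_evolution \<iota> V) (monom_elt \<iota> V \<mu> a \<nu>)
      (\<lambda>z. exp (?c * z) *\<^sub>C monom_elt \<iota> V \<mu> a \<nu>)"
    by (rule entire_extension_exp) (rule time_evolution_monom)
  moreover have "bounded ((\<lambda>z. \<psi> (x * (exp (?c * z) *\<^sub>C monom_elt \<iota> V \<mu> a \<nu>))) ` {z. 0 < Im z})"
  proof (rule boundedI, safe)
    fix z :: complex assume z: "0 < Im z"
    \<comment> \<open>For \<open>\<nu> = []\<close> the modulus is exp of - |mu| Im z, at most 1 on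
      the upper half plane; for other \<open>\<nu>\<close> the assumption \<open>null\<close> makes
      the function vanish.\<close>
    have "cmod (exp (?c * z)) \<le> 1" if "\<nu> = []"
      using z that by simp
    then show "cmod (\<psi> (x * (exp (?c * z) *\<^sub>C monom_elt \<iota> V \<mu> a \<nu>)))
        \<le> cmod (\<psi> (x * monom_elt \<iota> V \<mu> a \<nu>))"
      using null[of \<nu> x \<mu> a]
      by (cases "\<nu> = []")
        (simp_all add: mult_scaleC_right linear_functionalD[OF \<psi>] norm_mult mult_left_le_one_le
          del: norm_exp_eq_Re)
  qed
  ultimately show ?case
    by (intro exI conjI)
qed

lemma psi_formula_ground_state:
  assumes \<psi>: "\<psi> \<in> states" and formula: "psi_formula \<iota> V \<tau> \<psi>"
  shows "\<psi> \<in> TP_ground_states \<iota> V"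
proof -
  have pos: "positive_functional \<psi>" and lin: "linear_functional \<psi>"
    using \<psi> by (simp_all add: states_iff positive_functional_def)
  have "\<psi> (x * monom_elt \<iota> V \<mu> a \<nu>) = 0" if "\<nu> \<noteq> []" for x \<mu> a \<nu>
  proof -
    let ?w = "star (x * V_word V \<mu> * \<iota> a)"
    \<comment> \<open>This monomial has two nonempty words, so \<open>\<psi>\<close> vanishes on it,
      and it is the second factor in Cauchy-Schwarz.\<close>
    have "V_word V \<nu> * star (V_word V \<nu>) = monom_elt \<iota> V \<nu> 1 \<nu>"
      by (simp add: monom_elt_def star_homoD[OF iota])
    then have "\<psi> (star (star (V_word V \<nu>)) * star (V_word V \<nu>)) = 0"
      using formula that by (simp add: psi_formula_def star_star)
    then have "(cmod (\<psi> (star ?w * star (V_word V \<nu>))))\<^sup>2 \<le> 0"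
      using positive_functional_Cauchy_Schwarz[OF pos, of ?w "star (V_word V \<nu>)"] by simp
    then show ?thesis
      by (simp add: star_star monom_elt_def mult.assoc)
  qed
  then show ?thesis
    using \<psi> ground_state_if_annihilates[OF lin]
    by (simp add: TP_ground_states_def ground_states_def)
qed

lemma ground_state_psi_formula:
  assumes "\<psi> \<in> TP_ground_states \<iota> V"
  shows "psi_formula \<iota> V (\<psi> \<circ> \<iota>) \<psi>"
proof -
  have \<psi>: "\<psi> \<in> states" and ground: "\<And>x y. x \<in> monom_span \<iota> V \<Longrightarrow> y \<in> monom_span \<iota> V \<Longrightarrow>
      \<exists>F. entire_extension (time_evolution \<iota> V) y F
        \<and> bounded ((\<lambda>z. \<psi> (x * F z)) ` {z. 0 < Im z})"
    using assms by (simp_all add: TP_ground_states_def ground_states_def)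
  have pos: "positive_functional \<psi>" and lin: "linear_functional \<psi>"
    using \<psi> by (simp_all add: states_iff positive_functional_def)
  have bl: "bounded_linear \<psi>"
    by (rule state_bounded_linear[OF \<psi>])
  have zero: "\<psi> (monom_elt \<iota> V \<mu> a \<nu>) = 0" if \<nu>: "\<nu> \<noteq> []" for \<mu> a \<nu>
  proof -
    \<comment> \<open>All of V_mu a goes into \<open>?x\<close>, so that \<open>?y\<close> has the
      negative frequency - |nu| however long \<open>\<mu>\<close> is; the frequency |mu| - |nu| of
      the whole monomial could have either sign.\<close>
    let ?x = "monom_elt \<iota> V \<mu> a []" and ?y = "monom_elt \<iota> V [] 1 \<nu>"
    obtain F where F: "entire_extension (time_evolution \<iota> V) ?y F"
        "bounded ((\<lambda>z. \<psi> (?x * F z)) ` {z. 0 < Im z})"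
      using ground monom_elt_in_span by blast
    have "\<psi> (?x * ?y) = 0"
    proof (rule bounded_exp_negative_frequency[OF _ _ _ F(2)])
      show "(\<lambda>z. \<psi> (?x * F z)) holomorphic_on UNIV"
        by (rule entire_extension_holomorphic[OF F(1) bl lin])
      show "\<psi> (?x * F (of_real t)) = exp (- \<i> * of_nat (length \<nu>) * of_real t) * \<psi> (?x * ?y)" for t
        using F(1) by (simp add: entire_extension_def time_evolution_monom mult_scaleC_right
            linear_functionalD[OF lin])
    qed (use \<nu> in simp)
    then show ?thesis
      by (simp add: monom_elt_def star_homoD[OF iota] mult.assoc)
  qed
  \<comment> \<open>These monomials have positive frequency, where boundedness on the upper half
    plane says nothing; they vanish as adjoints of monomials already treated, \<open>\<psi>\<close>
    being Hermitian.\<close>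
  have zero': "\<psi> (monom_elt \<iota> V \<mu> a []) = 0" if "\<mu> \<noteq> []" for \<mu> a
  proof -
    have "star (monom_elt \<iota> V [] (star a) \<mu>) = monom_elt \<iota> V \<mu> a []"
      by (simp add: monom_elt_def star_mult star_star star_homoD[OF iota])
    then show ?thesis
      using positive_functional_star[OF pos, of "monom_elt \<iota> V [] (star a) \<mu>"] zero[OF that]
      by simp
  qed
  show ?thesis
    unfolding psi_formula_def
  proof (intro conjI allI)
    show "continuous_on UNIV \<psi>"
      by (rule linear_continuous_on[OF bl])
    show "\<psi> (monom_elt \<iota> V \<mu> a \<nu>) = (if \<mu> = [] \<and> \<nu> = [] then (\<psi> \<circ> \<iota>) a else 0)" for \<mu> a \<nu>
    proof (cases "\<mu> = [] \<and> \<nu> = []")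
      case False
      then show ?thesis
        using zero[of \<nu> \<mu> a] zero'[of \<mu> a] by auto
    qed (simp add: monom_elt_def)
  qed (rule lin)
qed

end

section \<open>The homeomorphism\<close>

lemma topspace_weak_star [simp]: "topspace (weak_star S) = S"
  by (simp add: weak_star_def)

lemma continuous_map_weak_star_eval: "continuous_map (weak_star S) euclidean (\<lambda>\<psi>. \<psi> x)"
  unfolding weak_star_def
  by (intro continuous_map_from_subtopology continuous_map_product_projection) simp

lemma continuous_map_into_weak_star:
  assumes "f \<in> topspace X \<rightarrow> S" "\<And>x. continuous_map X euclidean (\<lambda>\<tau>. f \<tau> x)"
  shows "continuous_map X (weak_star S) f"
  using assms by (auto simp: weak_star_def continuous_map_in_subtopology continuous_map_componentwise_UNIV)

context toeplitz_system
begin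

text \<open>The vacuum state satisfies the formula and is the only functional to do so; hence the
  definite description \<open>psi\<close> denotes it and inherits its positivity.\<close>

lemma psi_state:
  assumes "\<tau> \<in> states"
  shows "psi \<iota> V \<tau> \<in> states" "psi_formula \<iota> V \<tau> (psi \<iota> V \<tau>)"
proof -
  obtain \<psi> where \<psi>: "\<psi> \<in> states"
    "\<And>\<mu> a \<nu>. \<psi> (monom_elt \<iota> V \<mu> a \<nu>) = (if \<mu> = [] \<and> \<nu> = [] then \<tau> a else 0)"
    using toeplitz_pimsner_vacuum_state[OF tp endo assms] by blast
  have "psi_formula \<iota> V \<tau> \<psi>"
    using \<psi> linear_continuous_on[OF state_bounded_linear[OF \<psi>(1)]]
    by (auto simp: psi_formula_def states_def)
  moreover from this have "psi \<iota> V \<tau> = \<psi>"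
    by (rule psi_eqI)
  ultimately show "psi \<iota> V \<tau> \<in> states" "psi_formula \<iota> V \<tau> (psi \<iota> V \<tau>)"
    using \<psi>(1) by simp_all
qed

lemma psi_monom:
  "\<tau> \<in> states \<Longrightarrow>
    psi \<iota> V \<tau> (monom_elt \<iota> V \<mu> a \<nu>) = (if \<mu> = [] \<and> \<nu> = [] then \<tau> a else 0)"
  using psi_state(2) by (simp add: psi_formula_def)

lemma psi_linear: "\<tau> \<in> states \<Longrightarrow> linear_functional (psi \<iota> V \<tau>)"
  using psi_state(2) by (simp add: psi_formula_def)

lemma psi_ground_state: "\<tau> \<in> states \<Longrightarrow> psi \<iota> V \<tau> \<in> TP_ground_states \<iota> V"
  using psi_state by (rule psi_formula_ground_state)

lemma psi_restrict: "\<tau> \<in> states \<Longrightarrow> psi \<iota> V \<tau> \<circ> \<iota> = \<tau>"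
  using psi_monom[of \<tau> "[]" _ "[]"] by (simp add: fun_eq_iff monom_elt_def)

lemma state_restrict:
  assumes "\<psi> \<in> states"
  shows "\<psi> \<circ> \<iota> \<in> states"
proof -
  have "linear_functional \<psi>" and pos: "\<And>x. Im (\<psi> (star x * x)) = 0 \<and> 0 \<le> Re (\<psi> (star x * x))"
    and one: "\<psi> 1 = 1"
    using assms by (auto simp: states_def)
  note lin = linear_functionalD[OF this(1)]
  have "linear_functional (\<psi> \<circ> \<iota>)"
    by (simp add: linear_functional_iff star_homoD[OF iota] lin)
  moreover have "Im ((\<psi> \<circ> \<iota>) (star x * x)) = 0 \<and> 0 \<le> Re ((\<psi> \<circ> \<iota>) (star x * x))" for x
    using pos[of "\<iota> x"] by (simp add: star_homoD[OF iota])
  ultimately show ?thesis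
    by (simp add: states_def star_homoD[OF iota] one)
qed

lemma psi_surj:
  assumes "\<psi> \<in> TP_ground_states \<iota> V"
  shows "psi \<iota> V (\<psi> \<circ> \<iota>) = \<psi>"
  by (rule psi_eqI[OF ground_state_psi_formula[OF assms]])

text \<open>By uniqueness it suffices that the combination of the two images satisfies the formula
  for the combination of \<open>\<phi>\<close> and \<open>\<tau>\<close>.\<close>

lemma psi_affine: "affine_map_on states (psi \<iota> V)"
  unfolding affine_map_on_def
proof (intro ballI allI impI)
  fix \<phi> \<tau> :: "'a \<Rightarrow> complex" and t :: real
  assume \<phi>: "\<phi> \<in> states" and \<tau>: "\<tau> \<in> states"
  note lin = linear_functionalD[OF psi_linear[OF \<phi>]] linear_functionalD[OF psi_linear[OF \<tau>]]
  have cont: "continuous_on UNIV (psi \<iota> V \<phi>)" "continuous_on UNIV (psi \<iota> V \<tau>)"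
    using psi_state(2)[OF \<phi>] psi_state(2)[OF \<tau>] by (simp_all add: psi_formula_def)
  show "psi \<iota> V (\<lambda>a. of_real t * \<phi> a + of_real (1 - t) * \<tau> a)
      = (\<lambda>x. of_real t * psi \<iota> V \<phi> x + of_real (1 - t) * psi \<iota> V \<tau> x)"
  proof (rule psi_eqI, unfold psi_formula_def, intro conjI allI)
    show "linear_functional (\<lambda>x. of_real t * psi \<iota> V \<phi> x + of_real (1 - t) * psi \<iota> V \<tau> x)"
      unfolding linear_functional_iff by (simp only: lin) (simp add: algebra_simps)
    show "continuous_on UNIV (\<lambda>x. of_real t * psi \<iota> V \<phi> x + of_real (1 - t) * psi \<iota> V \<tau> x)"
      by (intro continuous_intros cont)
  qed (simp add: psi_monom[OF \<phi>] psi_monom[OF \<tau>])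
qed

lemma continuous_map_psi_monom_span:
  assumes "y \<in> monom_span \<iota> V"
  shows "continuous_map (weak_star states) euclidean (\<lambda>\<tau>. psi \<iota> V \<tau> y)"
  using assms
proof (induction rule: monom_span_induct)
  case zero
  show ?case
    by (rule continuous_map_eq[of _ _ "\<lambda>_. 0"]) (simp_all add: linear_functionalD[OF psi_linear])
next
  case (add x y)
  have "continuous_map (weak_star states) euclidean (\<lambda>\<tau>. psi \<iota> V \<tau> x + psi \<iota> V \<tau> y)"
    by (intro continuous_map_add add)
  then show ?case
    by (rule continuous_map_eq) (simp add: linear_functionalD[OF psi_linear])
next
  case (scale c x)
  have "continuous_map (weak_star states) euclidean ((\<lambda>z. c * z) \<circ> (\<lambda>\<tau>. psi \<iota> V \<tau> x))"
    by (rule continuous_map_compose[OF scale])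
      (auto simp: continuous_map_iff_continuous2 intro!: continuous_intros)
  then show ?case
    by (rule continuous_map_eq) (simp add: linear_functionalD[OF psi_linear])
next
  case (monom \<mu> a \<nu>)
  have "continuous_map (weak_star states) euclidean
      (\<lambda>\<tau>. if \<mu> = [] \<and> \<nu> = [] then \<tau> a else (0::complex))"
    by (cases "\<mu> = [] \<and> \<nu> = []") (simp_all add: continuous_map_weak_star_eval)
  then show ?case
    by (rule continuous_map_eq) (simp add: psi_monom)
qed

text \<open>Every image is a state, so its values at \<open>y n\<close> and \<open>x\<close> differ
  by at most norm (y n - x), uniformly in \<open>\<tau>\<close>. One sequence in the span with limit
  \<open>x\<close> thus exhibits a uniform limit of continuous functions.\<close>

lemma continuous_map_psi: "continuous_map (weak_star states) euclidean (\<lambda>\<tau>. psi \<iota> V \<tau> x)"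
proof -
  obtain y where y: "\<And>n. y n \<in> monom_span \<iota> V" "y \<longlonglongrightarrow> x"
    using closure_monom_span unfolding closure_sequential set_eq_iff by blast
  have "continuous_map (weak_star states) Met_TC.mtopology (\<lambda>\<tau>. psi \<iota> V \<tau> x)"
  proof (rule Met_TC.continuous_map_uniform_limit)
    show "\<forall>\<^sub>F n in sequentially.
        continuous_map (weak_star states) Met_TC.mtopology (\<lambda>\<tau>. psi \<iota> V \<tau> (y n))"
      using continuous_map_psi_monom_span[OF y(1)] by (simp add: mtopology_is_euclidean)
    fix e :: real assume "0 < e"
    then have "\<forall>\<^sub>F n in sequentially. dist (y n) x < e"
      using y(2) by (simp add: tendsto_iff)
    then show "\<forall>\<^sub>F n in sequentially. \<forall>\<tau>\<in>topspace (weak_star states).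
        psi \<iota> V \<tau> x \<in> UNIV \<and> dist (psi \<iota> V \<tau> (y n)) (psi \<iota> V \<tau> x) < e"
    proof eventually_elim
      case (elim n)
      have "dist (psi \<iota> V \<tau> (y n)) (psi \<iota> V \<tau> x) \<le> dist (y n) x" if "\<tau> \<in> states" for \<tau>
        using state_norm_le[OF psi_state(1)[OF that], of "y n - x"]
        by (simp add: dist_norm linear_functionalD[OF psi_linear[OF that]])
      then show ?case
        using elim by fastforce
    qed
  qed simp
  then show ?thesis
    by (simp add: mtopology_is_euclidean)
qed

text \<open>The inverse is restriction along \<open>\<iota>\<close>; it is continuous because its
  value at a is evaluation at \<open>\<iota> a\<close>.\<close>

lemma psi_homeomorphic:
  "homeomorphic_map (weak_star states) (weak_star (TP_ground_states \<iota> V)) (psi \<iota> V)"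
proof (rule homeomorphic_maps_imp_map)
  show "homeomorphic_maps (weak_star states) (weak_star (TP_ground_states \<iota> V))
      (psi \<iota> V) (\<lambda>\<psi>. \<psi> \<circ> \<iota>)"
    unfolding homeomorphic_maps_def
  proof (intro conjI ballI)
    show "continuous_map (weak_star states) (weak_star (TP_ground_states \<iota> V)) (psi \<iota> V)"
      by (intro continuous_map_into_weak_star continuous_map_psi) (simp add: psi_ground_state)
    show "continuous_map (weak_star (TP_ground_states \<iota> V)) (weak_star states) (\<lambda>\<psi>. \<psi> \<circ> \<iota>)"
      by (intro continuous_map_into_weak_star)
        (auto simp: continuous_map_weak_star_eval TP_ground_states_def ground_states_def
          intro!: state_restrict)
  qed (simp_all add: psi_restrict psi_surj)
qed

end

text \<open>\<open>psi\<close> is a definite description; the first conjunct shows that it denotes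
  the functional of the formula, which gives the other two their intended meaning.\<close>

theorem proposition3p4:
  fixes \<alpha> :: "'d::finite \<Rightarrow> 'a::cstar_algebra \<Rightarrow> 'a"
    and \<iota> :: "'a \<Rightarrow> 'b::cstar_algebra"
    and V :: "'d \<Rightarrow> 'b"
  assumes "dynamical_system \<alpha>"
    and "toeplitz_pimsner \<alpha> \<iota> V"
  shows "(\<forall>\<tau>\<in>states. \<exists>!\<psi>. psi_formula \<iota> V \<tau> \<psi>)
    \<and> affine_map_on states (psi \<iota> V)
    \<and> homeomorphic_map (weak_star states) (weak_star (TP_ground_states \<iota> V)) (psi \<iota> V)"
proof -
  interpret toeplitz_system \<alpha> \<iota> V
    using assms by unfold_locales
  show ?thesis
    using psi_state(2) psi_formula_unique psi_affine psi_homeomorphic by blast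
qed

end
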